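(* As $n\to\infty$, \[ \psi(n)=\left(1+e^{-\Omega(n^2)}\right)Z(C_n,1). \]
   Context: $\psi(n)$ is the total number of antichains (families of pairwise inclusion-incomparable sets, including the empty one) in the Boolean lattice $B_n=(2^{[n]},\subseteq)$. $C_n$ is the union of the layers $\binom{[n]}{i}$ with $\lfloor n/2\rfloor-1\le i\le\lceil n/2\rceil+1$, and $Z(C_n,1)$ is the number of antichains contained in $C_n$. *)

theory Defs
  imports Complex_Main "HOL-Library.Landau_Symbols"
begin

definition antichain :: "'a set set \<Rightarrow> bool" where
  "antichain F \<longleftrightarrow> pairwise (\<lambda>A B. \<not> A \<subseteq> B \<and> \<not> B \<subseteq> A) F"

definition num_antichains :: "'a set set \<Rightarrow> nat" where
  "num_antichains P = card {F. F \<subseteq> P \<and> antichain F}"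

definition boolean_lattice :: "nat \<Rightarrow> nat set set" where
  "boolean_lattice n = Pow {1..n}"

definition psi :: "nat \<Rightarrow> nat" where
  "psi n = num_antichains (boolean_lattice n)"

text \<open>The bounds are compared as integers, since the lower one is negative for \<open>n \<le> 1\<close>.\<close>

definition central_layers :: "nat \<Rightarrow> nat set set" where
  "central_layers n = {A \<in> boolean_lattice n.
     \<lfloor>real n / 2\<rfloor> - 1 \<le> int (card A) \<and> int (card A) \<le> \<lceil>real n / 2\<rceil> + 1}"

end

(* For downsets D of the levels i..k, let a be a set of size k with 2k >= n + 4. We show that
   P(a in D) <= exp(-c n^2) for uniform D; summing over a peels off level k at a relative cost
   exp(-c n^2), and complementation peels off the bottom levels.

   Call sets of one level linked when their shadows meet. First, the components of D in the top level k
   are small (shadow below n^4): deleting a component frees its whole shadow, so a component G has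
   probability at most 2^-|shadow G|, and the sum of these weights over large G is tiny. Then take the
   component G of D in level k-1 that contains the shadow of a. Deleting G together with the top sets
   above it frees the shadow of G, which has at least n^2/8 elements. The weight of G is now multiplied by
   the number of families of small top components lying above G.

   Sums over components are bounded by edge isoperimetry and a count of connected sets when the shadow is
   small, and otherwise by certificates in the style of Sapozhenko's graph containers. If the closure of G
   is much smaller than its shadow g, a greedy cover of the shadow determines it up to few elements. If
   closure and shadow almost agree, covering the shadow by second neighbourhoods costs only g / d^(1+c)
   elements, and Finner's inequality (the Hoelder bound for local functions on a product of two-point
   spaces) gains a factor 2^(-c g / d), because a set has more sets in its shadow than a set of the level
   below has sets above it. *)

theory Submission
  imports Defs "HOL-Analysis.Analysis" "HOL-Real_Asymp.Real_Asymp"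
begin

section \<open>Finner's inequality on the discrete cube\<close>

text \<open>Deleting only the component of \<open>a\<close> in the top level guarantees no more than
  a factor 2^-k, that is exp(-c n). One level further down, the shadow of the shadow of
  \<open>a\<close> has k choose 2 points; this is the origin of n^2. Both levels need more sets
  below a set than above a set of the next level, hence 2k >= n + 4, and peeling stops exactly at
  the top of the central band. The obstacle is a component G whose closure is about as large as its
  shadow, of size g: such a closure has about 2^g subsets, so the trivial count cancels the weight
  2^-g. The degree gap gains a mere 2^-(c g / d), so everything that a certificate records may cost
  only o(g / d) bits. The threshold n^4 separates two regimes: below it the logarithm in the
  isoperimetric inequality is O(log n), above it 2^-(n^4 / (2n)) outweighs the roughly 2^n roots and
  2^n shadow sizes. The families above G have small components so that their total weight is
  subexponential in the room they have, which the gain absorbs.\<close>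

lemma prod_powr_le_weighted_mean:
  fixes a :: "'a \<Rightarrow> real"
  assumes fin: "finite J" and "card J \<le> d" "d > 0" and pos: "\<And>y. y \<in> J \<Longrightarrow> a y > 0"
  shows "(\<Prod>y\<in>J. a y powr (1 / d)) \<le> 1 + (\<Sum>y\<in>J. a y - 1) / d"
proof -
  define m where "m = 1 + (\<Sum>y\<in>J. a y - 1) / d"
  have m_eq: "m = (1 - card J / d) + (\<Sum>y\<in>J. a y) / d"
    by (simp add: m_def sum_subtractf diff_divide_distrib)
  have frac: "0 \<le> 1 - card J / d" using assms by simp
  have "m > 0"
  proof (cases "J = {}")
    case False
    then have "(\<Sum>y\<in>J. a y) / d > 0" using assms by (simp add: sum_pos)
    then show ?thesis using frac m_eq by linarith
  qed (simp add: m_def)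
  \<comment> \<open>The tangent of the logarithm at the claimed mean \<open>m\<close>. The d - |J|
    missing factors count as ones; they are handled by the same tangent bound, evaluated at
    1.\<close>
  have 1: "ln (a y) \<le> ln m + a y / m - 1" if "y \<in> J" for y
    using ln_le_minus_one[of "a y / m"] pos[OF that] \<open>m > 0\<close> by (simp add: ln_div)
  have "(\<Sum>y\<in>J. ln (a y)) / d \<le> (\<Sum>y\<in>J. ln m + a y / m - 1) / d"
    using 1 by (intro divide_right_mono sum_mono) auto
  also have "\<dots> = card J / d * (ln m - 1) + (\<Sum>y\<in>J. a y) / d / m"
    by (simp add: sum.distrib sum_subtractf sum_divide_distrib[symmetric] add_divide_distrib
        diff_divide_distrib right_diff_distrib mult.commute)
  also have "\<dots> = card J / d * (ln m - 1) + (m - (1 - card J / d)) / m"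
    using m_eq by simp
  also have "\<dots> = ln m - (1 - card J / d) * (ln m + 1 / m - 1)"
  proof -
    define c where "c = card J / d"
    have "(m - (1 - c)) / m = 1 - (1 - c) * (1 / m)"
      using \<open>m > 0\<close> by (simp add: diff_divide_distrib)
    then show ?thesis unfolding c_def[symmetric] by (simp only:) (simp add: algebra_simps)
  qed
  also have "\<dots> \<le> ln m"
    using ln_le_minus_one[of "1 / m"] \<open>m > 0\<close> frac by (simp add: ln_div)
  finally have "exp ((\<Sum>y\<in>J. ln (a y)) / d) \<le> m"
    using \<open>m > 0\<close> by (simp add: ln_ge_iff)
  moreover have "exp ((\<Sum>y\<in>J. ln (a y)) / d) = (\<Prod>y\<in>J. a y powr (1 / d))"
    using pos by (simp add: sum_divide_distrib exp_sum fin powr_def less_imp_neq[symmetric])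
  ultimately show ?thesis by (simp add: m_def)
qed

text \<open>Hoelder with d exponents 1/d on a two-point space. Each of the d - |J| absent functions
  acts as the constant 1, whose sum over two points is 2, and contributes 2^(1/d).\<close>

lemma Hoelder_two_points:
  fixes u v :: "'a \<Rightarrow> real"
  assumes fin: "finite J" and card: "card J \<le> d" "d > 0"
    and u: "\<And>y. y \<in> J \<Longrightarrow> u y > 0" and v: "\<And>y. y \<in> J \<Longrightarrow> v y > 0"
  shows "(\<Prod>y\<in>J. u y powr (1 / d)) + (\<Prod>y\<in>J. v y powr (1 / d))
    \<le> 2 powr (1 - card J / d) * (\<Prod>y\<in>J. (u y + v y) powr (1 / d))"
proof -
  \<comment> \<open>Normalising each pair to sum 2 makes the two weighted means add up to exactly
    2.\<close>
  define p q where "p y = 2 * u y / (u y + v y)" and "q y = 2 * v y / (u y + v y)" for y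
  have pq: "p y > 0" "q y > 0" "p y + q y = 2" if "y \<in> J" for y
  proof -
    have s: "u y + v y > 0" using u[OF that] v[OF that] by simp
    then show "p y > 0" "q y > 0" using u[OF that] v[OF that] by (simp_all add: p_def q_def)
    have "p y + q y = 2 * (u y + v y) / (u y + v y)"
      by (simp add: p_def q_def add_divide_distrib distrib_left)
    then show "p y + q y = 2" using s by (metis nonzero_mult_div_cancel_right less_irrefl)
  qed
  have half: "(\<Prod>y\<in>J. (1 / 2) powr (1 / d)) = (2 powr (- (card J / d)) :: real)"
    by (simp add: powr_divide powr_minus inverse_eq_divide power_divide powr_power)
  have scale: "(\<Prod>y\<in>J. w y powr (1 / d)) =
      2 powr (- (card J / d)) * (\<Prod>y\<in>J. (u y + v y) powr (1 / d)) *
      (\<Prod>y\<in>J. (2 * w y / (u y + v y)) powr (1 / d))" if w: "\<And>y. y \<in> J \<Longrightarrow> w y > 0" for w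
  proof -
    have "w y powr (1 / d) =
        (1 / 2) powr (1 / d) * (u y + v y) powr (1 / d) * (2 * w y / (u y + v y)) powr (1 / d)"
      if y: "y \<in> J" for y
    proof -
      have s: "u y + v y > 0" using u[OF y] v[OF y] by simp
      have "w y = (1 / 2) * (u y + v y) * (2 * w y / (u y + v y))" using s by simp
      then show ?thesis
        by (metis powr_mult)
    qed
    then show ?thesis unfolding half[symmetric] prod.distrib[symmetric] by (intro prod.cong) auto
  qed
  have u': "(\<Prod>y\<in>J. u y powr (1 / d)) = 2 powr (- (card J / d)) *
      (\<Prod>y\<in>J. (u y + v y) powr (1 / d)) * (\<Prod>y\<in>J. p y powr (1 / d))"
    unfolding p_def using u by (rule scale)
  have v': "(\<Prod>y\<in>J. v y powr (1 / d)) = 2 powr (- (card J / d)) *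
      (\<Prod>y\<in>J. (u y + v y) powr (1 / d)) * (\<Prod>y\<in>J. q y powr (1 / d))"
    unfolding q_def using v by (rule scale)
  have "(\<Prod>y\<in>J. p y powr (1 / d)) + (\<Prod>y\<in>J. q y powr (1 / d))
      \<le> (1 + (\<Sum>y\<in>J. p y - 1) / d) + (1 + (\<Sum>y\<in>J. q y - 1) / d)"
    using pq by (intro add_mono prod_powr_le_weighted_mean fin card) auto
  also have "\<dots> = 2 + (\<Sum>y\<in>J. p y + q y - 2) / d"
    by (simp add: sum.distrib sum_subtractf add_divide_distrib diff_divide_distrib)
  also have "\<dots> = 2" using pq by simp
  finally have "(\<Prod>y\<in>J. p y powr (1 / d)) + (\<Prod>y\<in>J. q y powr (1 / d)) \<le> 2" .
  moreover have two: "2 powr (1 - card J / d) = 2 * (2 :: real) powr (- (card J / d))"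
    by (simp add: powr_diff powr_minus_divide)
  ultimately have "2 powr (- (card J / d)) * (\<Prod>y\<in>J. (u y + v y) powr (1 / d)) *
      ((\<Prod>y\<in>J. p y powr (1 / d)) + (\<Prod>y\<in>J. q y powr (1 / d)))
    \<le> 2 powr (- (card J / d)) * (\<Prod>y\<in>J. (u y + v y) powr (1 / d)) * 2"
    by (intro mult_left_mono) (simp_all add: prod_nonneg)
  then show ?thesis
    unfolding u' v' two by (simp only: distrib_left mult.assoc mult.left_commute[of 2] mult.commute[of _ 2])
qed

lemma sum_Pow_insert:
  fixes h :: "'a set \<Rightarrow> 'b::comm_monoid_add"
  assumes "finite S" "x \<notin> S"
  shows "(\<Sum>G\<in>Pow (insert x S). h G) = (\<Sum>G\<in>Pow S. h G + h (insert x G))"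
proof -
  have "inj_on (insert x) (Pow S)"
    using assms by (auto simp: inj_on_def)
  moreover have "Pow S \<inter> insert x ` Pow S = {}"
    using assms by auto
  ultimately show ?thesis
    using assms by (simp add: Pow_insert sum.union_disjoint sum.reindex sum.distrib)
qed

text \<open>Coordinates are summed out one at a time by the two-point Hoelder inequality. A
  coordinate seen by fewer than d functions leaves its factor 2^(1 - deg/d); these factors carry the
  information that is later exploited by double counting.\<close>

theorem Finner_inequality:
  fixes f :: "'b \<Rightarrow> 'a set \<Rightarrow> real"
  assumes "finite S" and finJ: "finite J" and d: "d > 0"
    and "\<And>y G. y \<in> J \<Longrightarrow> G \<subseteq> S \<Longrightarrow> f y G > 0"
    and "\<And>y G. y \<in> J \<Longrightarrow> G \<subseteq> S \<Longrightarrow> f y G = f y (G \<inter> M y)"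
    and "\<And>x. x \<in> S \<Longrightarrow> card {y \<in> J. x \<in> M y} \<le> d"
  shows "(\<Sum>G\<in>Pow S. \<Prod>y\<in>J. f y G powr (1 / d))
    \<le> (\<Prod>x\<in>S. 2 powr (1 - card {y \<in> J. x \<in> M y} / d)) *
       (\<Prod>y\<in>J. (\<Sum>G\<in>Pow (S \<inter> M y). f y G) powr (1 / d))"
  using assms(1,4-)
proof (induction S arbitrary: f rule: finite_induct)
  case empty
  show ?case by simp
next
  case (insert x S)
  \<comment> \<open>\<open>g y\<close> is \<open>f y\<close> with the coordinate \<open>x\<close>
    summed out; a function that does not depend on \<open>x\<close> stays as it is rather than being
    doubled.\<close>
  define g where "g y G = (if x \<in> M y then f y G + f y (insert x G) else f y G)" for y G
  let ?J = "{y \<in> J. x \<in> M y}"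
  have pos: "f y G > 0" "f y (insert x G) > 0" if "y \<in> J" "G \<subseteq> S" for y G
    using that by (auto intro!: insert.prems(1))
  have loc: "f y (insert x G) = f y G" if "y \<in> J" "G \<subseteq> S" "x \<notin> M y" for y G
  proof -
    have "f y (insert x G) = f y (insert x G \<inter> M y)" using that by (intro insert.prems(2)) auto
    also have "\<dots> = f y (G \<inter> M y)" using that by simp
    also have "\<dots> = f y G" using that by (intro insert.prems(2)[symmetric]) auto
    finally show ?thesis .
  qed
  have step: "(\<Prod>y\<in>J. f y G powr (1 / d)) + (\<Prod>y\<in>J. f y (insert x G) powr (1 / d))
      \<le> 2 powr (1 - card ?J / d) * (\<Prod>y\<in>J. g y G powr (1 / d))" if G: "G \<subseteq> S" for G
  proof -
    have split: "(\<Prod>y\<in>J. h y) = (\<Prod>y\<in>J - ?J. h y) * (\<Prod>y\<in>?J. h y)" for h :: "'b \<Rightarrow> real"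
      using finJ by (intro prod.subset_diff) auto
    have same: "(\<Prod>y\<in>J - ?J. f y (insert x G) powr (1 / d)) = (\<Prod>y\<in>J - ?J. f y G powr (1 / d))"
      "(\<Prod>y\<in>J - ?J. g y G powr (1 / d)) = (\<Prod>y\<in>J - ?J. f y G powr (1 / d))"
      using loc G by (auto intro!: prod.cong simp: g_def)
    have gJ: "(\<Prod>y\<in>?J. g y G powr (1 / d)) = (\<Prod>y\<in>?J. (f y G + f y (insert x G)) powr (1 / d))"
      by (simp add: g_def)
    have "(\<Prod>y\<in>?J. f y G powr (1 / d)) + (\<Prod>y\<in>?J. f y (insert x G) powr (1 / d))
      \<le> 2 powr (1 - card ?J / d) * (\<Prod>y\<in>?J. g y G powr (1 / d))"
      unfolding gJ using finJ pos G insert.prems(3)[of x] d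
      by (intro Hoelder_two_points) auto
    then have "(\<Prod>y\<in>J - ?J. f y G powr (1 / d)) *
        ((\<Prod>y\<in>?J. f y G powr (1 / d)) + (\<Prod>y\<in>?J. f y (insert x G) powr (1 / d)))
      \<le> (\<Prod>y\<in>J - ?J. f y G powr (1 / d)) * (2 powr (1 - card ?J / d) * (\<Prod>y\<in>?J. g y G powr (1 / d)))"
      by (intro mult_left_mono prod_nonneg) auto
    then show ?thesis
      unfolding split[of "\<lambda>y. f y G powr (1 / d)"] split[of "\<lambda>y. f y (insert x G) powr (1 / d)"]
        split[of "\<lambda>y. g y G powr (1 / d)"] same by (simp add: algebra_simps)
  qed
  have IH: "(\<Sum>G\<in>Pow S. \<Prod>y\<in>J. g y G powr (1 / d))
    \<le> (\<Prod>x\<in>S. 2 powr (1 - card {y \<in> J. x \<in> M y} / d)) *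
       (\<Prod>y\<in>J. (\<Sum>G\<in>Pow (S \<inter> M y). g y G) powr (1 / d))"
  proof (rule insert.IH)
    fix y G assume y: "y \<in> J" and G: "G \<subseteq> S"
    show "g y G > 0" using pos[OF y G] by (simp add: g_def add_pos_pos)
    have "f y (insert x G) = f y (insert x (G \<inter> M y))" if x: "x \<in> M y"
    proof -
      have "insert x G \<inter> M y = insert x (G \<inter> M y) \<inter> M y" by auto
      moreover have "f y (insert x G) = f y (insert x G \<inter> M y)"
        using y G by (intro insert.prems(2)) auto
      moreover have "f y (insert x (G \<inter> M y)) = f y (insert x (G \<inter> M y) \<inter> M y)"
        using y G by (intro insert.prems(2)) auto
      ultimately show ?thesis by simp
    qed
    moreover have "f y G = f y (G \<inter> M y)"
      using y G by (intro insert.prems(2)) auto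
    ultimately show "g y G = g y (G \<inter> M y)"
      by (simp add: g_def)
  qed (use insert.prems(3) in auto)
  have gsum: "(\<Sum>G\<in>Pow (S \<inter> M y). g y G) = (\<Sum>G\<in>Pow (insert x S \<inter> M y). f y G)" if "y \<in> J" for y
  proof (cases "x \<in> M y")
    case True
    then have "insert x S \<inter> M y = insert x (S \<inter> M y)" by auto
    then show ?thesis using True insert.hyps by (simp add: sum_Pow_insert g_def)
  qed (simp add: g_def)
  have "(\<Sum>G\<in>Pow (insert x S). \<Prod>y\<in>J. f y G powr (1 / d)) =
      (\<Sum>G\<in>Pow S. (\<Prod>y\<in>J. f y G powr (1 / d)) + (\<Prod>y\<in>J. f y (insert x G) powr (1 / d)))"
    using insert.hyps by (rule sum_Pow_insert)
  also have "\<dots> \<le> (\<Sum>G\<in>Pow S. 2 powr (1 - card ?J / d) * (\<Prod>y\<in>J. g y G powr (1 / d)))"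
    using step by (intro sum_mono) auto
  also have "\<dots> = 2 powr (1 - card ?J / d) * (\<Sum>G\<in>Pow S. \<Prod>y\<in>J. g y G powr (1 / d))"
    by (simp add: sum_distrib_left)
  also have "\<dots> \<le> 2 powr (1 - card ?J / d) * ((\<Prod>x\<in>S. 2 powr (1 - card {y \<in> J. x \<in> M y} / d)) *
       (\<Prod>y\<in>J. (\<Sum>G\<in>Pow (S \<inter> M y). g y G) powr (1 / d)))"
    using IH by (intro mult_left_mono) auto
  also have "(\<Prod>y\<in>J. (\<Sum>G\<in>Pow (S \<inter> M y). g y G) powr (1 / d)) =
      (\<Prod>y\<in>J. (\<Sum>G\<in>Pow (insert x S \<inter> M y). f y G) powr (1 / d))"
    using gsum by (intro prod.cong) auto
  finally show ?case using insert.hyps by (simp add: mult.assoc)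
qed

section \<open>Certificates, greedy covers and connected sets\<close>

lemma sum_Pow_power_card:
  fixes x :: real
  assumes "finite B"
  shows "(\<Sum>E\<in>Pow B. x ^ card E) = (1 + x) ^ card B"
  using prod_add[OF assms, of "\<lambda>_. x" "\<lambda>_. 1"] by (simp only: prod_constant power_one mult_1_right add.commute)

text \<open>Exponential Markov: every counted E has x^|E| >= x^s, and all subsets together have
  weight (1 + x)^|B|. The free parameter trades the price 1/x per recorded element against exp(x
  |B|) for the room.\<close>

lemma card_small_subsets_le:
  fixes x s :: real
  assumes "finite B" and x: "0 < x" "x \<le> 1"
  shows "card {E. E \<subseteq> B \<and> card E \<le> s} \<le> x powr (- s) * exp (x * card B)"
proof -
  let ?E = "{E. E \<subseteq> B \<and> card E \<le> s}"
  have fin: "finite (Pow B)" using assms by simp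
  have sub: "?E \<subseteq> Pow B" by auto
  have "x powr s * card ?E = (\<Sum>E\<in>?E. x powr s)" by simp
  also have "\<dots> \<le> (\<Sum>E\<in>?E. x ^ card E)"
  proof (rule sum_mono)
    fix E assume "E \<in> ?E"
    then have "x powr s \<le> x powr (card E)" using x by (intro powr_mono') auto
    then show "x powr s \<le> x ^ card E" using x by (simp add: powr_realpow)
  qed
  also have "\<dots> \<le> (\<Sum>E\<in>Pow B. x ^ card E)"
    using x sub fin by (intro sum_mono2) auto
  also have "\<dots> = (1 + x) ^ card B" by (rule sum_Pow_power_card[OF assms(1)])
  also have "\<dots> \<le> exp x ^ card B"
    using x by (intro power_mono exp_ge_add_one_self) auto
  also have "\<dots> = exp (x * card B)" by (simp add: exp_of_nat2_mult)
  finally show ?thesis using x by (simp add: powr_minus field_simps)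
qed

text \<open>Union bound: each \<open>a\<close> is charged to some certificate \<open>c\<close> that
  \<open>V\<close> accepts for it.\<close>

lemma sum_le_certificate_count:
  fixes h :: "'a \<Rightarrow> real" and b :: real
  assumes "finite A" "finite C" and h: "\<And>a. a \<in> A \<Longrightarrow> h a \<ge> 0"
    and ex: "\<And>a. a \<in> A \<Longrightarrow> \<exists>c\<in>C. V c a"
    and le: "\<And>c. c \<in> C \<Longrightarrow> (\<Sum>a\<in>{a \<in> A. V c a}. h a) \<le> b"
  shows "(\<Sum>a\<in>A. h a) \<le> card C * b"
proof -
  have "(\<Sum>a\<in>A. h a) \<le> (\<Sum>a\<in>A. \<Sum>c\<in>{c \<in> C. V c a}. h a)"
  proof (rule sum_mono)
    fix a assume a: "a \<in> A"
    then obtain c where "c \<in> {c \<in> C. V c a}" using ex by auto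
    then have "card {c \<in> C. V c a} > 0" using assms(2) by (auto simp: card_gt_0_iff)
    then have "1 \<le> real (card {c \<in> C. V c a})" by linarith
    then show "h a \<le> (\<Sum>c\<in>{c \<in> C. V c a}. h a)"
      using mult_right_mono[of 1 "real (card {c \<in> C. V c a})" "h a"] h[OF a] by simp
  qed
  also have "\<dots> = (\<Sum>c\<in>C. \<Sum>a\<in>{a \<in> A. V c a}. h a)"
    using assms by (intro sum.swap_restrict)
  also have "\<dots> \<le> (\<Sum>c\<in>C. b)" using le by (intro sum_mono)
  finally show ?thesis by simp
qed

text \<open>A largest T whose members cover at least h points each on average. An index with h
  uncovered points could be added to it, so none is left.\<close>

lemma greedy_cover:
  fixes h :: real
  assumes "h > 0" "finite I" "finite G" and sub: "\<And>i. i \<in> I \<Longrightarrow> R i \<subseteq> G"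
  shows "\<exists>T\<subseteq>I. card T * h \<le> card (\<Union>i\<in>T. R i) \<and> (\<forall>i\<in>I. card (R i - (\<Union>i\<in>T. R i)) < h)"
proof -
  let ?Q = "\<lambda>T. T \<subseteq> I \<and> card T * h \<le> card (\<Union>i\<in>T. R i)"
  have "?Q {}" by simp
  moreover have "\<forall>T. ?Q T \<longrightarrow> card T < Suc (card I)"
    using assms(2) by (auto simp: card_mono less_Suc_eq_le)
  ultimately obtain T where T: "?Q T" and max: "\<And>T'. ?Q T' \<Longrightarrow> card T' \<le> card T"
    using ex_has_greatest_nat[of ?Q "{}" card "Suc (card I)"] by auto
  have "card (R i - (\<Union>i\<in>T. R i)) < h" if i: "i \<in> I" "i \<notin> T" for i
  proof (rule ccontr)
    assume *: "\<not> ?thesis"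
    have finT: "finite T" using T assms(2) finite_subset by auto
    have finU: "finite (\<Union>i\<in>T. R i)" "finite (R i)"
      using T sub i assms(3) by (meson UN_least finite_subset subsetD)+
    have "(\<Union>i\<in>insert i T. R i) = (\<Union>i\<in>T. R i) \<union> (R i - (\<Union>i\<in>T. R i))" by auto
    then have "card (\<Union>i\<in>insert i T. R i) = card (\<Union>i\<in>T. R i) + card (R i - (\<Union>i\<in>T. R i))"
      using finU by (simp only:) (intro card_Un_disjoint, auto)
    moreover have "real (card T * 1) * h + h \<le> card (\<Union>i\<in>T. R i) + card (R i - (\<Union>i\<in>T. R i))"
      using T * by simp
    ultimately have "?Q (insert i T)"
      using T i finT by (simp add: algebra_simps)
    from max[OF this] show False using finT i by simp
  qed
  moreover have "card (R i - (\<Union>i\<in>T. R i)) < h" if "i \<in> T" for i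
    using that assms(1) by (simp add: UN_upper Diff_eq_empty_iff[THEN iffD2])
  ultimately show ?thesis using T by blast
qed

section \<open>Rooted connected sets and covering walks\<close>

definition conn :: "('a \<times> 'a) set \<Rightarrow> 'a \<Rightarrow> 'a set \<Rightarrow> bool" where
  "conn r x T \<longleftrightarrow> x \<in> T \<and> (\<forall>y\<in>T. (x, y) \<in> (r \<inter> T \<times> T)\<^sup>*)"

text \<open>The root is the last entry, because walks are extended at the head of the list.\<close>

definition walks :: "('a \<times> 'a) set \<Rightarrow> 'a \<Rightarrow> nat \<Rightarrow> 'a list set" where
  "walks r x l = {w. length w = Suc l \<and> last w = x \<and> successively (\<lambda>u v. (u, v) \<in> r) w}"

lemma walks_Suc:
  assumes "sym r"
  shows "walks r x (Suc l) \<subseteq> (\<Union>w\<in>walks r x l. (\<lambda>u. u # w) ` (r `` {hd w}))"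
proof
  fix w assume w: "w \<in> walks r x (Suc l)"
  then obtain u w' where "w = u # w'" "length w' = Suc l"
    by (auto simp: walks_def length_Suc_conv)
  moreover from this have "w' \<noteq> []" by auto
  ultimately show "w \<in> (\<Union>w\<in>walks r x l. (\<lambda>u. u # w) ` (r `` {hd w}))"
    using w symD[OF assms] by (auto simp: walks_def successively_Cons)
qed

lemma card_walks_le:
  assumes "sym r" and deg: "\<And>u. finite (r `` {u})" "\<And>u. card (r `` {u}) \<le> D"
  shows "finite (walks r x l) \<and> card (walks r x l) \<le> D ^ l"
proof (induction l)
  case 0
  have "walks r x 0 = {[x]}" by (auto simp: walks_def length_Suc_conv)
  then show ?case by simp
next
  case (Suc l)
  let ?U = "\<Union>w\<in>walks r x l. (\<lambda>u. u # w) ` (r `` {hd w})"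
  have fin: "finite ?U" using Suc deg by auto
  have "card ?U \<le> (\<Sum>w\<in>walks r x l. card ((\<lambda>u. u # w) ` (r `` {hd w})))"
    using Suc by (intro card_UN_le) auto
  also have "\<dots> \<le> (\<Sum>w\<in>walks r x l. D)"
    using deg by (intro sum_mono) (meson card_image_le order_trans)
  also have "\<dots> \<le> D ^ Suc l" using Suc by simp
  finally have U: "card ?U \<le> D ^ Suc l" .
  note sub = walks_Suc[OF assms(1), of x l]
  show ?case
    using finite_subset[OF sub fin] card_mono[OF fin sub] U by simp
qed

text \<open>The tour of a spanning tree, obtained by maximality: if the walk covers U but not T,
  some edge (t, u) leaves U, and replacing t by the detour t, u, t adds two steps for one new
  point.\<close>

lemma covering_walk:
  assumes "sym r" and T: "finite T" "conn r x T"
  shows "\<exists>w. successively (\<lambda>u v. (u, v) \<in> r) w \<and> last w = x \<and> w \<noteq> [] \<and> set w = T \<and> length w < 2 * card T"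
proof -
  let ?P = "\<lambda>U w. U \<subseteq> T \<and> successively (\<lambda>u v. (u, v) \<in> r) w \<and> last w = x \<and> w \<noteq> [] \<and> set w = U
    \<and> length w < 2 * card U"
  have "\<exists>w. ?P {x} w" using T by (intro exI[of _ "[x]"]) (auto simp: conn_def)
  moreover have "\<forall>U. (\<exists>w. ?P U w) \<longrightarrow> card U < Suc (card T)"
    using T by (auto simp: card_mono less_Suc_eq_le)
  ultimately obtain U where U: "\<exists>w. ?P U w" and max: "\<And>V. \<exists>w. ?P V w \<Longrightarrow> card V \<le> card U"
    using ex_has_greatest_nat[of "\<lambda>U. \<exists>w. ?P U w" "{x}" card "Suc (card T)"] by auto
  from U obtain w where w: "?P U w" by blast
  have xU: "x \<in> U" using w last_in_set by metis
  have finU: "finite U" using w T finite_subset by blast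
  have "U = T"
  proof (rule ccontr)
    assume "U \<noteq> T"
    then obtain y where y: "y \<in> T" "y \<notin> U" using w by auto
    have "\<exists>t u. t \<in> U \<and> u \<in> T \<and> u \<notin> U \<and> (t, u) \<in> r"
    proof (rule ccontr)
      assume no: "\<not> ?thesis"
      have "(x, y) \<in> (r \<inter> T \<times> T)\<^sup>*" using T y by (auto simp: conn_def)
      then have "y \<in> U" by induction (use xU no in auto)
      then show False using y by simp
    qed
    then obtain t u where tu: "t \<in> U" "u \<in> T" "u \<notin> U" "(t, u) \<in> r" by blast
    then obtain w1 w2 where ww: "w = w1 @ t # w2" using w split_list by metis
    have "?P (insert u U) (w1 @ t # u # t # w2)"
      using w tu finU symD[OF assms(1) tu(4)] unfolding ww
      by (auto simp: successively_append_iff successively_Cons split: if_splits)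
    then have "card (insert u U) \<le> card U" using max by blast
    then show False using finU tu by simp
  qed
  then show ?thesis using w by blast
qed

text \<open>A connected set is the range of a walk of fixed length ending in the root, and each step
  has at most D continuations.\<close>

lemma card_conn_sets_le:
  assumes r: "sym r" "refl r" and deg: "\<And>u. finite (r `` {u})" "\<And>u. card (r `` {u}) \<le> D"
  shows "finite {T. finite T \<and> conn r x T \<and> card T \<le> m}" (is "finite ?C")
    and "card {T. finite T \<and> conn r x T \<and> card T \<le> m} \<le> D ^ (2 * m)"
proof -
  have "{T. finite T \<and> conn r x T \<and> card T \<le> m} \<subseteq> set ` walks r x (2 * m)"
  proof
    fix T assume "T \<in> {T. finite T \<and> conn r x T \<and> card T \<le> m}"
    then obtain w where w: "successively (\<lambda>u v. (u, v) \<in> r) w" "last w = x" "w \<noteq> []" "set w = T"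
      "length w < 2 * m" using covering_walk[OF r(1), of T x] by fastforce
    \<comment> \<open>Repeating the head pads all walks to the common length; here reflexivity of
      \<open>r\<close> enters.\<close>
    let ?w = "replicate (Suc (2 * m) - length w) (hd w) @ w"
    have "successively (\<lambda>u v. (u, v) \<in> r) (replicate k (hd w) @ w)" for k
      using w r(2) by (induction k) (auto simp: successively_Cons hd_append refl_on_def)
    then have "?w \<in> walks r x (2 * m)" using w by (auto simp: walks_def)
    moreover have "set ?w = T" using w(3,4) by (auto simp: set_replicate_conv_if)
    ultimately show "T \<in> set ` walks r x (2 * m)" by blast
  qed
  moreover have W: "finite (walks r x (2 * m))" "card (walks r x (2 * m)) \<le> D ^ (2 * m)"
    using card_walks_le[OF r(1) deg, of x "2 * m"] by auto
  ultimately have S: "?C \<subseteq> set ` walks r x (2 * m)" by simp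
  show "finite ?C" using S W(1) by (rule finite_subset[OF _ finite_imageI])
  have "card ?C \<le> card (set ` walks r x (2 * m))"
    using S W(1) by (intro card_mono) auto
  also have "\<dots> \<le> card (walks r x (2 * m))" using W(1) by (rule card_image_le)
  finally show "card ?C \<le> D ^ (2 * m)" using W(2) by simp
qed

text \<open>Connectedness passes from G to a certificate T that is spread along G: consecutive
  points of a path in G have certificate points near them, and \<open>r\<close> reaches far enough
  to join these.\<close>

lemma conn_near:
  assumes "conn l x G" and T: "T = (\<Union>y\<in>G. near y)" and ne: "\<And>y. y \<in> G \<Longrightarrow> near y \<noteq> {}"
    and x: "x \<in> near x"
    and link: "\<And>y z s t. y \<in> G \<Longrightarrow> z \<in> G \<Longrightarrow> y = z \<or> (y, z) \<in> l \<Longrightarrow> s \<in> near y \<Longrightarrow> t \<in> near z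
      \<Longrightarrow> (s, t) \<in> r"
  shows "conn r x T"
proof -
  have nearT: "s \<in> T" if "y \<in> G" "s \<in> near y" for y s unfolding T using that by (rule UN_I)
  have "\<forall>s\<in>near y. (x, s) \<in> (r \<inter> T \<times> T)\<^sup>*" if "(x, y) \<in> (l \<inter> G \<times> G)\<^sup>*" "x \<in> G" for y
    using that(1)
  proof (induction rule: rtrancl_induct)
    case base
    have "(x, s) \<in> r \<inter> T \<times> T" if "s \<in> near x" for s
      using link[OF \<open>x \<in> G\<close> \<open>x \<in> G\<close> disjI1[OF refl] x that] nearT[OF \<open>x \<in> G\<close>] x that by simp
    then show ?case by blast
  next
    case (step y z)
    then have G: "y \<in> G" "z \<in> G" "(y, z) \<in> l" by auto
    obtain s where s: "s \<in> near y" using ne[OF G(1)] by auto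
    have "(s, t) \<in> r \<inter> T \<times> T" if "t \<in> near z" for t
      using link[OF G(1,2) disjI2[OF G(3)] s that] nearT[OF G(1) s] nearT[OF G(2) that] by simp
    then show ?case using step.IH s by (auto intro: rtrancl.rtrancl_into_rtrancl)
  qed
  note reach = this
  have G: "x \<in> G" "\<And>y. y \<in> G \<Longrightarrow> (x, y) \<in> (l \<inter> G \<times> G)\<^sup>*"
    using assms(1) by (simp_all add: conn_def)
  have "(x, s) \<in> (r \<inter> T \<times> T)\<^sup>*" if "s \<in> T" for s
  proof -
    from that have "\<exists>y\<in>G. s \<in> near y" unfolding T by (simp only: UN_iff)
    then show ?thesis using reach[OF G(2) G(1)] by (elim bexE) (rule bspec)
  qed
  with nearT[OF G(1) x] show ?thesis unfolding conn_def by (intro conjI ballI)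
qed

section \<open>Bipartite graphs of small codegree\<close>

text \<open>Two consecutive layers in the abstract: \<open>X\<close> above, \<open>Y\<close> below,
  \<open>N\<close> the shadow. The strict bound \<open>deg_Y\<close> against the exact degree
  \<open>card_N\<close> is the degree gap. Both sides share a type because certificates and walks
  mix them.\<close>

locale bigraph =
  fixes X Y :: "'a set" and N :: "'a \<Rightarrow> 'a set" and d :: nat
  assumes finX: "finite X" and finY: "finite Y" and disj: "X \<inter> Y = {}"
    and N_sub: "x \<in> X \<Longrightarrow> N x \<subseteq> Y"
    and card_N: "x \<in> X \<Longrightarrow> card (N x) = d"
    and deg_Y: "y \<in> Y \<Longrightarrow> card {x \<in> X. y \<in> N x} < d"
    and codeg: "x \<in> X \<Longrightarrow> x' \<in> X \<Longrightarrow> x \<noteq> x' \<Longrightarrow> y \<in> N x \<inter> N x' \<Longrightarrow> y' \<in> N x \<inter> N x' \<Longrightarrow> y = y'"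
begin

definition nb :: "'a \<Rightarrow> 'a set" where "nb y = {x \<in> X. y \<in> N x}"
definition sh :: "'a set \<Rightarrow> 'a set" where "sh G = (\<Union>x\<in>G. N x)"
definition clos :: "'a set \<Rightarrow> 'a set" where "clos G = {x \<in> X. N x \<subseteq> sh G}"
definition lk :: "('a \<times> 'a) set" where "lk = {(x, x'). x \<in> X \<and> x' \<in> X \<and> N x \<inter> N x' \<noteq> {}}"
text \<open>The diagonal is included so that \<open>ad ^^ k\<close> means distance at most
  k.\<close>

definition ad :: "('a \<times> 'a) set" where
  "ad = {(u, v). u = v \<or> (u \<in> X \<and> v \<in> N u) \<or> (v \<in> X \<and> u \<in> N v)}"

lemma finite_N: "x \<in> X \<Longrightarrow> finite (N x)"
  using N_sub finY finite_subset by blast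

lemma nb_subset: "nb y \<subseteq> X" by (auto simp: nb_def)

lemma finite_nb: "finite (nb y)" using finX nb_subset finite_subset by blast

lemma card_nb: "y \<in> Y \<Longrightarrow> card (nb y) < d" using deg_Y by (simp add: nb_def)

lemma sh_mono: "G \<subseteq> H \<Longrightarrow> sh G \<subseteq> sh H" by (auto simp: sh_def)

lemma sh_subset: "G \<subseteq> X \<Longrightarrow> sh G \<subseteq> Y" using N_sub by (auto simp: sh_def)

lemma finite_sh: "G \<subseteq> X \<Longrightarrow> finite (sh G)" using sh_subset finY finite_subset by blast

lemma mem_sh_iff: "G \<subseteq> X \<Longrightarrow> y \<in> sh G \<longleftrightarrow> nb y \<inter> G \<noteq> {}"
  by (auto simp: sh_def nb_def)

lemma clos_subset: "clos G \<subseteq> X" by (auto simp: clos_def)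

lemma subset_clos: "G \<subseteq> X \<Longrightarrow> G \<subseteq> clos G" by (auto simp: clos_def sh_def)

lemma sh_clos: "G \<subseteq> X \<Longrightarrow> sh (clos G) = sh G"
  using sh_mono[OF subset_clos] by (auto simp: clos_def sh_def)

lemma card_sh_le: "G \<subseteq> X \<Longrightarrow> card (sh G) \<le> card G * d"
proof -
  assume G: "G \<subseteq> X"
  then have "card (sh G) \<le> (\<Sum>x\<in>G. card (N x))"
    unfolding sh_def using finX finite_subset by (intro card_UN_le) auto
  also have "\<dots> = card G * d" using G card_N by (simp add: subset_iff)
  finally show ?thesis .
qed

lemma double_count:
  assumes "S \<subseteq> X" "F \<subseteq> Y"
  shows "(\<Sum>x\<in>S. card (N x \<inter> F)) = (\<Sum>y\<in>F. card (nb y \<inter> S))"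
proof -
  have fin: "finite S" "finite F" using assms finX finY finite_subset by auto
  have "(\<Sum>x\<in>S. card (N x \<inter> F)) = (\<Sum>x\<in>S. \<Sum>y\<in>{y \<in> F. y \<in> N x}. 1)"
    by (intro sum.cong refl) (auto intro!: arg_cong[where f = card])
  also have "\<dots> = (\<Sum>y\<in>F. \<Sum>x\<in>{x \<in> S. y \<in> N x}. 1)"
    using fin by (intro sum.swap_restrict)
  also have "\<dots> = (\<Sum>y\<in>F. card (nb y \<inter> S))"
    using assms by (intro sum.cong refl) (auto simp: nb_def intro!: arg_cong[where f = card])
  finally show ?thesis .
qed

text \<open>The 1 subtracted from d is the source of the gain: it turns a bound 2^|F| into 2^(|F| -
  |F|/d).\<close>

lemma sum_card_nb_le:
  assumes "S \<subseteq> X" "F \<subseteq> Y"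
  shows "(\<Sum>x\<in>S. card (N x \<inter> F)) \<le> card F * (d - 1)"
proof -
  have "card (nb y \<inter> S) \<le> d - 1" if "y \<in> F" for y
  proof -
    have "card (nb y \<inter> S) \<le> card (nb y)" using finite_nb by (intro card_mono) auto
    then show ?thesis using card_nb[of y] that assms by auto
  qed
  then show ?thesis unfolding double_count[OF assms] using sum_bounded_above[of F "\<lambda>y. card (nb y \<inter> S)" "d - 1"] by simp
qed

lemma sym_ad: "sym ad" by (auto simp: sym_def ad_def)

lemma refl_ad: "refl ad" by (auto simp: refl_on_def ad_def)

lemma ad_Image: "finite (ad `` {u}) \<and> card (ad `` {u}) \<le> d + 1"
proof -
  consider "u \<in> X" | "u \<in> Y" "u \<notin> X" | "u \<notin> X" "u \<notin> Y" by blast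
  then show ?thesis
  proof cases
    case 1
    then have "ad `` {u} \<subseteq> insert u (N u)" using N_sub disj by (auto simp: ad_def)
    moreover have "card (insert u (N u)) \<le> d + 1"
      using card_insert_le_m1[of "d + 1" "N u" u] card_N[OF 1] by simp
    ultimately show ?thesis using finite_N[OF 1]
      by (meson card_mono finite_insert finite_subset order_trans)
  next
    case 2
    then have "ad `` {u} \<subseteq> insert u (nb u)" by (auto simp: ad_def nb_def)
    moreover have "card (insert u (nb u)) \<le> d + 1"
      using card_insert_le_m1[of "d + 1" "nb u" u] card_nb[OF 2(1)] by simp
    ultimately show ?thesis using finite_nb[of u]
      by (meson card_mono finite_insert finite_subset order_trans)
  next
    case 3
    then have "ad `` {u} = {u}" using N_sub by (auto simp: ad_def)
    then show ?thesis by simp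
  qed
qed

end

lemma card_relpow_Image_le:
  fixes r :: "('a \<times> 'a) set"
  assumes deg: "\<And>u. finite (r `` {u}) \<and> card (r `` {u}) \<le> D"
  shows "finite ((r ^^ k) `` {u}) \<and> card ((r ^^ k) `` {u}) \<le> D ^ k"
proof (induction k)
  case (Suc k)
  have eq: "(r ^^ Suc k) `` {u} = (\<Union>v\<in>(r ^^ k) `` {u}. r `` {v})" by auto
  have "card (\<Union>v\<in>(r ^^ k) `` {u}. r `` {v}) \<le> (\<Sum>v\<in>(r ^^ k) `` {u}. card (r `` {v}))"
    using Suc by (intro card_UN_le) auto
  also have "\<dots> \<le> (\<Sum>v\<in>(r ^^ k) `` {u}. D)" using deg by (intro sum_mono) auto
  also have "\<dots> \<le> D ^ Suc k" using Suc by simp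
  finally show ?case unfolding eq using Suc deg by auto
qed simp

lemma sym_relpow: "sym r \<Longrightarrow> sym (r ^^ k)"
proof (induction k)
  case (Suc k)
  then have "(y, x) \<in> r O r ^^ k" if "(x, y) \<in> r ^^ k O r" for x y
    using that by (blast dest: symD)
  then show ?case by (simp add: sym_def relpow_commute)
qed (simp add: sym_Id)

lemma refl_relpow: "refl r \<Longrightarrow> refl (r ^^ k)"
  by (induction k) (auto simp: refl_on_def)

lemma relpow_mono_refl:
  assumes "refl r" "j \<le> k" "(x, y) \<in> r ^^ j" shows "(x, y) \<in> r ^^ k"
  using assms(2,3)
proof (induction k rule: dec_induct)
  case (step k)
  then show ?case using assms(1) by (auto simp: refl_on_def)
qed

lemma relpow_trans: "(x, y) \<in> r ^^ j \<Longrightarrow> (y, z) \<in> r ^^ k \<Longrightarrow> (x, z) \<in> r ^^ (j + k)"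
  by (auto simp: relpow_add)

context bigraph begin

text \<open>8 = 3 + 2 + 3: from a certificate point at most 3 to its point of G, 2 to a linked point
  of G, and at most 3 to that point's certificate point.\<close>

definition linked :: "('a \<times> 'a) set" where "linked = ad ^^ 8"

lemma card_linked_sets_le:
  fixes m :: real
  assumes "m \<ge> 0"
  shows "finite {T. finite T \<and> conn linked x T \<and> card T \<le> m}"
    and "card {T. finite T \<and> conn linked x T \<and> card T \<le> m} \<le> (d + 1) powr (16 * m)"
proof -
  have eq: "{T. finite T \<and> conn linked x T \<and> card T \<le> m} =
      {T. finite T \<and> conn linked x T \<and> card T \<le> nat \<lfloor>m\<rfloor>}"
    using assms by (auto simp: le_nat_floor le_floor_iff nat_le_iff) (linarith | simp add: le_nat_iff le_floor_iff)+
  have r: "sym linked" "refl linked" "finite (linked `` {u})" "card (linked `` {u}) \<le> (d + 1) ^ 8" for u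
    using sym_relpow[OF sym_ad] refl_relpow[OF refl_ad] card_relpow_Image_le[of ad "d + 1", OF ad_Image]
    by (auto simp: linked_def)
  note c = card_conn_sets_le[OF r, of x "nat \<lfloor>m\<rfloor>"]
  show "finite {T. finite T \<and> conn linked x T \<and> card T \<le> m}" unfolding eq by (rule c(1))
  have "real (card {T. finite T \<and> conn linked x T \<and> card T \<le> m}) \<le> real (((d + 1) ^ 8) ^ (2 * nat \<lfloor>m\<rfloor>))"
    unfolding eq using c(2) by (simp only: of_nat_le_iff)
  also have "\<dots> = real (d + 1) powr (16 * nat \<lfloor>m\<rfloor>)"
    by (subst powr_realpow) (simp_all add: power_mult[symmetric])
  also have "\<dots> \<le> real (d + 1) powr (16 * m)"
    using assms by (intro powr_mono) (auto simp: of_nat_floor)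
  finally show "card {T. finite T \<and> conn linked x T \<and> card T \<le> m} \<le> (d + 1) powr (16 * m)"
    by (simp add: add.commute)
qed

end

section \<open>Weighted families\<close>

lemma sum_supersets_le:
  fixes h g :: "'a set \<Rightarrow> real"
  assumes "finite S" "U \<subseteq> S" "A \<subseteq> Pow S" and A: "\<And>G. G \<in> A \<Longrightarrow> U \<subseteq> G"
    and le: "\<And>G. G \<in> A \<Longrightarrow> h G \<le> g (G - U)" and g: "\<And>G. g G \<ge> 0"
  shows "(\<Sum>G\<in>A. h G) \<le> (\<Sum>G\<in>Pow (S - U). g G)"
proof -
  have inj: "inj_on (\<lambda>G. G - U) A" using A by (auto simp: inj_on_def)
  have "(\<Sum>G\<in>A. h G) \<le> (\<Sum>G\<in>A. g (G - U))" using le by (intro sum_mono)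
  also have "\<dots> = (\<Sum>G\<in>(\<lambda>G. G - U) ` A. g G)" using inj by (simp add: sum.reindex)
  also have "\<dots> \<le> (\<Sum>G\<in>Pow (S - U). g G)"
    using assms by (intro sum_mono2) auto
  finally show ?thesis .
qed

context bigraph begin

text \<open>Finner with one function per shadow point outside F. The point x is seen by d - |N x
  \<inter> F| of them, so the leftover factors multiply to 2 to the number of edges between S - U
  and F, divided by d; double counting bounds this by |F|(d - 1)/d minus 3/4 for each point of
  U.\<close>

lemma sum_shadow_weight_le:
  assumes S: "S \<subseteq> X" and F: "F \<subseteq> Y" and US: "U \<subseteq> S" and d: "d > 0"
    and many: "\<And>x. x \<in> S \<Longrightarrow> 3 * d \<le> 4 * card (N x \<inter> F)"
  shows "(\<Sum>G\<in>Pow (S - U). 2 powr (- real (card (sh G - F))))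
    \<le> 2 powr (card F * (d - 1) / d - 3 / 4 * card U) *
      exp ((\<Sum>y\<in>sh S - F. 2 powr (real (card (nb y \<inter> S)) - d)) / d)"
proof -
  define J where "J = sh S - F"
  \<comment> \<open>The exponent d cancels the 1/d in Finner, so each shadow point outside F ends up
    with weight 1/2.\<close>
  define f where "f y G = (if y \<in> sh G then 2 powr (- real d) else 1)" for y and G :: "'a set"
  have fins: "finite S" "finite F" "finite U" "finite J"
    using finite_subset[OF S finX] finite_subset[OF F finY] finite_subset[OF US finite_subset[OF S finX]]
      finite_sh[OF S] by (simp_all add: J_def)
  have shU: "sh G \<subseteq> sh S" if "G \<subseteq> S - U" for G using that by (intro sh_mono) auto
  have "(\<Prod>y\<in>J. f y G powr (1 / d)) = 2 powr (- real (card (sh G - F)))" if G: "G \<in> Pow (S - U)" for G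
  proof -
    have half: "(2 powr (- real d)) powr (1 / d) = (1 / 2 :: real)"
      using d by (simp only: powr_powr) (simp add: powr_minus_divide)
    have "(\<Prod>y\<in>J. f y G powr (1 / d)) = (\<Prod>y\<in>J. if y \<in> sh G - F then 1 / 2 else 1)"
      by (intro prod.cong refl) (simp add: f_def J_def half)
    also have "\<dots> = (\<Prod>y\<in>J \<inter> (sh G - F). 1 / 2)"
      using fins by (simp add: prod.If_cases set_diff_eq)
    also have "J \<inter> (sh G - F) = sh G - F" using shU G by (auto simp: J_def)
    finally show ?thesis by (simp add: powr_minus_divide powr_realpow power_divide)
  qed
  then have "(\<Sum>G\<in>Pow (S - U). 2 powr (- real (card (sh G - F)))) = (\<Sum>G\<in>Pow (S - U). \<Prod>y\<in>J. f y G powr (1 / d))"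
    by simp
  also have "\<dots> \<le> (\<Prod>x\<in>S - U. 2 powr (1 - card {y \<in> J. x \<in> nb y} / d)) *
       (\<Prod>y\<in>J. (\<Sum>G\<in>Pow ((S - U) \<inter> nb y). f y G) powr (1 / d))"
  proof (rule Finner_inequality)
    show "f y G = f y (G \<inter> nb y)" if "G \<subseteq> S - U" for y G
    proof -
      have G: "G \<subseteq> X" "G \<inter> nb y \<subseteq> X" using that S by auto
      show ?thesis unfolding f_def mem_sh_iff[OF G(1)] mem_sh_iff[OF G(2)] by (simp add: Int_ac)
    qed
    show "card {y \<in> J. x \<in> nb y} \<le> d" if "x \<in> S - U" for x
    proof -
      have x: "x \<in> X" using that S by auto
      have "card {y \<in> J. x \<in> nb y} \<le> card (N x)"
        using finite_N[OF x] by (intro card_mono) (auto simp: nb_def)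
      then show ?thesis using card_N[OF x] by simp
    qed
  qed (use fins d in \<open>auto simp: f_def\<close>)
  also have "(\<Prod>x\<in>S - U. 2 powr (1 - card {y \<in> J. x \<in> nb y} / d)) =
      (\<Prod>x\<in>S - U. 2 powr (card (N x \<inter> F) / d))"
  proof (intro prod.cong refl)
    fix x assume "x \<in> S - U"
    then have x: "x \<in> S" "x \<in> X" using S by auto
    then have eq: "{y \<in> J. x \<in> nb y} = N x - N x \<inter> F" by (auto simp: J_def nb_def sh_def)
    have "card {y \<in> J. x \<in> nb y} + card (N x \<inter> F) = d"
      unfolding eq using finite_N[OF x(2)] card_N[OF x(2)]
      by (subst card_Diff_subset) (auto simp: card_mono)
    then have "1 - card {y \<in> J. x \<in> nb y} / d = card (N x \<inter> F) / d"
      using d by (simp add: field_simps flip: of_nat_add)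
    then show "2 powr (1 - card {y \<in> J. x \<in> nb y} / d) = 2 powr (card (N x \<inter> F) / d)" by simp
  qed
  also have "\<dots> = 2 powr (\<Sum>x\<in>S - U. card (N x \<inter> F) / d)"
    using fins by (subst powr_sum) auto
  also have "(\<Prod>y\<in>J. (\<Sum>G\<in>Pow ((S - U) \<inter> nb y). f y G) powr (1 / d))
      \<le> (\<Prod>y\<in>J. exp (2 powr (real (card (nb y \<inter> S)) - d) / d))"
  proof (intro prod_mono conjI)
    fix y assume y: "y \<in> J"
    let ?B = "(S - U) \<inter> nb y"
    have finB: "finite ?B" using fins by auto
    have B: "?B \<subseteq> X" using S by auto
    have "(\<Sum>G\<in>Pow ?B. f y G) = f y {} + (\<Sum>G\<in>Pow ?B - {{}}. f y G)"
      using finB by (intro sum.remove) (simp_all only: finite_Pow_iff Pow_iff empty_subsetI)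
    also have "f y {} = 1" by (simp add: f_def sh_def)
    also have "(\<Sum>G\<in>Pow ?B - {{}}. f y G) = (\<Sum>G\<in>Pow ?B - {{}}. 2 powr (- real d))"
    proof (intro sum.cong refl)
      fix G assume "G \<in> Pow ?B - {{}}"
      then have "G \<subseteq> X" "nb y \<inter> G \<noteq> {}" using B by auto
      then show "f y G = 2 powr (- real d)" by (simp add: f_def mem_sh_iff)
    qed
    also have "\<dots> \<le> card (Pow ?B) * 2 powr (- real d)"
      using finB by (simp add: card_Diff_subset)
    also have "\<dots> \<le> 2 powr (real (card (nb y \<inter> S)) - d)"
    proof -
      have "card ?B \<le> card (nb y \<inter> S)" using finite_nb by (intro card_mono) auto
      then have "2 ^ card ?B \<le> (2 ^ card (nb y \<inter> S) :: real)" by (intro power_increasing) auto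
      then show ?thesis using finB
        by (simp add: card_Pow powr_diff powr_minus_divide powr_realpow divide_right_mono del: Pow_Int_eq)
    qed
    finally have "(\<Sum>G\<in>Pow ?B. f y G) \<le> 1 + 2 powr (real (card (nb y \<inter> S)) - d)" by simp
    also have "\<dots> \<le> exp (2 powr (real (card (nb y \<inter> S)) - d))" by (rule exp_ge_add_one_self)
    finally have "(\<Sum>G\<in>Pow ?B. f y G) powr (1 / d) \<le> exp (2 powr (real (card (nb y \<inter> S)) - d)) powr (1 / d)"
      by (intro powr_mono2 sum_nonneg) (auto simp: f_def)
    then show "(\<Sum>G\<in>Pow ?B. f y G) powr (1 / d) \<le> exp (2 powr (real (card (nb y \<inter> S)) - d) / d)"
      by (simp add: exp_powr_real)
  qed auto
  also have "\<dots> = exp ((\<Sum>y\<in>J. 2 powr (real (card (nb y \<inter> S)) - d)) / d)"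
    using fins by (simp add: exp_sum sum_divide_distrib)
  also have "2 powr (\<Sum>x\<in>S - U. card (N x \<inter> F) / d) \<le> 2 powr (card F * (d - 1) / d - 3 / 4 * card U)"
  proof (rule powr_mono)
    have "(\<Sum>x\<in>U. 3 / 4 * real d) \<le> (\<Sum>x\<in>U. real (card (N x \<inter> F)))"
    proof (rule sum_mono)
      fix x assume "x \<in> U"
      then have "real (3 * d) \<le> real (4 * card (N x \<inter> F))" using many US by (intro of_nat_mono) auto
      then show "3 / 4 * real d \<le> card (N x \<inter> F)" by simp
    qed
    moreover have "real (\<Sum>x\<in>S. card (N x \<inter> F)) \<le> card F * (d - 1)"
      using sum_card_nb_le[OF S F] by (simp only: of_nat_le_iff)
    moreover have "(\<Sum>x\<in>S - U. real (card (N x \<inter> F))) =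
        (\<Sum>x\<in>S. real (card (N x \<inter> F))) - (\<Sum>x\<in>U. real (card (N x \<inter> F)))"
      using fins US by (simp add: sum_diff)
    ultimately have "(\<Sum>x\<in>S - U. real (card (N x \<inter> F))) \<le> real (card F * (d - 1)) - 3 / 4 * d * card U"
      by (simp add: mult.commute)
    then have "(\<Sum>x\<in>S - U. real (card (N x \<inter> F))) / d \<le> (real (card F * (d - 1)) - 3 / 4 * d * card U) / d"
      by (intro divide_right_mono) auto
    then show "(\<Sum>x\<in>S - U. card (N x \<inter> F) / d) \<le> real (card F * (d - 1)) / d - 3 / 4 * card U"
      using d by (simp add: sum_divide_distrib diff_divide_distrib)
  qed simp
  finally show ?thesis unfolding J_def by (simp add: mult_right_mono)
qed

end

text \<open>Only families \<open>W\<close> whose own polymer sum is negligible are admitted, even when a vertex is charged with \<open>3/4\<close> instead of \<open>1\<close>;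
  this slack pays for vertices with \<open>3/4\<close> of their neighbours in the core.\<close>

locale weighted_bigraph = bigraph X Y N d for X Y :: "'a set" and N d +
  fixes I :: "'i set" and W :: "'i \<Rightarrow> 'a set"
  assumes finI: "finite I"
    and W_sum: "Z \<subseteq> X \<Longrightarrow>
      (\<Sum>i\<in>{i \<in> I. W i \<subseteq> Z}. 2 powr (- (3 / 4) * card (W i))) \<le> 2 powr (card Z / real d ^ 2)"
begin

text \<open>In the application this is the number of small top families whose shadow lies in G, that
  is, the number of families that have to be deleted together with G in one of its
  occurrences.\<close>

definition wt :: "'a set \<Rightarrow> real" where "wt G = card {i \<in> I. W i \<subseteq> G}"

lemma wt_nonneg: "wt G \<ge> 0" by (simp add: wt_def)

lemma sum_wt:
  assumes "A \<subseteq> Pow Z" "finite Z"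
  shows "(\<Sum>G\<in>A. wt G * h G) = (\<Sum>i\<in>{i \<in> I. W i \<subseteq> Z}. \<Sum>G\<in>{G \<in> A. W i \<subseteq> G}. h G)"
proof -
  have finA: "finite A" using assms finite_subset by auto
  have "(\<Sum>G\<in>A. wt G * h G) = (\<Sum>G\<in>A. \<Sum>i\<in>{i \<in> {i \<in> I. W i \<subseteq> Z}. W i \<subseteq> G}. h G)"
  proof (intro sum.cong refl)
    fix G assume "G \<in> A"
    then have "{i \<in> {i \<in> I. W i \<subseteq> Z}. W i \<subseteq> G} = {i \<in> I. W i \<subseteq> G}" using assms by auto
    then show "wt G * h G = (\<Sum>i\<in>{i \<in> {i \<in> I. W i \<subseteq> Z}. W i \<subseteq> G}. h G)" by (simp add: wt_def)
  qed
  also have "\<dots> = (\<Sum>i\<in>{i \<in> I. W i \<subseteq> Z}. \<Sum>G\<in>{G \<in> A. W i \<subseteq> G}. h G)"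
    using finA finI by (intro sum.swap_restrict) auto
  finally show ?thesis .
qed

text \<open>Exchanging the sums leaves 2^(|Z| - |W i|) sets G for each i, and \<open>W_sum\<close>
  says that the weights hardly change the trivial count 2^|Z|.\<close>

lemma sum_wt_Pow_le:
  assumes "Z \<subseteq> X"
  shows "(\<Sum>G\<in>Pow Z. wt G) \<le> 2 powr (card Z + card Z / real d ^ 2)"
proof -
  have finZ: "finite Z" using assms finX finite_subset by auto
  have "(\<Sum>G\<in>{G \<in> Pow Z. W i \<subseteq> G}. 1) \<le> 2 powr card Z * 2 powr (- (3 / 4) * card (W i))"
    if i: "W i \<subseteq> Z" for i
  proof -
    have "(\<Sum>G\<in>{G \<in> Pow Z. W i \<subseteq> G}. 1) \<le> (\<Sum>G\<in>Pow (Z - W i). 1 :: real)"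
      using finZ i by (intro sum_supersets_le) auto
    also have "\<dots> = 2 powr (card (Z - W i))"
      using finZ by (simp add: card_Pow powr_realpow)
    also have "\<dots> \<le> 2 powr (card Z + (- (3 / 4) * card (W i)))"
      using finZ i by (intro powr_mono) (auto simp: card_Diff_subset finite_subset card_mono of_nat_diff)
    finally show ?thesis by (simp only: powr_add)
  qed
  then have "(\<Sum>G\<in>Pow Z. wt G * 1)
      \<le> (\<Sum>i\<in>{i \<in> I. W i \<subseteq> Z}. 2 powr card Z * 2 powr (- (3 / 4) * card (W i)))"
    unfolding sum_wt[OF subset_refl finZ] by (intro sum_mono) auto
  also have "\<dots> \<le> 2 powr card Z * 2 powr (card Z / real d ^ 2)"
    unfolding sum_distrib_left[symmetric] using W_sum[OF assms] by (intro mult_left_mono) auto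
  finally show ?thesis by (simp add: powr_add)
qed

text \<open>As F lies in the shadow, 2^-|F| splits off. Against the Finner factor 2^(|F|(d - 1)/d)
  this leaves the gain 2^-(|F|/d), while the sum over i is paid for by the 3/4 for each point of
  \<open>W i\<close>.\<close>

lemma sum_wt_shadow_le:
  assumes S: "S \<subseteq> X" and F: "F \<subseteq> Y" and d: "d > 0"
    and many: "\<And>x. x \<in> S \<Longrightarrow> 3 * d \<le> 4 * card (N x \<inter> F)"
  shows "(\<Sum>G\<in>{G \<in> Pow S. F \<subseteq> sh G}. wt G * 2 powr (- real (card (sh G))))
    \<le> 2 powr (card S / real d ^ 2 - card F / d) *
      exp ((\<Sum>y\<in>sh S - F. 2 powr (real (card (nb y \<inter> S)) - d)) / d)"
proof -
  let ?A = "{G \<in> Pow S. F \<subseteq> sh G}"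
  let ?e = "exp ((\<Sum>y\<in>sh S - F. 2 powr (real (card (nb y \<inter> S)) - d)) / d)"
  have finS: "finite S" using S finX finite_subset by auto
  have "(\<Sum>G\<in>{G \<in> ?A. W i \<subseteq> G}. 2 powr (- real (card (sh G))))
      \<le> 2 powr (- real (card F) / d) * ?e * 2 powr (- (3 / 4) * card (W i))" if i: "W i \<subseteq> S" for i
  proof -
    have "(\<Sum>G\<in>{G \<in> ?A. W i \<subseteq> G}. 2 powr (- real (card (sh G))))
      \<le> (\<Sum>G\<in>Pow (S - W i). 2 powr (- real (card F)) * 2 powr (- real (card (sh G - F))))"
    proof (rule sum_supersets_le)
      fix G assume G: "G \<in> {G \<in> ?A. W i \<subseteq> G}"
      then have fin: "finite (sh G)" using S finite_sh by auto
      have "card F + card (sh (G - W i) - F) = card (F \<union> (sh (G - W i) - F))"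
        using G fin finite_subset[OF sh_mono[of "G - W i" G] fin] finite_subset[of F "sh G"]
        by (subst card_Un_disjoint) auto
      also have "\<dots> \<le> card (sh G)"
        using G fin sh_mono[of "G - W i" G] by (intro card_mono) auto
      finally show "2 powr (- real (card (sh G))) \<le> 2 powr (- real (card F)) * 2 powr (- real (card (sh (G - W i) - F)))"
        by (simp add: powr_add[symmetric] flip: of_nat_add)
    qed (use finS i in auto)
    also have "\<dots> \<le> 2 powr (- real (card F)) * (2 powr (card F * (d - 1) / d - 3 / 4 * card (W i)) * ?e)"
      unfolding sum_distrib_left[symmetric] using assms i
      by (intro mult_left_mono sum_shadow_weight_le) auto
    also have "\<dots> = 2 powr (- real (card F) + (card F * (d - 1) / d - 3 / 4 * card (W i))) * ?e"
      by (simp only: powr_add mult.assoc)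
    also have "\<dots> = 2 powr (- real (card F) / d + - (3 / 4) * card (W i)) * ?e"
      using d by (simp add: field_simps of_nat_diff)
    finally show ?thesis by (simp only: powr_add mult_ac)
  qed
  then have "(\<Sum>G\<in>?A. wt G * 2 powr (- real (card (sh G))))
      \<le> (\<Sum>i\<in>{i \<in> I. W i \<subseteq> S}. 2 powr (- real (card F) / d) * ?e * 2 powr (- (3 / 4) * card (W i)))"
    using finS by (subst sum_wt[of ?A S]) (auto intro!: sum_mono)
  also have "\<dots> \<le> 2 powr (- real (card F) / d) * ?e * 2 powr (card S / real d ^ 2)"
    unfolding sum_distrib_left[symmetric] using W_sum[OF S] by (intro mult_left_mono) auto
  finally show ?thesis by (simp add: powr_diff powr_minus_divide mult.commute)
qed

end

section \<open>Expanding sets\<close>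

context bigraph begin

definition fam :: "'a \<Rightarrow> nat \<Rightarrow> 'a set set" where
  "fam x g = {G. G \<subseteq> X \<and> conn lk x G \<and> card (sh G) = g}"

lemma finite_fam: "finite (fam x g)"
  using finX by (auto simp: fam_def intro: finite_subset[of _ "Pow X"])

lemma lk_ad2: "(x, x') \<in> lk \<Longrightarrow> (x, x') \<in> ad ^^ 2"
  by (auto simp: lk_def ad_def numeral_2_eq_2)

lemma ad_relpow_le: "(x, y) \<in> ad ^^ j \<Longrightarrow> j \<le> k \<Longrightarrow> (x, y) \<in> ad ^^ k"
  using relpow_mono_refl[OF refl_ad] by blast

lemma sym_ad_relpow: "(x, y) \<in> ad ^^ k \<Longrightarrow> (y, x) \<in> ad ^^ k"
  using symD[OF sym_relpow[OF sym_ad]] .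

lemma conn_linkedI:
  assumes G: "conn lk x G" and x: "x \<in> T"
    and near: "\<And>y. y \<in> G \<Longrightarrow> \<exists>t\<in>T. (y, t) \<in> ad ^^ 3"
    and far: "\<And>t. t \<in> T \<Longrightarrow> \<exists>y\<in>G. (y, t) \<in> ad ^^ 3"
  shows "conn linked x T"
proof (rule conn_near[OF G, where near = "\<lambda>y. {t \<in> T. (y, t) \<in> ad ^^ 3}"])
  show "T = (\<Union>y\<in>G. {t \<in> T. (y, t) \<in> ad ^^ 3})" using far by blast
  show "{t \<in> T. (y, t) \<in> ad ^^ 3} \<noteq> {}" if "y \<in> G" for y using near[OF that] by blast
  have "(x, x) \<in> ad ^^ 3" by (rule ad_relpow_le[of _ _ 0]) auto
  then show "x \<in> {t \<in> T. (x, t) \<in> ad ^^ 3}" using x by simp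
next
  fix y z s t
  assume yz: "y = z \<or> (y, z) \<in> lk" and s: "s \<in> {t \<in> T. (y, t) \<in> ad ^^ 3}" and t: "t \<in> {t \<in> T. (z, t) \<in> ad ^^ 3}"
  have "(y, z) \<in> ad ^^ 2" using yz lk_ad2 ad_relpow_le[of y y 0 2] by auto
  then have "(s, t) \<in> ad ^^ (3 + 2 + 3)"
    using s t by (intro relpow_trans[of _ z] relpow_trans[of _ y]) (auto intro: sym_ad_relpow)
  then show "(s, t) \<in> linked" by (simp add: linked_def)
qed

lemma card_rich_le:
  fixes c :: real
  assumes "S \<subseteq> X" "F \<subseteq> Y" "\<And>x. x \<in> S \<Longrightarrow> c \<le> card (N x \<inter> F)"
  shows "card S * c \<le> card F * (real d - 1)"
proof -
  have "card S * c \<le> (\<Sum>x\<in>S. real (card (N x \<inter> F)))"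
    using assms(3) by (intro sum_bounded_below) auto
  also have "\<dots> = real (\<Sum>x\<in>S. card (N x \<inter> F))" by simp
  also have "\<dots> \<le> real (card F * (d - 1))"
    using sum_card_nb_le[OF assms(1,2)] by (simp only: of_nat_le_iff)
  also have "\<dots> \<le> card F * (real d - 1)"
  proof (cases "F = {}")
    case False
    then have "d \<ge> 1" using assms(2) card_nb by fastforce
    then show ?thesis by (simp add: of_nat_diff)
  qed simp
  finally show ?thesis .
qed

text \<open>Every greedy choice covers at least h new points on average, whence the size g/h; the
  root is added so that connected sets can be counted from it.\<close>

lemma expanding_certificate:
  fixes h :: real
  assumes G: "G \<in> fam x g" and h: "0 < h" "h \<le> d"
  shows "\<exists>T\<subseteq>X. conn linked x T \<and> card T \<le> 1 + g / h \<and> T \<subseteq> G \<and> (\<forall>y\<in>G. card (N y - sh T) < h)"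
proof -
  have GX: "G \<subseteq> X" and conn: "conn lk x G" and g: "card (sh G) = g" and xG: "x \<in> G"
    using G by (auto simp: fam_def conn_def)
  have finG: "finite G" using GX finX finite_subset by auto
  have "N y \<subseteq> sh G" if "y \<in> G" for y using that by (auto simp: sh_def)
  then obtain T where T: "T \<subseteq> G" "card T * h \<le> card (\<Union>y\<in>T. N y)"
      "\<And>y. y \<in> G \<Longrightarrow> card (N y - (\<Union>y\<in>T. N y)) < h"
    using greedy_cover[OF h(1) finG finite_sh[OF GX], of N] by blast
  let ?T = "insert x T"
  have TG: "?T \<subseteq> G" using T xG by auto
  have "card (sh T) \<le> g" using sh_mono[OF T(1)] finite_sh[OF GX] g by (metis card_mono)
  then have "card T * h \<le> g" using T(2) by (simp add: sh_def)
  then have "card T \<le> g / h" using h by (simp add: pos_le_divide_eq)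
  then have card: "card ?T \<le> 1 + g / h"
    using card_insert_le_m1[of "Suc (card T)" T x] by linarith
  have un: "card (N y - sh ?T) < h" if "y \<in> G" for y
  proof -
    have "card (N y - sh ?T) \<le> card (N y - (\<Union>y\<in>T. N y))"
      using finite_N that GX by (intro card_mono) (auto simp: sh_def)
    then show ?thesis using T(3)[OF that] by linarith
  qed
  have "conn linked x ?T"
  proof (rule conn_linkedI[OF conn])
    fix y assume y: "y \<in> G"
    \<comment> \<open>Fewer than h <= d of the d neighbours of y are uncovered, so y is linked to a
      point of the certificate.\<close>
    have "N y \<inter> sh ?T \<noteq> {}"
    proof
      assume "N y \<inter> sh ?T = {}"
      then have "N y - sh ?T = N y" by auto
      then show False using un[OF y] card_N[of y] y GX h by auto
    qed
    then obtain t where "t \<in> ?T" "N y \<inter> N t \<noteq> {}" by (auto simp: sh_def)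
    moreover from this have "(y, t) \<in> lk" using y TG GX by (auto simp: lk_def)
    ultimately show "\<exists>t\<in>?T. (y, t) \<in> ad ^^ 3" using lk_ad2 ad_relpow_le[of y t 2 3] by auto
  next
    fix t assume "t \<in> ?T"
    then show "\<exists>y\<in>G. (y, t) \<in> ad ^^ 3" using TG ad_relpow_le[of t t 0 3] by auto
  qed simp
  then show ?thesis using TG GX card un by blast
qed

end

context weighted_bigraph begin

lemma sum_wt_Pow_subset_le:
  fixes b :: real
  assumes "A \<subseteq> Pow Z" "Z \<subseteq> X" "card Z \<le> b"
  shows "(\<Sum>G\<in>A. wt G) \<le> 2 powr (b * (1 + 1 / real d ^ 2))"
proof -
  have finZ: "finite Z" using assms(2) finX by (rule finite_subset)
  have "(\<Sum>G\<in>A. wt G) \<le> (\<Sum>G\<in>Pow Z. wt G)"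
    using assms finZ wt_nonneg by (intro sum_mono2) auto
  also have "\<dots> \<le> 2 powr (card Z * (1 + 1 / real d ^ 2))"
    using sum_wt_Pow_le[OF assms(2)] by (simp add: distrib_left)
  also have "\<dots> \<le> 2 powr (b * (1 + 1 / real d ^ 2))"
    using assms(3) by (intro powr_mono mult_right_mono) auto
  finally show ?thesis .
qed

text \<open>The certificate shows the part F = sh T of the shadow and confines G to S, the points
  with almost all neighbours in F, and |S| is barely larger than |F|. Either F is clearly smaller
  than the shadow, and all subsets of S are affordable; or the few missing shadow points are
  guessed, which fixes the closure, and its subsets are affordable because it has fewer than (1 -
  eta) g points.\<close>

lemma expanding_sum_le:
  fixes h kap eta :: real
  assumes h: "2 \<le> h" "h ^ 2 = d" and kap: "0 \<le> kap" "kap \<le> 1" and eta: "0 \<le> eta" "eta \<le> 1"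
    and T: "T \<subseteq> X"
  shows "(\<Sum>G\<in>{G \<in> {G \<in> fam x g. card (clos G) < (1 - eta) * g}. T \<subseteq> G \<and> (\<forall>y\<in>G. card (N y - sh T) < h)}. wt G)
    \<le> 2 powr (g * ((1 - kap) * (1 + 2 / h) * (1 + 1 / real d ^ 2)))
      + real d powr (2 * kap * g) * exp (2 * g / d) * 2 powr (g * ((1 - eta) * (1 + 1 / real d ^ 2)))"
    (is "(\<Sum>G\<in>?A. wt G) \<le> ?B1 + ?B2")
proof (cases "?A = {}")
  case False
  then obtain G0 where G0: "G0 \<in> ?A" by blast
  have d: "d > 0" and hd: "2 * h \<le> d" "h > 0"
    using h mult_right_mono[of 2 h h] by (auto simp: power2_eq_square intro!: Nat.gr0I)
  define F where "F = sh T"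
  define S where "S = {y \<in> X. card (N y - F) < h}"
  have FY: "F \<subseteq> Y" and SX: "S \<subseteq> X" using sh_subset[OF T] by (auto simp: F_def S_def)
  have inS: "G \<subseteq> S" and Fsub: "F \<subseteq> sh G" and GX: "G \<subseteq> X" and cg: "card (sh G) = g"
    and cl: "card (clos G) < (1 - eta) * g" if "G \<in> ?A" for G
    using that sh_mono[of T G] by (auto simp: S_def F_def fam_def)
  have fin: "finite (sh G)" if "G \<in> ?A" for G using finite_sh GX[OF that] by blast
  have Fg: "card F \<le> g" using Fsub[OF G0] fin[OF G0] cg[OF G0] by (metis card_mono)
  have "real d - h \<le> card (N y \<inter> F)" if "y \<in> S" for y
  proof -
    have y: "y \<in> X" using that by (auto simp: S_def)
    have "card (N y \<inter> F) + card (N y - F) = d"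
      using card_N[OF y] finite_N[OF y] by (metis card_Int_Diff)
    then show ?thesis using that by (simp add: S_def)
  qed
  then have "card S * (real d - h) \<le> card F * (real d - 1)"
    using card_rich_le[OF SX FY] by blast
  also have "\<dots> \<le> card F * ((1 + 2 / h) * (real d - h))"
  proof (intro mult_left_mono)
    \<comment> \<open>As d = h^2, the product equals d + h - 2, which is at least d - 1.\<close>
    have "(1 + 2 / h) * (real d - h) = d + 2 * (d / h) - h - 2"
      using hd by (simp add: field_simps)
    also have "d / h = h" using h hd by (simp add: power2_eq_square field_simps flip: h(2))
    finally show "real d - 1 \<le> (1 + 2 / h) * (real d - h)" using h by simp
  qed simp
  finally have cS: "card S \<le> card F * (1 + 2 / h)" using hd by simp
  show ?thesis
  proof (cases "card F \<le> (1 - kap) * g")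
    case True
    have "card S \<le> (1 - kap) * g * (1 + 2 / h)"
      using cS True h by (smt (verit) divide_nonneg_nonneg mult_right_mono)
    then have "(\<Sum>G\<in>?A. wt G) \<le> 2 powr ((1 - kap) * g * (1 + 2 / h) * (1 + 1 / real d ^ 2))"
      using inS SX by (intro sum_wt_Pow_subset_le[of _ S]) auto
    also have "\<dots> = ?B1" by (simp add: mult_ac)
    finally show ?thesis by (smt (verit) exp_ge_zero mult_nonneg_nonneg powr_ge_zero)
  next
    case False
    define Es where "Es = {E. E \<subseteq> sh S - F \<and> card E \<le> kap * g}"
    have "real (card S) \<le> 2 * g"
    proof -
      have "card F * (1 + 2 / h) \<le> real g * 2" using Fg h by (intro mult_mono) (auto simp: field_simps)
      then show ?thesis using cS by simp
    qed
    then have shS: "card (sh S) \<le> 2 * g * d"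
      using card_sh_le[OF SX] d by (smt (verit, best) mult_right_mono of_nat_0_le_iff of_nat_le_iff of_nat_mult)
    have "card (sh S - F) \<le> card (sh S)" using finite_sh[OF SX] by (intro card_mono) auto
    then have shSF: "real (card (sh S - F)) \<le> 2 * g * d" using shS by linarith
    \<comment> \<open>There are up to 2 g d candidates, so x = 1/d^2 keeps their factor at exp(2 g /
      d).\<close>
    have "real (card Es) \<le> (1 / real d ^ 2) powr (- (kap * g)) * exp ((1 / real d ^ 2) * card (sh S - F))"
      unfolding Es_def using finite_sh[OF SX] d by (intro card_small_subsets_le) auto
    also have "(1 / real d ^ 2) powr (- (kap * g)) = real d powr (2 * kap * g)"
    proof -
      have "1 / real d ^ 2 = real d powr (- 2)" using d by (simp add: powr_minus_divide powr_realpow)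
      then show ?thesis by (simp add: powr_powr mult_ac)
    qed
    also have "exp ((1 / real d ^ 2) * card (sh S - F)) \<le> exp (2 * g / d)"
    proof -
      have "(1 / real d ^ 2) * card (sh S - F) \<le> (1 / real d ^ 2) * (2 * g * d)"
        using shSF by (intro mult_left_mono) auto
      then show ?thesis using d by (simp add: power2_eq_square)
    qed
    finally have cE: "real (card Es) \<le> real d powr (2 * kap * g) * exp (2 * g / d)"
      by (simp add: mult_left_mono)
    have "(\<Sum>G\<in>?A. wt G) \<le> card Es * 2 powr ((1 - eta) * g * (1 + 1 / real d ^ 2))"
    proof (rule sum_le_certificate_count[where V = "\<lambda>E G. sh G = F \<union> E"])
      show "finite ?A" using finite_fam by auto
      show "finite Es" unfolding Es_def using finite_sh[OF SX] by (auto intro: finite_subset[of _ "Pow (sh S)"])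
      show "\<exists>E\<in>Es. sh G = F \<union> E" if G: "G \<in> ?A" for G
      proof (intro bexI[of _ "sh G - F"])
        have "card (sh G - F) = g - card F"
          using Fsub[OF G] fin[OF G] cg[OF G] by (subst card_Diff_subset) (auto intro: finite_subset)
        then have "card (sh G - F) \<le> kap * g"
          using False Fg by (simp add: of_nat_diff algebra_simps)
        then show "sh G - F \<in> Es" using sh_mono[OF inS[OF G]] by (auto simp: Es_def)
      qed (use Fsub[OF G] in auto)
    next
      fix E assume "E \<in> Es"
      let ?C = "{G \<in> ?A. sh G = F \<union> E}"
      show "(\<Sum>G\<in>?C. wt G) \<le> 2 powr ((1 - eta) * g * (1 + 1 / real d ^ 2))"
      proof (cases "?C = {}")
        case False
        then obtain G1 where G1: "G1 \<in> ?A" "sh G1 = F \<union> E" by blast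
        \<comment> \<open>Sets with equal shadow have equal closure; any one of them supplies the
          bound on its size.\<close>
        have "G \<subseteq> clos G1" if "G \<in> ?C" for G
          using that GX[of G] G1 by (auto simp: clos_def sh_def)
        then show ?thesis
          using cl[OF G1(1)] clos_subset by (intro sum_wt_Pow_subset_le[of _ "clos G1"]) auto
      next
        case True
        show ?thesis unfolding True by simp
      qed
    qed (rule wt_nonneg)
    also have "\<dots> \<le> real d powr (2 * kap * g) * exp (2 * g / d) * 2 powr ((1 - eta) * g * (1 + 1 / real d ^ 2))"
      using cE by (intro mult_right_mono) auto
    also have "\<dots> = ?B2" by (simp add: mult_ac)
    finally show ?thesis by (smt (verit) powr_ge_zero)
  qed
next
  case True
  show ?thesis unfolding True by simp
qed

end

section \<open>Sets whose closure almost fills the shadow\<close>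

context bigraph begin

text \<open>A certificate \<open>(T, E)\<close> stores the chosen points of both sides in \<open>T\<close>, and in \<open>E\<close> those neighbours
  of \<open>T \<inter> Y\<close> that lie outside the closure, so that \<open>core T E\<close> can be read off as part of the shadow.\<close>

definition core :: "'a set \<Rightarrow> 'a set \<Rightarrow> 'a set" where
  "core T E = sh (\<Union> (nb ` (T \<inter> Y)) - E) \<union> sh (T \<inter> X)"

definition rich_set :: "'a set \<Rightarrow> 'a set" where
  "rich_set F = {x \<in> X. 3 * d \<le> 4 * card (N x \<inter> F)}"

text \<open>By \<open>codeg\<close>, the neighbourhoods of points above a common y meet only in
  y.\<close>

lemma card_sh_star:
  assumes "A \<subseteq> nb y"
  shows "card A * (d - 1) \<le> card (sh A)"
proof -
  have A: "A \<subseteq> X" "\<And>x. x \<in> A \<Longrightarrow> y \<in> N x" using assms by (auto simp: nb_def)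
  have fin: "finite A" using A finX finite_subset by blast
  have "card A * (d - 1) = (\<Sum>x\<in>A. card (N x - {y}))"
    using A card_N by (simp add: card_Diff_singleton subset_iff)
  also have "\<dots> = card (\<Union>x\<in>A. N x - {y})"
  proof (rule card_UN_disjoint[symmetric])
    show "\<forall>x\<in>A. \<forall>x'\<in>A. x \<noteq> x' \<longrightarrow> (N x - {y}) \<inter> (N x' - {y}) = {}"
      using A codeg by blast
  qed (use fin A finite_N in auto)
  also have "\<dots> \<le> card (sh A)"
    using finite_sh[OF A(1)] by (intro card_mono) (auto simp: sh_def)
  finally show ?thesis .
qed

lemma sum_card_sym:
  assumes "finite U" "finite D" and sym: "\<And>u v. u \<in> U \<Longrightarrow> v \<in> D \<Longrightarrow> v \<in> R u \<longleftrightarrow> u \<in> R v"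
    and sub: "\<And>u. u \<in> U \<Longrightarrow> R u \<subseteq> D"
  shows "(\<Sum>u\<in>U. card (R u)) = (\<Sum>v\<in>D. card (R v \<inter> U))"
proof -
  have "(\<Sum>u\<in>U. card (R u)) = (\<Sum>u\<in>U. \<Sum>v\<in>{v \<in> D. u \<in> R v}. 1)"
  proof (intro sum.cong refl)
    fix u assume u: "u \<in> U"
    then have "R u = {v \<in> D. u \<in> R v}" using sym sub by blast
    then show "card (R u) = (\<Sum>v\<in>{v \<in> D. u \<in> R v}. 1)" by simp
  qed
  also have "\<dots> = (\<Sum>v\<in>D. \<Sum>u\<in>{u \<in> U. u \<in> R v}. 1)"
    using assms by (intro sum.swap_restrict)
  also have "\<dots> = (\<Sum>v\<in>D. card (R v \<inter> U))"
    by (intro sum.cong refl) (auto intro!: arg_cong[where f = card])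
  finally show ?thesis .
qed

text \<open>One second neighbourhood, taken through the closure, has order d^2 points, so about
  g/d^2 of them cover most of the shadow; this is far cheaper than covering by neighbourhoods of
  size d. Only the remaining 5 tau g points are covered at rate d.\<close>

lemma tight_certificate:
  fixes tau :: real
  assumes G: "G \<in> fam x g" and cl: "(1 - tau ^ 4) * g \<le> card (clos G)"
    and tau: "0 < tau" "tau \<le> 1" and d: "d / 2 \<le> (1 - tau ^ 2) * (real d - 1)" "d > 0"
  shows "\<exists>T E. T \<subseteq> X \<union> Y \<and> conn linked x T \<and> card T \<le> 1 + g / (tau * d ^ 2) + 20 * tau * g / d
    \<and> card (T \<inter> Y) \<le> g / (tau * d ^ 2) \<and> E \<subseteq> \<Union> (nb ` (T \<inter> Y)) \<and> card E \<le> tau * g / d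
    \<and> core T E \<subseteq> sh G \<and> G \<subseteq> rich_set (core T E) \<and> (1 - 5 * tau) * g \<le> card (core T E)"
proof -
  define C where "C = clos G"
  define D where "D = sh G"
  define R where "R y = sh (nb y \<inter> C)" for y
  have GX: "G \<subseteq> X" and conn: "conn lk x G" and g: "card D = g" and xG: "x \<in> G"
    using G by (auto simp: fam_def conn_def D_def)
  have finG: "finite G" using GX finX finite_subset by blast
  have CX: "C \<subseteq> X" and GC: "G \<subseteq> C" and shC: "sh C = D" and DY: "D \<subseteq> Y" and finD: "finite D"
    unfolding C_def D_def using clos_subset subset_clos[OF GX] sh_clos[OF GX] sh_subset[OF GX] finite_sh[OF GX] by auto
  have RD: "R y \<subseteq> D" for y unfolding R_def shC[symmetric] by (intro sh_mono) auto
  have finR: "finite (R y)" for y using RD finD finite_subset by blast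
  have deg: "real (card (nb y \<inter> C)) \<le> d" "card (nb y) \<le> d" if "y \<in> D" for y
  proof -
    have y: "y \<in> Y" using that DY by auto
    have "card (nb y \<inter> C) \<le> card (nb y)" using finite_nb by (intro card_mono) auto
    then show "real (card (nb y \<inter> C)) \<le> d" "card (nb y) \<le> d" using card_nb[OF y] by auto
  qed

  \<comment> \<open>At most tau^4 g d edges are missing between the closure and a full degree d on
    the shadow. A point outside \<open>D'\<close> misses more than tau^2 d of them, so there are at
    most tau^2 g such points.\<close>
  define D' where "D' = {y \<in> D. (1 - tau ^ 2) * d \<le> card (nb y \<inter> C)}"
  have D'D: "D' \<subseteq> D" by (auto simp: D'_def)
  have "(\<Sum>y\<in>D. real (card (nb y \<inter> C))) = real (\<Sum>x\<in>C. card (N x \<inter> D))"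
    using double_count[OF CX DY] by simp
  also have "(\<Sum>x\<in>C. card (N x \<inter> D)) = (\<Sum>x\<in>C. d)"
  proof (intro sum.cong refl)
    fix x assume x: "x \<in> C"
    then have "N x \<inter> D = N x" using shC by (auto simp: sh_def)
    then show "card (N x \<inter> D) = d" using card_N x CX by auto
  qed
  finally have total: "(\<Sum>y\<in>D. real (card (nb y \<inter> C))) = card C * d" by simp
  have missing: "real g * d - card C * d \<le> tau ^ 4 * g * d"
  proof -
    have "(1 - tau ^ 4) * g * d \<le> card C * real d" using cl unfolding C_def by (intro mult_right_mono) auto
    then show ?thesis by (simp add: algebra_simps)
  qed
  have "card (D - D') * (tau ^ 2 * d) \<le> (\<Sum>y\<in>D - D'. d - real (card (nb y \<inter> C)))"
    by (rule sum_bounded_below) (auto simp: D'_def algebra_simps)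
  also have "\<dots> \<le> (\<Sum>y\<in>D. d - real (card (nb y \<inter> C)))"
    using finD deg by (intro sum_mono2) auto
  also have "\<dots> = real g * d - card C * d" by (simp add: sum_subtractf total g)
  also have "\<dots> \<le> (tau ^ 2 * g) * (tau ^ 2 * d)" using missing by (simp add: power4_eq_xxxx power2_eq_square mult_ac)
  finally have bad: "card (D - D') \<le> tau ^ 2 * g" using tau d(2) by (simp add: mult_le_cancel_right)

  have R_large: "real d ^ 2 / 2 \<le> card (R y)" if y: "y \<in> D'" for y
  proof -
    have "real d ^ 2 / 2 = d / 2 * d" by (simp add: power2_eq_square)
    also have "\<dots> \<le> ((1 - tau ^ 2) * (real d - 1)) * d" using d by (intro mult_right_mono) auto
    also have "\<dots> = ((1 - tau ^ 2) * d) * (real d - 1)" by simp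
    also have "\<dots> \<le> card (nb y \<inter> C) * (real d - 1)"
      using y d(2) by (intro mult_right_mono) (auto simp: D'_def)
    also have "\<dots> = real (card (nb y \<inter> C) * (d - 1))" using d(2) by (simp add: of_nat_diff)
    also have "\<dots> \<le> card (R y)" unfolding R_def of_nat_le_iff by (rule card_sh_star) auto
    finally show ?thesis .
  qed
  have R_small: "card (R y) \<le> real d ^ 2" if "y \<in> D" for y
  proof -
    have "card (R y) \<le> card (nb y \<inter> C) * d" unfolding R_def using CX by (intro card_sh_le) auto
    then have "real (card (R y)) \<le> card (nb y \<inter> C) * real d" by (metis of_nat_le_iff of_nat_mult)
    also have "\<dots> \<le> real d * d" using deg[OF that] by (intro mult_right_mono) auto
    finally show ?thesis by (simp add: power2_eq_square)
  qed

  \<comment> \<open>Centres are taken from \<open>D'\<close>, where the second neighbourhoods have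
    at least d^2/2 points.\<close>
  obtain T0 where T0: "T0 \<subseteq> D'" "card T0 * (tau * d ^ 2) \<le> card (\<Union>y\<in>T0. R y)"
    "\<And>y. y \<in> D' \<Longrightarrow> card (R y - (\<Union>y\<in>T0. R y)) < tau * d ^ 2"
    using greedy_cover[of "tau * d ^ 2" D' D R] tau d finD RD D'D finite_subset[OF D'D] by auto
  define F0 where "F0 = (\<Union>y\<in>T0. R y)"
  have F0D: "F0 \<subseteq> D" using RD by (auto simp: F0_def)
  have "real (card F0) \<le> g" using card_mono[OF finD F0D] g by simp
  then have "card T0 * (tau * d ^ 2) \<le> g" using T0(2) by (simp add: F0_def)
  then have cT0: "card T0 \<le> g / (tau * d ^ 2)" using tau d by (simp add: pos_le_divide_eq)

  define U where "U = D' - F0"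
  have finU: "finite U" using finD D'D finite_subset by (auto simp: U_def)
  \<comment> \<open>The relation is symmetric: u and y are in each other's \<open>R\<close> when
    they share a neighbour in the closure. Counted from the other end, a point of \<open>D'\<close>
    meets fewer than tau d^2 uncovered points because the greedy choice has stopped, and a point
    outside \<open>D'\<close> at most d^2.\<close>
  have "card U * (real d ^ 2 / 2) \<le> (\<Sum>y\<in>U. real (card (R y)))"
    using R_large by (intro sum_bounded_below) (auto simp: U_def)
  also have "\<dots> = real (\<Sum>y\<in>U. card (R y))" by simp
  also have "(\<Sum>y\<in>U. card (R y)) = (\<Sum>y\<in>D. card (R y \<inter> U))"
    using finU finD RD by (intro sum_card_sym) (auto simp: R_def sh_def nb_def)
  also have "real \<dots> = (\<Sum>y\<in>D - D'. real (card (R y \<inter> U))) + (\<Sum>y\<in>D'. real (card (R y \<inter> U)))"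
    using finD D'D by (simp add: sum.subset_diff)
  also have "\<dots> \<le> (\<Sum>y\<in>D - D'. real d ^ 2) + (\<Sum>y\<in>D'. tau * d ^ 2)"
  proof (intro add_mono sum_mono)
    fix y assume y: "y \<in> D - D'"
    have "card (R y \<inter> U) \<le> card (R y)" using finR by (intro card_mono) auto
    then show "real (card (R y \<inter> U)) \<le> real d ^ 2" using R_small[of y] y by force
  next
    fix y assume y: "y \<in> D'"
    have "card (R y \<inter> U) \<le> card (R y - F0)" using finR by (intro card_mono) (auto simp: U_def)
    then show "real (card (R y \<inter> U)) \<le> tau * d ^ 2" using T0(3)[OF y] by (simp add: F0_def)
  qed
  also have "\<dots> = card (D - D') * real d ^ 2 + card D' * (tau * d ^ 2)" by simp
  also have "\<dots> \<le> tau ^ 2 * g * real d ^ 2 + g * (tau * d ^ 2)"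
    using bad card_mono[OF finD D'D] g tau by (intro add_mono mult_right_mono) auto
  also have "\<dots> \<le> 4 * tau * g * (real d ^ 2 / 2)"
  proof -
    have "tau ^ 2 \<le> tau" using tau by (simp add: power2_eq_square mult_left_le)
    then have "tau ^ 2 * g * real d ^ 2 \<le> tau * g * real d ^ 2" by (intro mult_right_mono) auto
    then show ?thesis by (simp add: mult_ac)
  qed
  finally have cU: "card U \<le> 4 * tau * g" using d(2) by (simp add: mult_le_cancel_right)
  have "card (D - F0) \<le> card ((D - D') \<union> U)" using finD finU by (intro card_mono) (auto simp: U_def)
  also have "\<dots> \<le> card (D - D') + card U" by (rule card_Un_le)
  finally have "real (card (D - F0)) \<le> card (D - D') + card U" by linarith
  also have "\<dots> \<le> tau ^ 2 * g + 4 * tau * g" using bad cU by linarith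
  also have "\<dots> \<le> 5 * tau * g"
    using mult_right_mono[of "tau ^ 2" tau "real g"] tau by (simp add: power2_eq_square mult_left_le)
  finally have cDF0: "card (D - F0) \<le> 5 * tau * g" .

  \<comment> \<open>The threshold d/4 makes every point of G rich, with more than 3d/4 neighbours in
    the core. The price is 5 tau g divided by d/4.\<close>
  obtain T2 where T2: "T2 \<subseteq> G" "card T2 * (d / 4) \<le> card (\<Union>y\<in>T2. N y - F0)"
    "\<And>y. y \<in> G \<Longrightarrow> card ((N y - F0) - (\<Union>y\<in>T2. N y - F0)) < d / 4"
  proof -
    have "N y - F0 \<subseteq> D" if "y \<in> G" for y using that by (auto simp: D_def sh_def)
    then show ?thesis using greedy_cover[of "d / 4" G D "\<lambda>y. N y - F0"] d(2) finG finD that by auto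
  qed
  have "(\<Union>y\<in>T2. N y - F0) \<subseteq> D - F0" using T2(1) by (auto simp: D_def sh_def)
  then have "card (\<Union>y\<in>T2. N y - F0) \<le> card (D - F0)" using finD by (intro card_mono) auto
  then have "card T2 * (d / 4) \<le> 5 * tau * g" using T2(2) cDF0 by linarith
  then have cT2: "card T2 \<le> 20 * tau * g / d" using d(2) by (simp add: field_simps)

  define T where "T = T0 \<union> insert x T2"
  have T0Y: "T0 \<subseteq> Y" and T2X: "insert x T2 \<subseteq> X" using T0(1) D'D DY T2(1) xG GX by auto
  have TY: "T \<inter> Y = T0" and TX: "T \<inter> X = insert x T2" using T0Y T2X disj by (auto simp: T_def)
  \<comment> \<open>\<open>T0\<close> alone shows its whole neighbourhoods; knowing which points
    fall outside the closure recovers \<open>F0\<close>. A centre has at most tau^2 d of these, and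
    there are at most g/(tau d^2) centres.\<close>
  define E where "E = \<Union> (nb ` T0) - C"
  have fin0: "finite T0" using T0Y finY finite_subset by blast
  have EC: "\<Union> (nb ` T0) - E = \<Union> (nb ` T0) \<inter> C" by (auto simp: E_def)
  have core: "core T E = F0 \<union> sh (insert x T2)"
    unfolding core_def TY TX EC by (auto simp: F0_def R_def sh_def)
  have sub: "core T E \<subseteq> D"
    unfolding core using F0D sh_mono[of "insert x T2" G] T2(1) xG by (auto simp: D_def)
  have rich: "3 * d < 4 * card (N y \<inter> core T E)" if y: "y \<in> G" for y
  proof -
    have yX: "y \<in> X" using y GX by auto
    have "card (N y - core T E) \<le> card ((N y - F0) - (\<Union>y\<in>T2. N y - F0))"
      using finite_N[OF yX] by (intro card_mono) (auto simp: core sh_def)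
    then have "card (N y - core T E) < d / 4" using T2(3)[OF y] by linarith
    moreover have "card (N y \<inter> core T E) + card (N y - core T E) = d"
      using card_N[OF yX] finite_N[OF yX] by (metis card_Int_Diff)
    ultimately show ?thesis by linarith
  qed
  have "card T \<le> card T0 + card (insert x T2)" unfolding T_def by (rule card_Un_le)
  moreover have "card (insert x T2) \<le> 1 + card T2" using card_insert_le_m1[of "Suc (card T2)" T2 x] by simp
  ultimately have cT: "card T \<le> 1 + g / (tau * d ^ 2) + 20 * tau * g / d" using cT0 cT2 by linarith
  have cE: "card E \<le> tau * g / d"
  proof -
    have "E = (\<Union>y\<in>T0. nb y - C)" by (auto simp: E_def)
    then have "card E \<le> (\<Sum>y\<in>T0. card (nb y - C))" using fin0 card_UN_le by metis
    then have "real (card E) \<le> (\<Sum>y\<in>T0. real (card (nb y - C)))" by (metis of_nat_le_iff of_nat_sum)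
    also have "\<dots> \<le> card T0 * (tau ^ 2 * d)"
    proof (rule sum_bounded_above)
      fix y assume "y \<in> T0"
      then have y: "y \<in> D'" "y \<in> D" using T0(1) D'D by auto
      have "card (nb y \<inter> C) + card (nb y - C) = card (nb y)"
        using finite_nb by (metis card_Int_Diff)
      then show "real (card (nb y - C)) \<le> tau ^ 2 * d"
        using deg(2)[OF y(2)] y(1) by (simp add: D'_def algebra_simps)
    qed
    also have "\<dots> \<le> g / (tau * d ^ 2) * (tau ^ 2 * d)" using cT0 by (intro mult_right_mono) auto
    also have "\<dots> = tau * g / d" using tau d by (simp add: power2_eq_square field_simps)
    finally show ?thesis .
  qed
  have "conn linked x T"
  proof (rule conn_linkedI[OF conn])
    show "x \<in> T" by (simp add: T_def)
    fix y assume y: "y \<in> G"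
    then have yX: "y \<in> X" using GX by auto
    have "N y \<inter> core T E \<noteq> {}" using rich[OF y] d(2) by auto
    then obtain z where z: "z \<in> N y" "z \<in> core T E" by blast
    show "\<exists>t\<in>T. (y, t) \<in> ad ^^ 3"
    proof (cases "z \<in> F0")
      case True
      then obtain t y' where t: "t \<in> T0" "y' \<in> nb t" "z \<in> N y'" by (auto simp: F0_def R_def sh_def)
      \<comment> \<open>The path from y through z and y' to the centre t has three edges, the reason
        for distance 3 in the certificates.\<close>
      have "(y, z) \<in> ad" "(z, y') \<in> ad" "(y', t) \<in> ad" using t z yX by (auto simp: ad_def nb_def)
      then have "(y, t) \<in> ad ^^ 3" by (auto simp: numeral_3_eq_3)
      then show ?thesis using t by (auto simp: T_def)
    next
      case False
      then obtain t where t: "t \<in> insert x T2" "z \<in> N t" using z by (auto simp: core sh_def)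
      then have "(y, t) \<in> lk" using z yX T2X by (auto simp: lk_def)
      then have "(y, t) \<in> ad ^^ 3" using lk_ad2 ad_relpow_le[of y t 2 3] by auto
      then show ?thesis using t by (auto simp: T_def)
    qed
  next
    fix t assume "t \<in> T"
    then consider "t \<in> T0" | "t \<in> G" using T2(1) xG by (auto simp: T_def)
    then show "\<exists>y\<in>G. (y, t) \<in> ad ^^ 3"
    proof cases
      case 1
      then obtain y where "y \<in> G" "t \<in> N y" using T0(1) D'D by (auto simp: D_def sh_def)
      then have "(y, t) \<in> ad ^^ 1" "y \<in> G" using GX by (auto simp: ad_def)
      then show ?thesis using ad_relpow_le[of y t 1 3] by auto
    next
      case 2
      then show ?thesis using ad_relpow_le[of t t 0 3] by auto
    qed
  qed
  moreover have "G \<subseteq> rich_set (core T E)" using rich GX by (auto simp: rich_set_def intro: less_imp_le)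
  moreover have "(1 - 5 * tau) * g \<le> card (core T E)"
  proof -
    have "card (D - F0) = card D - card F0" using F0D finD by (meson card_Diff_subset finite_subset)
    moreover have "card F0 \<le> card (core T E)"
      using sub finD by (intro card_mono) (auto simp: core intro: finite_subset)
    ultimately show ?thesis using cDF0 g card_mono[OF finD F0D] by (simp add: of_nat_diff algebra_simps)
  qed
  moreover have "T \<subseteq> X \<union> Y" using T0Y T2X by (auto simp: T_def)
  moreover have "E \<subseteq> \<Union> (nb ` (T \<inter> Y))" unfolding TY E_def by auto
  moreover have "card (T \<inter> Y) \<le> g / (tau * d ^ 2)" unfolding TY by (rule cT0)
  ultimately show ?thesis using cT cE sub unfolding D_def by blast
qed

end

section \<open>The boundary term for tight sets, and their total weight\<close>

context bigraph begin

lemma card_rich_set_le: 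
  assumes "F \<subseteq> Y" "d > 0"
  shows "card (rich_set F) \<le> 2 * real (card F)"
proof -
  have "card (rich_set F) * (3 * d / 4) \<le> card F * (real d - 1)"
    using assms(1) by (intro card_rich_le) (auto simp: rich_set_def)
  also have "\<dots> \<le> card F * (3 * d / 2)" by (intro mult_left_mono) auto
  finally have "card (rich_set F) * (3 * d / 4) \<le> 2 * real (card F) * (3 * d / 4)" by (simp add: mult_ac)
  then show ?thesis using assms(2) by (simp add: mult_le_cancel_right)
qed

text \<open>This bounds the correction term of Finner's inequality. A point y matters only if more
  than d/2 of its neighbours lie in S; such points are few, both inside the shadow and outside
  it.\<close>

lemma tight_boundary_sum_le:
  fixes tau :: real
  assumes G: "G \<in> fam x g" and cl: "(1 - tau ^ 4) * g \<le> card (clos G)" and tau: "0 < tau" "tau \<le> 1" and d: "d > 0"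
    and F: "F \<subseteq> sh G" "(1 - 5 * tau) * g \<le> card F" and S: "S = rich_set F"
  shows "(\<Sum>y\<in>sh S - F. 2 powr (real (card (nb y \<inter> S)) - d)) \<le> g * (9 * tau + 2 * d * 2 powr (- (d / 2)))"
proof -
  define C where "C = clos G"
  define D where "D = sh G"
  have GX: "G \<subseteq> X" and g: "card D = g" using G by (auto simp: fam_def D_def)
  have CX: "C \<subseteq> X" and shC: "sh C = D" and DY: "D \<subseteq> Y" and finD: "finite D"
    unfolding C_def D_def using clos_subset sh_clos[OF GX] sh_subset[OF GX] finite_sh[OF GX] by auto
  have FD: "F \<subseteq> D" and SX: "S \<subseteq> X" and FY: "F \<subseteq> Y" using F DY by (auto simp: D_def S rich_set_def)
  have fin: "finite S" "finite C" "finite (sh S)" using SX CX finX finite_subset finite_sh by blast+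
  have Fg: "real (card F) \<le> g" using card_mono[OF finD FD] g by simp
  have cS: "card S \<le> 2 * real g" using card_rich_set_le[OF FY d] Fg by (simp add: S)
  have "tau ^ 4 \<le> tau" using tau power_decreasing[of 1 4 tau] by simp
  \<comment> \<open>The closure already uses almost all the edges that the shadow can carry, and
    each further rich point would use 3d/4 more.\<close>
  have "card (S - C) * (3 * d / 4) \<le> (\<Sum>x\<in>S - C. real (card (N x \<inter> D)))"
  proof (rule sum_bounded_below)
    fix x assume "x \<in> S - C"
    then have x: "x \<in> X" "3 * d \<le> 4 * card (N x \<inter> F)" using SX by (auto simp: S rich_set_def)
    have "card (N x \<inter> F) \<le> card (N x \<inter> D)" using FD finD by (intro card_mono) auto
    then show "3 * d / 4 \<le> real (card (N x \<inter> D))" using x by simp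
  qed
  also have "\<dots> = (\<Sum>x\<in>S \<union> C. real (card (N x \<inter> D))) - (\<Sum>x\<in>C. real (card (N x \<inter> D)))"
  proof -
    have "S \<union> C = (S - C) \<union> C" by auto
    then have "(\<Sum>x\<in>S \<union> C. real (card (N x \<inter> D))) =
        (\<Sum>x\<in>S - C. real (card (N x \<inter> D))) + (\<Sum>x\<in>C. real (card (N x \<inter> D)))"
      using fin sum.union_disjoint[of "S - C" C "\<lambda>x. real (card (N x \<inter> D))"] by auto
    then show ?thesis by simp
  qed
  also have "(\<Sum>x\<in>S \<union> C. real (card (N x \<inter> D))) \<le> real g * d"
  proof -
    have "(\<Sum>x\<in>S \<union> C. card (N x \<inter> D)) \<le> g * (d - 1)"
      using sum_card_nb_le[of "S \<union> C" D] SX CX DY g by simp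
    then have "(\<Sum>x\<in>S \<union> C. card (N x \<inter> D)) \<le> g * d"
      using order_trans[OF _ mult_le_mono2[of "d - 1" d g]] by simp
    then show ?thesis by (metis of_nat_le_iff of_nat_mult of_nat_sum)
  qed
  also have "(\<Sum>x\<in>C. real (card (N x \<inter> D))) = card C * real d"
  proof -
    have "card (N x \<inter> D) = d" if x: "x \<in> C" for x
    proof -
      have "N x \<inter> D = N x" using shC x by (auto simp: sh_def)
      then show ?thesis using card_N x CX by auto
    qed
    then show ?thesis by simp
  qed
  also have "real g * d - card C * real d \<le> tau * g * d"
  proof -
    have "(1 - tau) * g * d \<le> (1 - tau ^ 4) * g * d" using \<open>tau ^ 4 \<le> tau\<close> by (intro mult_right_mono) auto
    also have "\<dots> \<le> card C * real d" using cl unfolding C_def by (intro mult_right_mono) auto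
    finally show ?thesis by (simp add: algebra_simps)
  qed
  finally have "card (S - C) * (3 / 4) * d \<le> tau * g * d" by simp
  then have cSC: "card (S - C) * (3 / 4) \<le> tau * g" using d by (simp add: mult_le_cancel_right)

  define B where "B = {y \<in> sh S - F. d / 2 < card (nb y \<inter> S)}"
  have shSY: "sh S \<subseteq> Y" using SX by (rule sh_subset)
  have BY: "B \<subseteq> Y" using shSY by (auto simp: B_def)
  have finB: "finite B" using BY finY finite_subset by blast
  \<comment> \<open>A point outside the shadow has no neighbour in the closure, so its more than d/2
    neighbours in S all lie in the small set S - C.\<close>
  have "card (B - D) * (d / 2) \<le> (\<Sum>y\<in>B - D. real (card (nb y \<inter> (S - C))))"
  proof (rule sum_bounded_below)
    fix y assume y: "y \<in> B - D"
    then have "nb y \<inter> C = {}" using mem_sh_iff[OF CX] shC by auto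
    then have "nb y \<inter> (S - C) = nb y \<inter> S" by auto
    then show "d / 2 \<le> real (card (nb y \<inter> (S - C)))" using y by (simp add: B_def)
  qed
  also have "\<dots> = real (\<Sum>x\<in>S - C. card (N x \<inter> (B - D)))"
    using SX BY by (subst double_count) auto
  also have "\<dots> \<le> card (S - C) * d"
  proof -
    have "(\<Sum>x\<in>S - C. card (N x \<inter> (B - D))) \<le> of_nat (card (S - C)) * d"
    proof (rule sum_bounded_above)
      fix x assume "x \<in> S - C"
      then have x: "x \<in> X" using SX by auto
      show "card (N x \<inter> (B - D)) \<le> d"
        using card_mono[OF finite_N[OF x], of "N x \<inter> (B - D)"] card_N[OF x] by simp
    qed
    then show ?thesis by (metis of_nat_id of_nat_le_iff of_nat_mult)
  qed
  finally have "card (B - D) * (1 / 2) * d \<le> real (card (S - C)) * d" by simp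
  then have "card (B - D) * (1 / 2) \<le> real (card (S - C))" using d by (simp add: mult_le_cancel_right)
  then have BD: "card (B - D) \<le> 4 * tau * g" using cSC tau by (simp add: mult_ac)
  have "card (B \<inter> D) \<le> card (D - F)" using finD by (intro card_mono) (auto simp: B_def)
  also have "card (D - F) = g - card F" using FD finD g by (metis card_Diff_subset finite_subset)
  finally have BD': "card (B \<inter> D) \<le> 5 * tau * g" using F(2) Fg by (simp add: of_nat_diff algebra_simps)
  have "card B = card (B \<inter> D) + card (B - D)" using finB by (metis card_Int_Diff)
  then have cB: "card B \<le> 9 * tau * g" using BD BD' by simp

  have "(\<Sum>y\<in>sh S - F. 2 powr (real (card (nb y \<inter> S)) - d))
      = (\<Sum>y\<in>(sh S - F) - B. 2 powr (real (card (nb y \<inter> S)) - d)) + (\<Sum>y\<in>B. 2 powr (real (card (nb y \<inter> S)) - d))"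
    using fin by (intro sum.subset_diff) (auto simp: B_def)
  also have "\<dots> \<le> (\<Sum>y\<in>(sh S - F) - B. 2 powr (- (d / 2))) + (\<Sum>y\<in>B. 1)"
  proof (intro add_mono sum_mono)
    fix y assume "y \<in> B"
    then have "card (nb y) < d" using card_nb BY by auto
    moreover have "card (nb y \<inter> S) \<le> card (nb y)" using finite_nb by (intro card_mono) auto
    ultimately show "2 powr (real (card (nb y \<inter> S)) - d) \<le> 1"
      using powr_mono[of "real (card (nb y \<inter> S)) - d" 0 2] by simp
  qed (auto simp: B_def)
  also have "\<dots> = card ((sh S - F) - B) * 2 powr (- (d / 2)) + card B" by simp
  also have "card ((sh S - F) - B) \<le> card (sh S)" using fin by (intro card_mono) auto
  also have "card (sh S) \<le> 2 * g * d"
  proof -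
    have "card S \<le> 2 * g" using cS by linarith
    then show ?thesis using card_sh_le[OF SX] mult_le_mono1[of "card S" "2 * g" d] by linarith
  qed
  finally have "(\<Sum>y\<in>sh S - F. 2 powr (real (card (nb y \<inter> S)) - d)) \<le> real (2 * g * d) * 2 powr (- (d / 2)) + card B"
    by (simp add: mult_right_mono)
  also have "\<dots> \<le> g * (9 * tau + 2 * d * 2 powr (- (d / 2)))" using cB by (simp add: algebra_simps)
  finally show ?thesis .
qed

end

context weighted_bigraph begin

text \<open>The three factors are the number of sets T, the number of sets E for one T, and the
  weighted sum over the G compatible with one core.\<close>

lemma tight_sum_le:
  fixes tau :: real
  assumes tau: "0 < tau" "tau \<le> 1" and d: "d / 2 \<le> (1 - tau ^ 2) * (real d - 1)" "d > 0"
  shows "(\<Sum>G\<in>{G \<in> fam x g. (1 - tau ^ 4) * g \<le> card (clos G)}. wt G * 2 powr (- real g))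
    \<le> (d + 1) powr (16 * (1 + g / (tau * d ^ 2) + 20 * tau * g / d)) *
      (d powr (tau * g / d) * exp (g / (tau * d ^ 2))) *
      (2 powr (2 * real g / real d ^ 2 - (1 - 5 * tau) * g / d) * exp (g * (9 * tau + 2 * d * 2 powr (- (d / 2))) / d))"
    (is "sum _ ?A \<le> ?c1 * ?c2 * ?b")
proof -
  define m where "m = 1 + g / (tau * d ^ 2) + 20 * tau * g / d"
  have m: "m \<ge> 0" using tau by (simp add: m_def)
  define Ts where "Ts = {T. finite T \<and> conn linked x T \<and> card T \<le> m}"
  define Ts' where "Ts' = {T \<in> Ts. T \<subseteq> X \<union> Y \<and> card (T \<inter> Y) \<le> g / (tau * d ^ 2)}"
  define Es where "Es T = {E. E \<subseteq> \<Union> (nb ` (T \<inter> Y)) \<and> card E \<le> tau * g / d}" for T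
  have finTs: "finite Ts" and cTs: "card Ts \<le> ?c1"
    unfolding Ts_def m_def[symmetric] by (rule card_linked_sets_le[OF m])+
  have finE: "finite (\<Union> (nb ` (T \<inter> Y)))" for T using finY finite_nb by auto
  have finEs: "finite (Es T)" for T
    using finE[of T] by (auto simp: Es_def intro: finite_subset[of _ "Pow (\<Union> (nb ` (T \<inter> Y)))"])
  have cEs: "card (Es T) \<le> ?c2" if T: "T \<in> Ts'" for T
  proof -
    \<comment> \<open>E is chosen among at most g/(tau d) points, so x = 1/d keeps the second factor
      at exp(g/(tau d^2)).\<close>
    have "real (card (Es T)) \<le> (1 / d) powr (- (tau * g / d)) * exp ((1 / d) * card (\<Union> (nb ` (T \<inter> Y))))"
      unfolding Es_def using d by (intro card_small_subsets_le finE) auto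
    also have "(1 / d) powr (- (tau * g / d)) = d powr (tau * g / d)"
      using d by (simp add: powr_minus powr_divide field_simps)
    also have "(1 / d) * card (\<Union> (nb ` (T \<inter> Y))) \<le> g / (tau * d ^ 2)"
    proof -
      have "card (\<Union> (nb ` (T \<inter> Y))) \<le> (\<Sum>y\<in>T \<inter> Y. card (nb y))" using finY by (intro card_UN_le) auto
      also have "\<dots> \<le> card (T \<inter> Y) * d"
        using sum_bounded_above[of "T \<inter> Y" "\<lambda>y. card (nb y)" d] card_nb by (auto intro: less_imp_le)
      finally have "real (card (\<Union> (nb ` (T \<inter> Y)))) \<le> card (T \<inter> Y) * real d" by (metis of_nat_le_iff of_nat_mult)
      then have "(1 / d) * card (\<Union> (nb ` (T \<inter> Y))) \<le> (1 / d) * (card (T \<inter> Y) * real d)"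
        by (intro mult_left_mono) auto
      also have "\<dots> = card (T \<inter> Y)" using d by simp
      finally show ?thesis using T by (simp add: Ts'_def)
    qed
    finally show ?thesis by (simp add: mult_left_mono)
  qed
  have finTs': "finite Ts'" using finTs by (simp add: Ts'_def)
  have "real (card (Sigma Ts' Es)) = (\<Sum>T\<in>Ts'. real (card (Es T)))" using finTs' finEs by simp
  also have "\<dots> \<le> card Ts' * ?c2" using cEs by (intro sum_bounded_above)
  also have "\<dots> \<le> ?c1 * ?c2"
  proof (intro mult_right_mono)
    have "card Ts' \<le> card Ts" using finTs by (intro card_mono) (auto simp: Ts'_def)
    then show "card Ts' \<le> ?c1" using cTs by linarith
  qed auto
  finally have cSig: "card (Sigma Ts' Es) \<le> ?c1 * ?c2" .
  let ?V = "\<lambda>c G. core (fst c) (snd c) \<subseteq> sh G \<and> G \<subseteq> rich_set (core (fst c) (snd c))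
    \<and> (1 - 5 * tau) * g \<le> card (core (fst c) (snd c))"
  have "sum (\<lambda>G. wt G * 2 powr (- real g)) ?A \<le> card (Sigma Ts' Es) * ?b"
  proof (rule sum_le_certificate_count[where V = ?V])
    show "finite ?A" using finite_fam by auto
    show "finite (Sigma Ts' Es)" using finTs' finEs by auto
    show "wt G * 2 powr (- real g) \<ge> 0" for G using wt_nonneg by simp
    fix G assume G: "G \<in> ?A"
    obtain T E where "T \<subseteq> X \<union> Y \<and> conn linked x T \<and> card T \<le> 1 + g / (tau * d ^ 2) + 20 * tau * g / d
      \<and> card (T \<inter> Y) \<le> g / (tau * d ^ 2) \<and> E \<subseteq> \<Union> (nb ` (T \<inter> Y)) \<and> card E \<le> tau * g / d
      \<and> core T E \<subseteq> sh G \<and> G \<subseteq> rich_set (core T E) \<and> (1 - 5 * tau) * g \<le> card (core T E)"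
      using tight_certificate[of G x g tau] G tau d by blast
    then show "\<exists>c\<in>Sigma Ts' Es. ?V c G"
      using finX finY finite_subset[of T "X \<union> Y"]
      by (intro bexI[of _ "(T, E)"]) (auto simp: Ts'_def Ts_def Es_def m_def)
  next
    fix c
    define F where "F = core (fst c) (snd c)"
    define S where "S = rich_set F"
    let ?Ac = "{G \<in> ?A. ?V c G}"
    show "(\<Sum>G\<in>?Ac. wt G * 2 powr (- real g)) \<le> ?b"
    proof (cases "?Ac = {}")
      case False
      then obtain G0 where G0: "G0 \<in> fam x g" "(1 - tau ^ 4) * g \<le> card (clos G0)" "F \<subseteq> sh G0"
        "(1 - 5 * tau) * g \<le> card F" by (auto simp: F_def)
      have G0X: "G0 \<subseteq> X" "card (sh G0) = g" using G0(1) by (auto simp: fam_def)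
      have FY: "F \<subseteq> Y" using G0(3) sh_subset[OF G0X(1)] by auto
      have SX: "S \<subseteq> X" by (auto simp: S_def rich_set_def)
      have finS: "finite S" using SX finX by (rule finite_subset)
      have "card F \<le> g" using G0(3) G0X finite_sh card_mono by metis
      then have cS: "card S \<le> 2 * real g" using card_rich_set_le[OF FY d(2)] by (simp add: S_def)
      have "(\<Sum>G\<in>?Ac. wt G * 2 powr (- real g)) = (\<Sum>G\<in>?Ac. wt G * 2 powr (- real (card (sh G))))"
        by (intro sum.cong refl) (auto simp: fam_def)
      also have "\<dots> \<le> (\<Sum>G\<in>{G \<in> Pow S. F \<subseteq> sh G}. wt G * 2 powr (- real (card (sh G))))"
        using finS wt_nonneg by (intro sum_mono2) (auto simp: S_def F_def)
      also have "\<dots> \<le> 2 powr (card S / real d ^ 2 - card F / d) *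
          exp ((\<Sum>y\<in>sh S - F. 2 powr (real (card (nb y \<inter> S)) - d)) / d)"
        using SX FY d(2) by (intro sum_wt_shadow_le) (auto simp: S_def rich_set_def)
      also have "\<dots> \<le> ?b"
      proof (intro mult_mono powr_mono)
        have "card S / real d ^ 2 \<le> 2 * real g / real d ^ 2" using cS by (simp add: divide_right_mono)
        moreover have "(1 - 5 * tau) * g / d \<le> card F / d" using G0(4) by (intro divide_right_mono) auto
        ultimately show "card S / real d ^ 2 - card F / d \<le> 2 * real g / real d ^ 2 - (1 - 5 * tau) * g / d" by linarith
        show "exp ((\<Sum>y\<in>sh S - F. 2 powr (real (card (nb y \<inter> S)) - d)) / d)
            \<le> exp (g * (9 * tau + 2 * d * 2 powr (- (d / 2))) / d)"
          using tight_boundary_sum_le[OF G0(1,2) tau d(2) G0(3,4) S_def] by (simp add: divide_right_mono)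
      qed auto
      finally show ?thesis .
    next
      case True
      show ?thesis unfolding True by simp
    qed
  qed
  also have "\<dots> \<le> ?c1 * ?c2 * ?b" using cSig by (intro mult_right_mono) auto
  finally show ?thesis .
qed

end

section \<open>The polymer sum\<close>

text \<open>The tightness parameter tau. The closure counts as small below (1 - tau^4) g, with tau^4
  = d^(-1/4); the other parameters are kap = d^(-5/16) and h = sqrt d. Thus log d / h is of smaller
  order than kap, kap log d of smaller order than tau^4, and tau log d still tends to 0.\<close>

definition th :: "nat \<Rightarrow> real" where "th d = real d powr (- 1 / 16)"

text \<open>The last three conditions say that the cost of the certificates is outweighed by the gain: by
  Finner's inequality for tight sets, and by the two cases of \<open>expanding_sum_le\<close> for expanding ones.\<close>

definition large :: "nat \<Rightarrow> bool" where
  "large d \<longleftrightarrow> d \<ge> 4 \<and> real d / 2 \<le> (1 - th d ^ 2) * (real d - 1)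
  \<and> 16 * ln (real d + 1) * (1 / (th d * d) + 20 * th d) + th d * ln d + 1 / (th d * d)
      + ln 2 * (2 / d - (1 - 5 * th d)) + (9 * th d + 2 * d * 2 powr (- (real d / 2))) \<le> - ln 2 / 2
  \<and> 16 * ln (real d + 1) / sqrt d
      + ln 2 * ((1 - real d powr (- 5 / 16)) * (1 + 2 / sqrt d) * (1 + 1 / real d ^ 2) - 1) \<le> - ln 2 / (2 * d)
  \<and> 16 * ln (real d + 1) / sqrt d + 2 * real d powr (- 5 / 16) * ln d + 2 / d
      + ln 2 * ((1 - th d ^ 4) * (1 + 1 / real d ^ 2) - 1) \<le> - ln 2 / (2 * d)"

lemma eventually_large: "eventually large sequentially"
proof -
  have l2: "ln (2 :: real) \<ge> 2 / 3" by (rule ln2_ge_two_thirds)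
  have "eventually (\<lambda>d::nat. d \<ge> 4) sequentially" by (rule eventually_ge_at_top)
  moreover have "eventually (\<lambda>d::nat. real d / 2 \<le> (1 - th d ^ 2) * (real d - 1)) sequentially"
    unfolding th_def by real_asymp
  moreover have "eventually (\<lambda>d::nat. 16 * ln (real d + 1) * (1 / (th d * d) + 20 * th d) + th d * ln d
      + 1 / (th d * d) + ln 2 * (2 / d - (1 - 5 * th d)) + (9 * th d + 2 * d * 2 powr (- (real d / 2)))
      \<le> - ln 2 / 2) sequentially"
  proof -
    \<comment> \<open>All costs vanish in the limit; what stays is -ln 2 from Finner's inequality,
      of which half is kept.\<close>
    have lims: "(\<lambda>d. ln (real d + 1) * (1 / (th d * d))) \<longlonglongrightarrow> 0" "(\<lambda>d. ln (real d + 1) * th d) \<longlonglongrightarrow> 0"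
      "(\<lambda>d. th d * ln d) \<longlonglongrightarrow> 0" "(\<lambda>d. 1 / (th d * d)) \<longlonglongrightarrow> 0" "(\<lambda>d. 2 / real d) \<longlonglongrightarrow> 0"
      "th \<longlonglongrightarrow> 0" "(\<lambda>d. real d * 2 powr (- (real d / 2))) \<longlonglongrightarrow> 0"
      unfolding th_def by real_asymp+
    have "(\<lambda>d. 16 * (ln (real d + 1) * (1 / (th d * d))) + 320 * (ln (real d + 1) * th d) + th d * ln d
        + 1 / (th d * d) + ln 2 * (2 / d - (1 - 5 * th d)) + (9 * th d + 2 * (d * 2 powr (- (real d / 2)))))
      \<longlonglongrightarrow> 16 * 0 + 320 * 0 + 0 + 0 + ln 2 * (0 - (1 - 5 * 0)) + (9 * 0 + 2 * 0)"
      by (intro tendsto_intros lims)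
    then have "eventually (\<lambda>d. 16 * (ln (real d + 1) * (1 / (th d * d))) + 320 * (ln (real d + 1) * th d) + th d * ln d
        + 1 / (th d * d) + ln 2 * (2 / d - (1 - 5 * th d)) + (9 * th d + 2 * (d * 2 powr (- (real d / 2)))) < - ln 2 / 2)
      sequentially"
      by (rule order_tendstoD) (use l2 in simp)
    then show ?thesis by eventually_elim (simp add: algebra_simps)
  qed
  moreover have "eventually (\<lambda>d::nat. 16 * ln (real d + 1) / sqrt d
      + ln 2 * ((1 - real d powr (- 5 / 16)) * (1 + 2 / sqrt d) * (1 + 1 / real d ^ 2) - 1)
      \<le> - ln 2 / (2 * d)) sequentially"
  proof -
    \<comment> \<open>The gain is of order d^(-5/16); the number of certificates, the error in |S|
      and the target 1/d are all of smaller order.\<close>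
    have "eventually (\<lambda>d::nat. 16 * ln (real d + 1) / sqrt d \<le> real d powr (- 5 / 16) / 10) sequentially"
      "eventually (\<lambda>d::nat. (1 + 2 / sqrt d) * (1 + 1 / real d ^ 2) - 1 \<le> real d powr (- 5 / 16) / 10) sequentially"
      "eventually (\<lambda>d::nat. 1 / real d \<le> real d powr (- 5 / 16) / 10) sequentially"
      by real_asymp+
    then show ?thesis
    proof eventually_elim
      case (elim d)
      define k u where "k = real d powr (- 5 / 16)" and "u = (1 + 2 / sqrt d) * (1 + 1 / real d ^ 2) - 1"
      have k: "k \<ge> 0" "u \<ge> 0" by (simp_all add: k_def u_def mult_ge1_I algebra_simps)
      have "(1 - k) * (1 + 2 / sqrt d) * (1 + 1 / real d ^ 2) - 1 = (1 - k) * (1 + u) - 1"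
        by (simp add: u_def)
      also have "\<dots> \<le> - (9 / 10) * k"
        using elim(2) mult_nonneg_nonneg[OF k] unfolding k_def[symmetric] u_def[symmetric] by (simp add: algebra_simps)
      finally have P: "ln 2 * ((1 - k) * (1 + 2 / sqrt d) * (1 + 1 / real d ^ 2) - 1) \<le> ln 2 * (- (9 / 10) * k)"
        (is "?P \<le> _") by (rule mult_left_mono) simp
      define a b where "a = ln 2 * k" and "b = ln 2 * (1 / real d)"
      have "?P \<le> - (9 / 10) * a" using P by (simp add: a_def mult_ac)
      moreover have "b \<le> ln 2 * (k / 10)"
        unfolding b_def using elim(3) unfolding k_def by (rule mult_left_mono) simp
      then have "b \<le> a / 10" by (simp add: a_def)
      moreover have "b \<ge> 0" "k / 10 \<le> 8 / 10 * a" "- ln 2 / real (2 * d) = - b / 2"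
        using mult_right_mono[OF l2 k(1)] k by (simp_all add: a_def b_def)
      moreover have "16 * ln (real d + 1) / sqrt d \<le> k / 10" (is "?Q \<le> _") using elim(1) by (simp add: k_def)
      ultimately have "?Q + ?P \<le> - ln 2 / real (2 * d)" by linarith
      then show ?case by (simp add: k_def)
    qed
  qed
  moreover have "eventually (\<lambda>d::nat. 16 * ln (real d + 1) / sqrt d + 2 * real d powr (- 5 / 16) * ln d + 2 / d
      + ln 2 * ((1 - th d ^ 4) * (1 + 1 / real d ^ 2) - 1) \<le> - ln 2 / (2 * d)) sequentially"
  proof -
    \<comment> \<open>Here the gain is of order tau^4 = d^(-1/4), against which the guessed shadow
      points cost kap log d.\<close>
    have "eventually (\<lambda>d::nat. 16 * ln (real d + 1) / sqrt d \<le> th d ^ 4 / 10) sequentially"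
      "eventually (\<lambda>d::nat. 2 * real d powr (- 5 / 16) * ln d \<le> th d ^ 4 / 10) sequentially"
      "eventually (\<lambda>d::nat. 2 / real d \<le> th d ^ 4 / 10) sequentially"
      "eventually (\<lambda>d::nat. 1 / real d ^ 2 \<le> th d ^ 4 / 10) sequentially"
      unfolding th_def by real_asymp+
    then show ?thesis
    proof eventually_elim
      case (elim d)
      define k u where "k = th d ^ 4" and "u = 1 / real d ^ 2"
      have k: "k \<ge> 0" "u \<ge> 0" by (simp_all add: k_def u_def)
      have "(1 - k) * (1 + u) - 1 \<le> - (9 / 10) * k"
        using elim(4) mult_nonneg_nonneg[OF k] unfolding k_def[symmetric] u_def[symmetric] by (simp add: algebra_simps)
      then have P: "ln 2 * ((1 - k) * (1 + u) - 1) \<le> ln 2 * (- (9 / 10) * k)"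
        (is "?P \<le> _") by (rule mult_left_mono) simp
      define a b where "a = ln 2 * k" and "b = ln 2 * (2 / real d)"
      have "?P \<le> - (9 / 10) * a" using P by (simp add: a_def mult_ac)
      moreover have "b \<le> ln 2 * (k / 10)"
        unfolding b_def using elim(3) unfolding k_def by (rule mult_left_mono) simp
      then have "b \<le> a / 10" by (simp add: a_def)
      moreover have "b \<ge> 0" "3 / 10 * k \<le> 5 / 10 * a" "- ln 2 / real (2 * d) = - b / 4"
        using mult_right_mono[OF l2 k(1)] k by (simp_all add: a_def b_def)
      moreover have "16 * ln (real d + 1) / sqrt d \<le> k / 10" (is "?Q \<le> _")
        "2 * real d powr (- 5 / 16) * ln d \<le> k / 10" (is "?R \<le> _")
        "2 / real d \<le> k / 10" (is "?S \<le> _") using elim(1,2,3) by (simp_all add: k_def)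
      ultimately have "?Q + ?R + ?S + ?P \<le> - ln 2 / real (2 * d)" by linarith
      then show ?case by (simp add: k_def u_def)
    qed
  qed
  ultimately show ?thesis unfolding large_def
    by eventually_elim (simp only: of_nat_mult of_nat_numeral simp_thms)
qed

lemma th_bounds: "d > 0 \<Longrightarrow> 0 < th d \<and> th d \<le> 1"
  using powr_mono[of "- 1 / 16" 0 "real d"] by (simp add: th_def)

context weighted_bigraph begin

abbreviation "loose x g \<equiv> {G \<in> fam x g. card (clos G) < (1 - th d ^ 4) * g}"
abbreviation "tight x g \<equiv> {G \<in> fam x g. (1 - th d ^ 4) * g \<le> card (clos G)}"

text \<open>The root in the certificate is responsible for the prefactor (d + 1)^16. The rate g/(2d)
  is a weakening, chosen to agree with the rate for tight sets.\<close>

lemma expanding_total_le: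
  assumes large: "large d"
  shows "(\<Sum>G\<in>loose x g. wt G * 2 powr (- real g))
    \<le> 2 * real (d + 1) ^ 16 * 2 powr (- (g / (2 * d)))"
proof -
  have d4: "d \<ge> 4" using large by (simp add: large_def)
  define h where "h = sqrt d"
  define k where "k = real d powr (- 5 / 16)"
  have h: "2 \<le> h" "h ^ 2 = d" "0 < h" "h \<le> d"
    using d4 real_le_lsqrt[of "real d" "real d"] by (auto simp: h_def real_le_rsqrt power2_eq_square)
  have k: "0 \<le> k" "k \<le> 1" using powr_mono[of "- 5 / 16" 0 "real d"] d4 by (auto simp: k_def)
  have t: "0 < th d" "th d \<le> 1" using th_bounds d4 by auto
  have e: "0 \<le> th d ^ 4" "th d ^ 4 \<le> 1" using t by (auto simp: power_le_one)
  define Cs where "Cs = {T \<in> {T. finite T \<and> conn linked x T \<and> card T \<le> 1 + g / h}. T \<subseteq> X}"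
  have fin: "finite {T. finite T \<and> conn linked x T \<and> card T \<le> 1 + g / h}"
    and card: "card {T. finite T \<and> conn linked x T \<and> card T \<le> 1 + g / h} \<le> (d + 1) powr (16 * (1 + g / h))"
    using h by (intro card_linked_sets_le; simp)+
  have finC: "finite Cs" unfolding Cs_def by (rule finite_subset[OF _ fin]) auto
  have "card Cs \<le> card {T. finite T \<and> conn linked x T \<and> card T \<le> 1 + g / h}"
    unfolding Cs_def using fin by (intro card_mono) auto
  then have cC: "card Cs \<le> (d + 1) powr (16 * (1 + g / h))" using card by linarith
  let ?b = "2 powr (g * ((1 - k) * (1 + 2 / h) * (1 + 1 / real d ^ 2)))
      + real d powr (2 * k * g) * exp (2 * g / d) * 2 powr (g * ((1 - th d ^ 4) * (1 + 1 / real d ^ 2)))"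
  let ?A = "loose x g"
  have "(\<Sum>G\<in>?A. wt G) \<le> card Cs * ?b"
  proof (rule sum_le_certificate_count[where V = "\<lambda>T G. T \<subseteq> G \<and> (\<forall>y\<in>G. card (N y - sh T) < h)"])
    show "finite ?A" using finite_fam by simp
    show "\<exists>T\<in>Cs. T \<subseteq> G \<and> (\<forall>y\<in>G. card (N y - sh T) < h)" if "G \<in> ?A" for G
      using expanding_certificate[of G x g h] that h finX finite_subset unfolding Cs_def by blast
    show "(\<Sum>G\<in>{G \<in> ?A. T \<subseteq> G \<and> (\<forall>y\<in>G. card (N y - sh T) < h)}. wt G) \<le> ?b" if "T \<in> Cs" for T
      using that expanding_sum_le[OF h(1,2) k e, of T x g] by (simp add: Cs_def)
  qed (use finC wt_nonneg in auto)
  also have "\<dots> \<le> (d + 1) powr (16 * (1 + g / h)) * ?b" using cC by (intro mult_right_mono) auto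
  finally have "(\<Sum>G\<in>?A. wt G) * 2 powr (- real g) \<le> (d + 1) powr (16 * (1 + g / h)) * ?b * 2 powr (- real g)"
    by (rule mult_right_mono) simp
  also have "\<dots> = real (d + 1) ^ 16 *
      (exp (g * (16 * ln (real d + 1) / h + ln 2 * ((1 - k) * (1 + 2 / h) * (1 + 1 / real d ^ 2) - 1)))
       + exp (g * (16 * ln (real d + 1) / h + 2 * k * ln d + 2 / d + ln 2 * ((1 - th d ^ 4) * (1 + 1 / real d ^ 2) - 1))))"
  proof -
    have "(d + 1) powr (16 * (1 + g / h)) = real (d + 1) ^ 16 * exp (g * (16 * ln (real d + 1) / h))"
    proof -
      have "(d + 1) powr (16 * (1 + g / h)) = (d + 1) powr (16 + 16 * g / h)"
        by (simp add: distrib_left)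
      also have "\<dots> = (d + 1) powr 16 * (d + 1) powr (16 * g / h)" by (rule powr_add)
      also have "(d + 1) powr (16 * g / h) = exp (g * (16 * ln (real d + 1) / h))"
        by (simp add: powr_def mult_ac add.commute)
      finally show ?thesis using powr_realpow[of "real (d + 1)" 16] by simp
    qed
    moreover have "2 powr a = exp (a * ln 2)" for a :: real by (simp add: powr_def)
    moreover have "real d powr (2 * k * g) = exp (g * (2 * k * ln d))" using d4 by (simp add: powr_def mult_ac)
    ultimately show ?thesis
      by (simp add: distrib_left distrib_right exp_add[symmetric] mult.assoc) (simp add: algebra_simps)
  qed
  also have "\<dots> \<le> real (d + 1) ^ 16 * (exp (g * (- ln 2 / (2 * d))) + exp (g * (- ln 2 / (2 * d))))"
  proof (intro mult_left_mono[of _ _ "real (d + 1) ^ 16"] add_mono iffD2[OF exp_le_cancel_iff]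
      mult_left_mono[of _ _ "real g"])
    show "16 * ln (real d + 1) / h + ln 2 * ((1 - k) * (1 + 2 / h) * (1 + 1 / real d ^ 2) - 1) \<le> - ln 2 / (2 * d)"
      "16 * ln (real d + 1) / h + 2 * k * ln d + 2 / d + ln 2 * ((1 - th d ^ 4) * (1 + 1 / real d ^ 2) - 1)
        \<le> - ln 2 / (2 * d)"
      using large unfolding large_def h_def k_def by simp_all
  qed simp_all
  also have "\<dots> = 2 * real (d + 1) ^ 16 * 2 powr (- (g / (2 * d)))"
    by (simp add: powr_def mult_ac)
  finally show ?thesis by (simp add: sum_distrib_right)
qed

lemma tight_total_le:
  assumes large: "large d"
  shows "(\<Sum>G\<in>tight x g. wt G * 2 powr (- real g))
    \<le> real (d + 1) ^ 16 * 2 powr (- (g / (2 * d)))"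
proof -
  have d4: "d \<ge> 4" "d > 0" and dd: "real d / 2 \<le> (1 - th d ^ 2) * (real d - 1)"
    using large by (simp_all add: large_def)
  have t: "0 < th d" "th d \<le> 1" using th_bounds d4 by auto
  define q where "q = real g / d"
  have "(\<Sum>G\<in>tight x g. wt G * 2 powr (- real g))
    \<le> (d + 1) powr (16 * (1 + g / (th d * d ^ 2) + 20 * th d * g / d)) *
      (d powr (th d * g / d) * exp (g / (th d * d ^ 2))) *
      (2 powr (2 * real g / real d ^ 2 - (1 - 5 * th d) * g / d) * exp (g * (9 * th d + 2 * d * 2 powr (- (d / 2))) / d))"
    by (rule tight_sum_le[OF t dd d4(2)])
  also have "\<dots> = real (d + 1) ^ 16 * exp (q * (16 * ln (real d + 1) * (1 / (th d * d) + 20 * th d) + th d * ln d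
      + 1 / (th d * d) + ln 2 * (2 / d - (1 - 5 * th d)) + (9 * th d + 2 * d * 2 powr (- (real d / 2)))))"
  proof -
    have 1: "g / (th d * d ^ 2) = q * (1 / (th d * d))" by (simp add: q_def power2_eq_square)
    have 2: "20 * th d * g / d = q * (20 * th d)" "th d * g / d = q * th d"
      "2 * real g / real d ^ 2 - (1 - 5 * th d) * g / d = q * (2 / d - (1 - 5 * th d))"
      by (simp_all add: q_def power2_eq_square diff_divide_distrib algebra_simps)
    have 7: "g * (9 * th d + 2 * d * 2 powr (- (d / 2))) / d = q * (9 * th d + 2 * d * 2 powr (- (real d / 2)))"
      by (simp add: q_def)
    have 3: "(d + 1) powr (16 * (1 + q * (1 / (th d * d)) + q * (20 * th d))) =
        real (d + 1) ^ 16 * exp (q * (16 * ln (real d + 1) * (1 / (th d * d) + 20 * th d)))"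
    proof -
      have "(d + 1) powr (16 * (1 + q * (1 / (th d * d)) + q * (20 * th d))) =
          (d + 1) powr (16 + q * (16 * (1 / (th d * d) + 20 * th d)))"
        by (simp add: algebra_simps)
      also have "\<dots> = (d + 1) powr 16 * (d + 1) powr (q * (16 * (1 / (th d * d) + 20 * th d)))"
        by (rule powr_add)
      also have "(d + 1) powr (q * (16 * (1 / (th d * d) + 20 * th d))) =
          exp (q * (16 * ln (real d + 1) * (1 / (th d * d) + 20 * th d)))"
        by (simp add: powr_def mult_ac add.commute)
      finally show ?thesis using powr_realpow[of "real (d + 1)" 16] by simp
    qed
    have 4: "d powr (q * th d) = exp (q * (th d * ln d))" using d4 by (simp add: powr_def mult_ac)
    have 5: "2 powr a = exp (a * ln 2)" for a :: real by (simp add: powr_def)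
    have 6: "2 powr (q * (2 / d - (1 - 5 * th d))) = exp (q * (ln 2 * (2 / d - (1 - 5 * th d))))"
      unfolding 5 by (simp add: mult_ac)
    show ?thesis unfolding 1 2 7 3 4 6 by (simp only: distrib_left exp_add mult.assoc)
  qed
  also have "\<dots> \<le> real (d + 1) ^ 16 * exp (q * (- ln 2 / 2))"
  proof (intro mult_left_mono iffD2[OF exp_le_cancel_iff])
    show "16 * ln (real d + 1) * (1 / (th d * d) + 20 * th d) + th d * ln d
      + 1 / (th d * d) + ln 2 * (2 / d - (1 - 5 * th d)) + (9 * th d + 2 * d * 2 powr (- (real d / 2))) \<le> - ln 2 / 2"
      using large unfolding large_def by simp
  qed (simp_all add: q_def)
  also have "\<dots> = real (d + 1) ^ 16 * 2 powr (- (g / (2 * d)))"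
    by (simp add: powr_def q_def mult_ac)
  finally show ?thesis .
qed

theorem polymer_sum_le:
  assumes "large d"
  shows "(\<Sum>G\<in>fam x g. wt G * 2 powr (- real g)) \<le> 3 * real (d + 1) ^ 16 * 2 powr (- (g / (2 * d)))"
proof -
  have "fam x g = loose x g \<union> tight x g"
    by auto
  then have "(\<Sum>G\<in>fam x g. wt G * 2 powr (- real g)) =
      (\<Sum>G\<in>loose x g. wt G * 2 powr (- real g)) +
      (\<Sum>G\<in>tight x g. wt G * 2 powr (- real g))"
    using finite_fam by (subst sum.union_disjoint[symmetric]) auto
  then show ?thesis using expanding_total_le[OF assms, where x = x and g = g] tight_total_le[OF assms, where x = x and g = g] by simp
qed

end

section \<open>Edge isoperimetry and downsets\<close>

text \<open>For a <= b, one a comes from log2(1 + t) >= t at t = a/b in [0, 1], by concavity, and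
  the other from log2(1 + b/a) >= 1.\<close>

lemma x_log_superadditive:
  fixes a b :: real
  assumes "a \<ge> 0" "b \<ge> 0"
  shows "a * log 2 a + b * log 2 b + 2 * min a b \<le> (a + b) * log 2 (a + b)"
proof -
  have *: "a * log 2 a + b * log 2 b + 2 * a \<le> (a + b) * log 2 (a + b)" if ab: "0 < a" "a \<le> b" for a b :: real
  proof -
    have b: "b > 0" using ab by simp
    have "ln 2 * (a / b) \<le> ln (1 + a / b)"
    proof -
      have "(1 - a / b) * ln 1 + (a / b) * ln 2 \<le> ln ((1 - a / b) *\<^sub>R 1 + (a / b) *\<^sub>R (2 :: real))"
        using ab b by (intro concave_onD[OF ln_concave]) (auto simp: convex_real_interval)
      also have "(1 - a / b) *\<^sub>R 1 + (a / b) *\<^sub>R (2 :: real) = 1 + a / b" by simp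
      finally show ?thesis by (simp add: mult.commute)
    qed
    then have "a / b \<le> log 2 (1 + a / b)" by (simp add: log_def field_simps)
    then have 1: "a \<le> b * log 2 (1 + a / b)" using b by (simp add: field_simps)
    have "1 \<le> log 2 (1 + b / a)" using ab by (subst le_log_iff) (auto simp: field_simps)
    then have 2: "a \<le> a * log 2 (1 + b / a)" using ab by simp
    have split: "log 2 (u + v) = log 2 u + log 2 (1 + v / u)" if "u > 0" "v > 0" for u v :: real
    proof -
      have "u + v = u * (1 + v / u)" using that by (simp add: distrib_left)
      moreover have "1 + v / u > 0" using that by (simp add: add_pos_pos)
      ultimately show ?thesis using that by (metis log_mult_pos)
    qed
    have "log 2 (a + b) = log 2 a + log 2 (1 + b / a)" "log 2 (a + b) = log 2 b + log 2 (1 + a / b)"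
      using split[of a b] split[of b a] ab b by (simp_all add: add.commute)
    then have "a * log 2 (a + b) = a * log 2 a + a * log 2 (1 + b / a)"
      "b * log 2 (a + b) = b * log 2 b + b * log 2 (1 + a / b)"
      by (metis distrib_left)+
    then show ?thesis using 1 2 unfolding distrib_right by linarith
  qed
  consider "a = 0" | "b = 0" | "0 < a" "a \<le> b" | "0 < b" "b \<le> a" using assms by linarith
  then show ?thesis using *[of a b] *[of b a] assms by cases (auto simp: add_ac min_def)
qed

text \<open>Edges of the hypercube inside S, each counted at its upper end.\<close>

definition edges :: "'a set set \<Rightarrow> nat" where
  "edges S = (\<Sum>A\<in>S. card {i \<in> A. A - {i} \<in> S})"

text \<open>Splitting S along one direction u, the edges in direction u form a matching between the
  halves, hence number at most the smaller half; this is the term 2 min(a, b) of the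
  superadditivity.\<close>

theorem edge_isoperimetry:
  assumes "finite U" "S \<subseteq> Pow U"
  shows "2 * edges S \<le> card S * log 2 (card S)"
  using assms
proof (induction U arbitrary: S rule: finite_induct)
  case empty
  then have "S = {} \<or> S = {{}}" by auto
  then show ?case by (auto simp: edges_def)
next
  case (insert u U)
  define S0 where "S0 = {A \<in> S. u \<notin> A}"
  define S1 where "S1 = {B \<in> Pow U. insert u B \<in> S}"
  have fin: "finite S0" "finite S1" using insert finite_subset[of _ "Pow (insert u U)"] by (auto simp: S0_def S1_def)
  have S: "S = S0 \<union> insert u ` S1"
  proof (intro equalityI subsetI)
    fix A assume A: "A \<in> S"
    show "A \<in> S0 \<union> insert u ` S1"
    proof (cases "u \<in> A")
      case True
      then have "insert u (A - {u}) = A" "A - {u} \<subseteq> U" using insert.prems A by auto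
      then show ?thesis using A unfolding S1_def by (metis (mono_tags, lifting) PowI UnI2 image_eqI mem_Collect_eq)
    qed (use A in \<open>simp add: S0_def\<close>)
  qed (auto simp: S0_def S1_def)
  have disj: "S0 \<inter> insert u ` S1 = {}" by (auto simp: S0_def)
  have S0U: "S0 \<subseteq> Pow U" and S1U: "S1 \<subseteq> Pow U" using insert.prems by (auto simp: S0_def S1_def)
  have "insert u B - {u} = B" if "B \<in> S1" for B using that S1U insert.hyps by auto
  then have inj: "inj_on (insert u) S1" by (metis inj_on_def)
  have cS: "card S = card S0 + card S1"
    unfolding S using fin disj inj by (subst card_Un_disjoint) (auto simp: card_image)
  have "edges S = (\<Sum>A\<in>S0. card {i \<in> A. A - {i} \<in> S}) + (\<Sum>B\<in>S1. card {i \<in> insert u B. insert u B - {i} \<in> S})"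
    unfolding edges_def using fin disj inj by (subst (1) S, subst sum.union_disjoint) (auto simp: sum.reindex)
  also have "(\<Sum>A\<in>S0. card {i \<in> A. A - {i} \<in> S}) = edges S0"
    unfolding edges_def by (intro sum.cong refl arg_cong[where f = card]) (auto simp: S0_def)
  also have "(\<Sum>B\<in>S1. card {i \<in> insert u B. insert u B - {i} \<in> S})
      = (\<Sum>B\<in>S1. card {i \<in> B. B - {i} \<in> S1} + (if B \<in> S0 then 1 else 0))"
  proof (intro sum.cong refl)
    fix B assume B: "B \<in> S1"
    then have BU: "B \<subseteq> U" "u \<notin> B" using S1U insert.hyps by auto
    have "insert u B - {i} = insert u (B - {i})" if "i \<in> B" for i using that BU by auto
    then have "{i \<in> insert u B. insert u B - {i} \<in> S} = {i \<in> B. B - {i} \<in> S1} \<union> (if B \<in> S0 then {u} else {})"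
      using BU by (auto simp: S1_def S0_def)
    moreover have "finite B" using BU insert.hyps finite_subset by auto
    ultimately show "card {i \<in> insert u B. insert u B - {i} \<in> S} =
        card {i \<in> B. B - {i} \<in> S1} + (if B \<in> S0 then 1 else 0)"
      using BU by simp
  qed
  also have "\<dots> = edges S1 + card (S1 \<inter> S0)"
    using fin by (simp add: sum.distrib edges_def sum.If_cases)
  finally have "edges S = edges S0 + edges S1 + card (S1 \<inter> S0)" by simp
  moreover have "card (S1 \<inter> S0) \<le> min (card S0) (card S1)" using fin by (auto intro: card_mono)
  ultimately have "real (edges S) \<le> edges S0 + edges S1 + min (real (card S0)) (card S1)" by simp
  then have "2 * real (edges S) \<le> card S0 * log 2 (card S0) + card S1 * log 2 (card S1) + 2 * min (real (card S0)) (card S1)"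
    using insert.IH[OF S0U] insert.IH[OF S1U] by simp
  also have "\<dots> \<le> card S * log 2 (card S)"
    unfolding cS using x_log_superadditive[of "card S0" "card S1"] by simp
  finally show ?case by simp
qed

section \<open>Downsets, antichains and the deletion argument\<close>

definition downsets :: "'a set set \<Rightarrow> 'a set set set" where
  "downsets P = {D. D \<subseteq> P \<and> (\<forall>z\<in>D. \<forall>z'\<in>P. z' \<subseteq> z \<longrightarrow> z' \<in> D)}"

lemma finite_downsets: "finite P \<Longrightarrow> finite (downsets P)"
  by (rule finite_subset[of _ "Pow P"]) (auto simp: downsets_def)

text \<open>Antichains are the sets of maximal elements of downsets. Downsets are the better object
  here since deleting part of one frees the elements just below.\<close>

lemma num_antichains_eq_card_downsets:
  assumes fin: "finite P"
  shows "num_antichains P = card (downsets P)"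
proof -
  define gen where "gen F = {x \<in> P. \<exists>f\<in>F. x \<subseteq> f}" for F
  define tops where "tops D = {x \<in> D. \<forall>y\<in>D. x \<subseteq> y \<longrightarrow> x = y}" for D :: "'a set set"
  have "bij_betw gen {F. F \<subseteq> P \<and> antichain F} (downsets P)"
  proof (rule bij_betw_byWitness[where f' = tops])
    show "\<forall>F\<in>{F. F \<subseteq> P \<and> antichain F}. tops (gen F) = F"
    proof
      fix F assume "F \<in> {F. F \<subseteq> P \<and> antichain F}"
      then have F: "F \<subseteq> P" "\<And>A B. A \<in> F \<Longrightarrow> B \<in> F \<Longrightarrow> A \<subseteq> B \<Longrightarrow> A = B"
        by (auto simp: antichain_def pairwise_def)
      show "tops (gen F) = F"
      proof (intro equalityI subsetI)
        fix x assume x: "x \<in> tops (gen F)"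
        then obtain f where f: "f \<in> F" "x \<subseteq> f" by (auto simp: tops_def gen_def)
        then have "f \<in> gen F" using F by (auto simp: gen_def)
        then have "x = f" using x f by (auto simp: tops_def)
        then show "x \<in> F" using f by simp
      next
        fix x assume x: "x \<in> F"
        have "x = y" if y: "y \<in> gen F" "x \<subseteq> y" for y
        proof -
          obtain f where f: "f \<in> F" "y \<subseteq> f" using y by (auto simp: gen_def)
          then have "x = f" using F(2)[OF x f(1)] y(2) by auto
          then show ?thesis using f y by auto
        qed
        moreover have "x \<in> gen F" using x F by (auto simp: gen_def)
        ultimately show "x \<in> tops (gen F)" by (auto simp: tops_def)
      qed
    qed
    show "\<forall>D\<in>downsets P. gen (tops D) = D"
    proof
      fix D assume D: "D \<in> downsets P"
      then have finD: "finite D" using fin finite_subset by (auto simp: downsets_def)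
      show "gen (tops D) = D"
      proof (intro equalityI subsetI)
        fix x assume "x \<in> gen (tops D)"
        then show "x \<in> D" using D by (auto simp: gen_def tops_def downsets_def)
      next
        fix x assume x: "x \<in> D"
        then obtain m where m: "m \<in> D" "x \<subseteq> m" "\<And>y. y \<in> D \<Longrightarrow> m \<subseteq> y \<Longrightarrow> m = y"
          using finite_has_maximal2[OF finD x] by auto
        then have "m \<in> tops D" by (auto simp: tops_def)
        then show "x \<in> gen (tops D)" using m x D by (auto simp: gen_def downsets_def)
      qed
    qed
    show "gen ` {F. F \<subseteq> P \<and> antichain F} \<subseteq> downsets P"
      by (auto simp: gen_def downsets_def)
    show "tops ` downsets P \<subseteq> {F. F \<subseteq> P \<and> antichain F}"
      by (auto simp: tops_def downsets_def antichain_def pairwise_def)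
  qed
  then show ?thesis unfolding num_antichains_def by (rule bij_betw_same_card)
qed

text \<open>A Peierls map: K is deleted and every point of V then becomes optional. As K and V are
  fixed and known to lie in D, both D and the choice S can be read off from the result.\<close>

lemma card_downsets_removal:
  assumes "finite P" "Ds \<subseteq> downsets P" "finite V" "K \<inter> V = {}"
    and sub: "\<And>D. D \<in> Ds \<Longrightarrow> K \<union> V \<subseteq> D"
    and rem: "\<And>D S. D \<in> Ds \<Longrightarrow> S \<subseteq> V \<Longrightarrow> D - K - S \<in> downsets P"
  shows "card Ds * 2 ^ card V \<le> card (downsets P)"
proof -
  have "inj_on (\<lambda>(D, S). D - K - S) (Ds \<times> Pow V)"
  proof (rule inj_onI, clarify)
    fix D S D' S' assume *: "D \<in> Ds" "D' \<in> Ds" "S \<subseteq> V" "S' \<subseteq> V" "D - K - S = D' - K - S'"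
    have "S = V - (D - K - S)" "S' = V - (D' - K - S')" using * sub assms(4) by blast+
    moreover have "D = (D - K - S) \<union> K \<union> V" "D' = (D' - K - S') \<union> K \<union> V" using * sub by blast+
    ultimately show "D = D' \<and> S = S'" using *(5) by auto
  qed
  moreover have "(\<lambda>(D, S). D - K - S) ` (Ds \<times> Pow V) \<subseteq> downsets P" using rem by auto
  ultimately have "card (Ds \<times> Pow V) \<le> card (downsets P)"
    using finite_downsets[OF assms(1)] card_inj_on_le by blast
  then show ?thesis using assms(3) by (simp add: card_cartesian_product card_Pow)
qed

section \<open>Layers of the Boolean lattice\<close>

definition component :: "('a \<times> 'a) set \<Rightarrow> 'a set \<Rightarrow> 'a \<Rightarrow> 'a set" where
  "component r B x = {y. (x, y) \<in> (r \<inter> B \<times> B)\<^sup>*}"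

lemma self_in_component: "x \<in> component r B x" by (simp add: component_def)

lemma component_subset:
  assumes "x \<in> B" shows "component r B x \<subseteq> B"
proof
  fix y assume "y \<in> component r B x"
  then have "(x, y) \<in> (r \<inter> B \<times> B)\<^sup>*" by (simp add: component_def)
  then show "y \<in> B" using assms by (induction rule: rtrancl_induct) auto
qed

lemma component_closed:
  assumes "x \<in> B" "y \<in> component r B x" "z \<in> B" "(y, z) \<in> r" shows "z \<in> component r B x"
proof -
  have "(y, z) \<in> r \<inter> B \<times> B" using assms component_subset[OF assms(1)] by auto
  with assms(2) show ?thesis unfolding component_def mem_Collect_eq by (rule rtrancl_into_rtrancl)
qed

lemma component_mono:
  assumes "A \<subseteq> B" shows "component r A x \<subseteq> component r B x"
proof -
  have "(r \<inter> A \<times> A)\<^sup>* \<subseteq> (r \<inter> B \<times> B)\<^sup>*" using assms by (intro rtrancl_mono) auto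
  then show ?thesis unfolding component_def by blast
qed

lemma conn_component:
  assumes "x \<in> B" shows "conn r x (component r B x)"
proof -
  have "(x, y) \<in> (r \<inter> component r B x \<times> component r B x)\<^sup>*" if "y \<in> component r B x" for y
    using that[unfolded component_def mem_Collect_eq]
  proof (induction rule: rtrancl_induct)
    case (step y z)
    have "(x, z) \<in> (r \<inter> B \<times> B)\<^sup>*" using step.hyps by (rule rtrancl_into_rtrancl)
    then have "y \<in> component r B x" "z \<in> component r B x" using step.hyps(1) by (simp_all add: component_def)
    then have "(y, z) \<in> r \<inter> component r B x \<times> component r B x" using step.hyps(2) by blast
    with step.IH show ?case by (rule rtrancl_into_rtrancl)
  qed simp
  then show ?thesis unfolding conn_def using self_in_component by (intro conjI ballI)
qed

lemma component_eq:
  assumes "sym r" "y \<in> component r B x" shows "component r B y = component r B x"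
proof -
  have "sym ((r \<inter> B \<times> B)\<^sup>*)" using assms(1) by (intro sym_rtrancl) (auto simp: sym_def)
  moreover have xy: "(x, y) \<in> (r \<inter> B \<times> B)\<^sup>*" using assms(2) by (simp add: component_def)
  ultimately have yx: "(y, x) \<in> (r \<inter> B \<times> B)\<^sup>*" by (rule symD)
  show ?thesis unfolding component_def
    by (intro Collect_cong iffI) (erule rtrancl_trans[OF xy], erule rtrancl_trans[OF yx])
qed

lemma conn_mono:
  assumes "r \<subseteq> s" "conn r x G" shows "conn s x G"
proof -
  have "(r \<inter> G \<times> G)\<^sup>* \<subseteq> (s \<inter> G \<times> G)\<^sup>*" using assms(1) by (intro rtrancl_mono) auto
  then show ?thesis using assms(2) unfolding conn_def by blast
qed

context bigraph begin

lemma sym_lk: "sym lk" by (auto simp: sym_def lk_def)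

lemma disjoint_shadows:
  assumes "A \<subseteq> X" "x \<in> A" "y \<in> A" "component lk A x \<noteq> component lk A y"
  shows "sh (component lk A x) \<inter> sh (component lk A y) = {}"
proof (rule ccontr)
  assume "\<not> ?thesis"
  then obtain u v where uv: "u \<in> component lk A x" "v \<in> component lk A y" "N u \<inter> N v \<noteq> {}" by (auto simp: sh_def)
  then have "u \<in> A" "v \<in> A" using component_subset[OF assms(2)] component_subset[OF assms(3)] by blast+
  then have "(u, v) \<in> lk" using uv assms(1) by (auto simp: lk_def)
  then have "v \<in> component lk A x" using component_closed[OF assms(2) uv(1) \<open>v \<in> A\<close>] by simp
  then show False using component_eq[OF sym_lk, of v A x] component_eq[OF sym_lk uv(2)] assms(4) by simp
qed

lemma Union_comps: "\<Union> (component lk A ` A) = A"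
proof
  show "\<Union> (component lk A ` A) \<subseteq> A" by (rule UN_least) (rule component_subset)
  show "A \<subseteq> \<Union> (component lk A ` A)" using self_in_component by fast
qed

lemma card_sh_comps:
  assumes "A \<subseteq> X"
  shows "card (sh A) = (\<Sum>G\<in>component lk A ` A. card (sh G))"
proof -
  have finA: "finite A" using assms finX finite_subset by blast
  have sub: "G \<subseteq> X" if "G \<in> component lk A ` A" for G using that component_subset[of _ A lk] assms by blast
  have "sh A = (\<Union>G\<in>component lk A ` A. sh G)"
    by (subst (1) Union_comps[symmetric]) (auto simp: sh_def)
  also have "card \<dots> = (\<Sum>G\<in>component lk A ` A. card (sh G))"
  proof (rule card_UN_disjoint)
    show "\<forall>G\<in>component lk A ` A. \<forall>H\<in>component lk A ` A. G \<noteq> H \<longrightarrow> sh G \<inter> sh H = {}"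
      using disjoint_shadows[OF assms] by blast
  qed (use finA sub finite_sh in auto)
  finally show ?thesis .
qed

text \<open>The polymer expansion: a set is determined by its components, and its shadow is the disjoint
  union of theirs.\<close>

lemma sum_sets_le_exp_polymers:
  fixes c :: real
  assumes S: "\<And>A. A \<in> S \<Longrightarrow> A \<subseteq> X" "\<And>A. A \<in> S \<Longrightarrow> component lk A ` A \<subseteq> P" and "finite P"
  shows "(\<Sum>A\<in>S. 2 powr (c * card (sh A))) \<le> exp (\<Sum>G\<in>P. 2 powr (c * card (sh G)))"
proof -
  let ?w = "\<lambda>G. 2 powr (c * card (sh G))"
  let ?C = "\<lambda>A. component lk A ` A"
  have finA: "finite A" if "A \<in> S" for A using S(1)[OF that] finX finite_subset by blast
  have inj: "inj_on ?C S" by (rule inj_onI) (metis Union_comps)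
  have "(\<Sum>A\<in>S. ?w A) = (\<Sum>A\<in>S. \<Prod>G\<in>?C A. ?w G)"
  proof (rule sum.cong[OF refl])
    fix A assume A: "A \<in> S"
    have "c * card (sh A) = (\<Sum>G\<in>?C A. c * card (sh G))"
      unfolding card_sh_comps[OF S(1)[OF A]] by (simp add: sum_distrib_left)
    then show "?w A = (\<Prod>G\<in>?C A. ?w G)" using finA[OF A] by (simp only:) (subst powr_sum, auto)
  qed
  also have "\<dots> = (\<Sum>C\<in>?C ` S. \<Prod>G\<in>C. ?w G)" using inj by (simp add: sum.reindex)
  also have "\<dots> \<le> (\<Sum>C\<in>Pow P. \<Prod>G\<in>C. ?w G)"
    using S(2) assms(3) by (intro sum_mono2 prod_nonneg) auto
  also have "\<dots> = (\<Prod>G\<in>P. ?w G + 1)"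
    using prod_add[OF assms(3), of ?w "\<lambda>_. 1"] by simp
  also have "\<dots> \<le> (\<Prod>G\<in>P. exp (?w G))"
    by (intro prod_mono conjI) (auto simp: add_nonneg_nonneg add.commute)
  also have "\<dots> = exp (\<Sum>G\<in>P. ?w G)" using assms(3) by (simp add: exp_sum)
  finally show ?thesis .
qed

text \<open>Linked points are at distance at most 2, so the degree is at most (d + 1)^2 along walks
  of 2m steps.\<close>

lemma card_conn_lk_le:
  "card {G. G \<subseteq> X \<and> conn lk x G \<and> card G = m} \<le> (d + 1) ^ (4 * m)"
proof -
  have r: "sym (ad ^^ 2)" "refl (ad ^^ 2)" "finite ((ad ^^ 2) `` {u})" "card ((ad ^^ 2) `` {u}) \<le> (d + 1) ^ 2" for u
    using sym_relpow[OF sym_ad] refl_relpow[OF refl_ad] card_relpow_Image_le[of ad "d + 1", OF ad_Image] by blast+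
  have "{G. G \<subseteq> X \<and> conn lk x G \<and> card G = m} \<subseteq> {T. finite T \<and> conn (ad ^^ 2) x T \<and> card T \<le> m}"
    using finX finite_subset conn_mono[of lk "ad ^^ 2"] lk_ad2 by fastforce
  then have "card {G. G \<subseteq> X \<and> conn lk x G \<and> card G = m} \<le> card {T. finite T \<and> conn (ad ^^ 2) x T \<and> card T \<le> m}"
    by (intro card_mono card_conn_sets_le(1)[OF r])
  also have "\<dots> \<le> ((d + 1) ^ 2) ^ (2 * m)" by (rule card_conn_sets_le(2)[OF r])
  finally show ?thesis by (simp add: power_mult[symmetric])
qed

end

section \<open>Layers as bipartite graphs, and components with small shadow\<close>

definition layer :: "nat \<Rightarrow> nat \<Rightarrow> nat set set" where "layer n j = {A. A \<subseteq> {1..n} \<and> card A = j}"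

definition shade :: "nat set \<Rightarrow> nat set set" where "shade A = (\<lambda>i. A - {i}) ` A"

lemma finite_layer: "finite (layer n j)"
  by (rule finite_subset[of _ "Pow {1..n}"]) (auto simp: layer_def)

lemma card_layer_le: "card (layer n j) \<le> 2 ^ n"
proof -
  have "card (layer n j) \<le> card (Pow {1..n})" by (intro card_mono) (auto simp: layer_def)
  then show ?thesis by (simp add: card_Pow)
qed

lemma finite_in_layer: "A \<in> layer n j \<Longrightarrow> finite A"
  using finite_subset by (auto simp: layer_def)

lemma mem_shade_iff: "finite A \<Longrightarrow> B \<in> shade A \<longleftrightarrow> B \<subseteq> A \<and> card B + 1 = card A"
proof
  assume "finite A" "B \<in> shade A"
  then show "B \<subseteq> A \<and> card B + 1 = card A" using card_Suc_Diff1[of A] by (auto simp: shade_def)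
next
  assume A: "finite A" and B: "B \<subseteq> A \<and> card B + 1 = card A"
  then have "finite B" using finite_subset by blast
  then have "card (A - B) = 1" using B card_Diff_subset[of B A] by linarith
  then obtain i where "A - B = {i}" by (auto simp: card_1_singleton_iff)
  then have "B = A - {i}" "i \<in> A" using B by auto
  then show "B \<in> shade A" by (auto simp: shade_def)
qed

text \<open>The hypothesis says exactly that the upper degree n - j + 1 is below the lower degree j.
  Two sets of equal size can share only their intersection as a lower neighbour.\<close>

lemma bigraph_layers:
  assumes j: "n + 2 \<le> 2 * j"
  shows "bigraph (layer n j) (layer n (j - 1)) shade j"
proof
  show "finite (layer n j)" "finite (layer n (j - 1))" by (rule finite_layer)+
  show "layer n j \<inter> layer n (j - 1) = {}" using j by (auto simp: layer_def)
  show "shade x \<subseteq> layer n (j - 1)" if "x \<in> layer n j" for x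
  proof
    fix y assume "y \<in> shade x"
    then have "y \<subseteq> x" "card y + 1 = card x" using mem_shade_iff[OF finite_in_layer[OF that]] by auto
    then show "y \<in> layer n (j - 1)" using that unfolding layer_def by auto
  qed
  show "card (shade x) = j" if "x \<in> layer n j" for x
  proof -
    have "inj_on (\<lambda>i. x - {i}) x" by (auto simp: inj_on_def)
    then show ?thesis using that by (simp add: shade_def card_image layer_def)
  qed
  show "card {x \<in> layer n j. y \<in> shade x} < j" if y: "y \<in> layer n (j - 1)" for y
  proof -
    have yf: "finite y" by (rule finite_in_layer[OF y])
    have "{x \<in> layer n j. y \<in> shade x} \<subseteq> (\<lambda>i. insert i y) ` ({1..n} - y)"
    proof
      fix x assume "x \<in> {x \<in> layer n j. y \<in> shade x}"
      then have x: "x \<in> layer n j" "y \<in> shade x" by auto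
      then obtain i where "i \<in> x" "y = x - {i}" by (auto simp: shade_def)
      then show "x \<in> (\<lambda>i. insert i y) ` ({1..n} - y)" using x by (intro image_eqI[of _ _ i]) (auto simp: layer_def)
    qed
    then have "card {x \<in> layer n j. y \<in> shade x} \<le> card ((\<lambda>i. insert i y) ` ({1..n} - y))"
      by (rule card_mono[rotated]) simp
    also have "\<dots> \<le> card ({1..n} - y)" by (rule card_image_le) simp
    also have "\<dots> = n - (j - 1)" using y yf by (simp add: layer_def card_Diff_subset)
    finally show ?thesis using j by linarith
  qed
  show "y = y'" if x: "x \<in> layer n j" "x' \<in> layer n j" "x \<noteq> x'" "y \<in> shade x \<inter> shade x'" "y' \<in> shade x \<inter> shade x'" for x x' y y'
  proof -
    have f: "finite x" "finite x'" using x finite_in_layer by auto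
    have "x \<inter> x' \<noteq> x"
      using x f card_subset_eq[of x' x] by (auto simp: layer_def)
    then have "card (x \<inter> x') < card x" using f by (intro psubset_card_mono) auto
    moreover have "y \<subseteq> x \<inter> x'" "y' \<subseteq> x \<inter> x'" "card y + 1 = card x" "card y' + 1 = card x"
      using x f by (auto simp: mem_shade_iff)
    ultimately have "y = x \<inter> x'" "y' = x \<inter> x'"
      using f card_seteq[of "x \<inter> x'" y] card_seteq[of "x \<inter> x'" y'] by simp_all
    then show ?thesis by simp
  qed
qed

text \<open>The ratio of a geometric series over the size m of a component: (n + 1)^4 per member for
  the number of connected sets, 2 for the families above it, and the last factor for half of the
  shadow that isoperimetry guarantees per member.\<close>

definition rho :: "nat \<Rightarrow> real" where
  "rho n = real (n + 1) ^ 4 * 2 * 2 powr (- (n / (4 * (1 + 4 * log 2 n))))"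

lemma sum_geometric_le:
  fixes r :: real
  assumes "0 \<le> r" "r \<le> 1 / 2"
  shows "(\<Sum>m=1..M. r ^ m) \<le> 2 * r"
proof -
  have "(\<Sum>m=1..M. r ^ m) \<le> 2 * r - r ^ M * (2 * r)"
  proof (induction M)
    case (Suc M)
    have "r ^ Suc M * (2 * r) \<le> r ^ Suc M * 1" using assms by (intro mult_left_mono) auto
    then show ?case using Suc by (simp add: algebra_simps)
  qed simp
  then show ?thesis using assms by (smt (verit) mult_nonneg_nonneg zero_le_power)
qed

locale cube_layer =
  fixes n j :: nat
  assumes nj: "n + 2 \<le> 2 * j" "j \<le> n"
begin

sublocale bigraph "layer n j" "layer n (j - 1)" shade j
  by (rule bigraph_layers[OF nj(1)])

text \<open>Isoperimetry is applied to G together with its shadow: every member of G has all its j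
  downward edges inside, while a set of at most 2 n^4 points has only O(log n) edges per
  point.\<close>

lemma small_shadow_expansion:
  assumes G: "G \<subseteq> layer n j" and small: "card (sh G) < n ^ 4"
  shows "card G * (n / (2 * (1 + 4 * log 2 n))) \<le> card (sh G)"
proof -
  define L where "L = 1 + 4 * log 2 n"
  define S where "S = G \<union> sh G"
  define m g where "m = card G" and "g = card (sh G)"
  have n: "n \<ge> 2" using nj by linarith
  then have L: "L \<ge> 1" by (simp add: L_def)
  have fin: "finite G" "finite (sh G)" using G finX finite_subset finite_sh by blast+
  have shU: "sh G \<subseteq> layer n (j - 1)" using G by (rule sh_subset)
  have "m * real j \<le> g * (real j - 1)"
    unfolding m_def g_def
  proof (rule card_rich_le[OF G shU])
    fix x assume x: "x \<in> G"
    then have "shade x \<inter> sh G = shade x" by (auto simp: sh_def)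
    then show "real j \<le> card (shade x \<inter> sh G)" using card_N x G by auto
  qed
  then have "m * real j \<le> g * real j" by (simp add: algebra_simps)
  then have mg: "m \<le> g" using nj by (simp add: mult_le_cancel_right)
  have "card S \<le> m + g" unfolding S_def m_def g_def by (rule card_Un_le)
  then have cS: "card S \<le> 2 * g" using mg by simp
  have "log 2 (card S) \<le> L"
  proof (cases "card S = 0")
    case False
    have "log 2 (card S) \<le> log 2 (2 * real n ^ 4)"
      using False cS small by (intro log_mono) (auto simp: g_def[symmetric] simp flip: of_nat_power of_nat_mult)
    also have "\<dots> = L" using n by (simp add: L_def log_mult log_nat_power)
    finally show ?thesis .
  qed (use L in \<open>simp add: log_def\<close>)
  have "G \<subseteq> Pow {1..n}" using G by (auto simp: layer_def)
  moreover have "sh G \<subseteq> Pow {1..n}" using shU by (auto simp: layer_def)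
  ultimately have SU: "S \<subseteq> Pow {1..n}" by (simp add: S_def)
  have "m * j = (\<Sum>A\<in>G. card {i \<in> A. A - {i} \<in> S})"
  proof -
    have "card {i \<in> A. A - {i} \<in> S} = j" if A: "A \<in> G" for A
    proof -
      have "{i \<in> A. A - {i} \<in> S} = A" using A by (auto simp: S_def sh_def shade_def)
      then show ?thesis using A G by (auto simp: layer_def)
    qed
    then show ?thesis by (simp add: m_def)
  qed
  also have "\<dots> \<le> edges S" unfolding edges_def using fin by (intro sum_mono2) (auto simp: S_def)
  finally have "2 * (m * real j) \<le> 2 * edges S" by (simp flip: of_nat_mult)
  also have "\<dots> \<le> card S * log 2 (card S)" using edge_isoperimetry[OF _ SU] by simp
  also have "\<dots> \<le> card S * L" using \<open>log 2 (card S) \<le> L\<close> by (intro mult_left_mono) auto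
  also have "\<dots> \<le> (2 * g) * L" using cS L by (intro mult_right_mono) auto
  finally have "m * real j \<le> g * L" by simp
  moreover have "m * (real n / 2) \<le> m * real j" using nj by (intro mult_left_mono) auto
  ultimately have "m * (real n / 2) \<le> g * L" by linarith
  then have "m * (real n / 2) / L \<le> g" using L by (simp add: field_simps)
  then show ?thesis by (simp add: L_def m_def g_def)
qed

text \<open>The weight 2^-g is used only by half, so that the other half can supply exp(-c n^2)
  later; 2^|G| leaves room for the families above G.\<close>

lemma small_polymer_sum_le:
  assumes rho: "rho n \<le> 1 / 2"
  shows "(\<Sum>G\<in>{G. G \<subseteq> layer n j \<and> conn lk x G \<and> card (sh G) < n ^ 4}. 2 ^ card G * 2 powr (- (card (sh G) / 2))) \<le> 2 * rho n"
    (is "sum ?f ?A \<le> _")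
proof -
  define q where "q = n / (4 * (1 + 4 * log 2 n))"
  define M where "M = card (layer n j)"
  have finA: "finite ?A" by (rule finite_subset[of _ "Pow (layer n j)"]) (auto simp: finX)
  have img: "card ` ?A \<subseteq> {1..M}"
  proof
    fix m assume "m \<in> card ` ?A"
    then obtain G where G: "m = card G" "G \<subseteq> layer n j" "x \<in> G" by (auto simp: conn_def)
    then have "card G \<noteq> 0" using finite_subset[OF G(2) finX] by auto
    then show "m \<in> {1..M}" using G card_mono[OF finX G(2)] by (simp add: M_def)
  qed
  have "sum ?f ?A = (\<Sum>m=1..M. \<Sum>G\<in>{G \<in> ?A. card G = m}. ?f G)"
    by (rule sum.group[symmetric, OF finA _ img]) simp
  also have "\<dots> \<le> (\<Sum>m=1..M. rho n ^ m)"
  proof (rule sum_mono)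
    fix m assume m: "m \<in> {1..M}"
    have "(\<Sum>G\<in>{G \<in> ?A. card G = m}. ?f G) \<le> of_nat (card {G \<in> ?A. card G = m}) * (2 * 2 powr (- q)) ^ m"
    proof (rule sum_bounded_above)
      fix G assume G: "G \<in> {G \<in> ?A. card G = m}"
      then have "card G * (n / (2 * (1 + 4 * log 2 n))) \<le> card (sh G)"
        using small_shadow_expansion by blast
      moreover have "a / (2 * b) = 2 * (a / (4 * b))" for a b :: real by simp
      then have "n / (2 * (1 + 4 * log 2 n)) = 2 * q" by (simp only: q_def)
      ultimately have "card G * (2 * q) \<le> card (sh G)" by (simp only:)
      then have "m * q \<le> card (sh G) / 2" using G by simp
      then have "2 powr (- (card (sh G) / 2)) \<le> 2 powr (m * (- q))" by (intro powr_mono) auto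
      also have "\<dots> = (2 powr (- q)) ^ m" by (simp add: powr_power mult.commute)
      finally show "?f G \<le> (2 * 2 powr (- q)) ^ m" using G by (simp add: power_mult_distrib)
    qed
    also have "\<dots> \<le> (real (n + 1) ^ 4) ^ m * (2 * 2 powr (- q)) ^ m"
    proof (intro mult_right_mono)
      have "card {G \<in> ?A. card G = m} \<le> card {G. G \<subseteq> layer n j \<and> conn lk x G \<and> card G = m}"
      proof (rule card_mono)
        show "finite {G. G \<subseteq> layer n j \<and> conn lk x G \<and> card G = m}"
          by (rule finite_subset[of _ "Pow (layer n j)"]) (auto simp: finX)
      qed auto
      also have "\<dots> \<le> (j + 1) ^ (4 * m)" by (rule card_conn_lk_le)
      also have "\<dots> \<le> (n + 1) ^ (4 * m)" using nj by (intro power_mono) auto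
      finally have "real (card {G \<in> ?A. card G = m}) \<le> real ((n + 1) ^ (4 * m))" by (simp only: of_nat_le_iff)
      then show "of_nat (card {G \<in> ?A. card G = m}) \<le> (real (n + 1) ^ 4) ^ m" by (simp add: power_mult)
    qed simp
    also have "\<dots> = rho n ^ m" by (simp only: rho_def q_def power_mult_distrib[symmetric] mult.assoc)
    finally show "(\<Sum>G\<in>{G \<in> ?A. card G = m}. ?f G) \<le> rho n ^ m" .
  qed
  also have "\<dots> \<le> 2 * rho n" using rho by (intro sum_geometric_le) (simp_all add: rho_def)
  finally show ?thesis .
qed

definition small_sets :: "nat set set set" where
  "small_sets = {A. A \<subseteq> layer n j \<and> (\<forall>x\<in>A. card (sh (component lk A x)) < n ^ 4)}"

text \<open>This is the condition \<open>W_sum\<close> for the graph one level down, of degree j -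
  1. A component is rooted by a shadow point in Z and one of fewer than n sets above it, so the
  polymer expansion gives exp(|Z| n 2 rho).\<close>

lemma small_sets_sum_le:
  assumes rho: "rho n \<le> 1 / 2" "2 * real n ^ 3 * rho n \<le> ln 2" and Z: "Z \<subseteq> layer n (j - 1)"
  shows "(\<Sum>A\<in>{A \<in> small_sets. sh A \<subseteq> Z}. 2 powr (- (3 / 4) * card (sh A))) \<le> 2 powr (card Z / real (j - 1) ^ 2)"
proof -
  define P where "P = {G. G \<noteq> {} \<and> G \<subseteq> layer n j \<and> (\<forall>x\<in>G. conn lk x G) \<and> card (sh G) < n ^ 4 \<and> sh G \<subseteq> Z}"
  let ?w = "\<lambda>G. 2 powr (- (3 / 4) * card (sh G))"
  have finP: "finite P" by (rule finite_subset[of _ "Pow (layer n j)"]) (auto simp: P_def finX)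
  have finZ: "finite Z" using Z finY finite_subset by blast
  have "(\<Sum>A\<in>{A \<in> small_sets. sh A \<subseteq> Z}. ?w A) \<le> exp (\<Sum>G\<in>P. ?w G)"
  proof (rule sum_sets_le_exp_polymers)
    fix A assume A: "A \<in> {A \<in> small_sets. sh A \<subseteq> Z}"
    then show AX: "A \<subseteq> layer n j" by (simp add: small_sets_def)
    show "component lk A ` A \<subseteq> P"
    proof
      fix G assume "G \<in> component lk A ` A"
      then obtain x where x: "x \<in> A" "G = component lk A x" by blast
      have GA: "G \<subseteq> A" using component_subset[OF x(1)] x(2) by simp
      have "conn lk y G" if "y \<in> G" for y
        using component_eq[OF sym_lk, of y A x] conn_component[of y A lk] that x GA by auto
      moreover have "sh G \<subseteq> Z" using sh_mono[OF GA] A by auto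
      moreover have "G \<noteq> {}" using x self_in_component by fast
      ultimately show "G \<in> P" using A x GA AX by (auto simp: P_def small_sets_def)
    qed
  qed (rule finP)
  also have "(\<Sum>G\<in>P. ?w G) \<le> card (Sigma Z nb) * (2 * rho n)"
  proof (rule sum_le_certificate_count[where V = "\<lambda>c G. snd c \<in> G"])
    show "finite (Sigma Z nb)" using finZ finite_nb by auto
    show "\<exists>c\<in>Sigma Z nb. snd c \<in> G" if G: "G \<in> P" for G
    proof -
      obtain x where x: "x \<in> G" "x \<in> layer n j" using G by (auto simp: P_def)
      have "card (shade x) = j" using card_N[OF x(2)] .
      then obtain y where y: "y \<in> shade x" using nj by fastforce
      then have "y \<in> Z" "x \<in> nb y" using G x by (auto simp: P_def sh_def nb_def)
      then show ?thesis using x by (intro bexI[of _ "(y, x)"]) auto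
    qed
    fix c
    have "(\<Sum>G\<in>{G \<in> P. snd c \<in> G}. ?w G)
      \<le> (\<Sum>G\<in>{G \<in> P. snd c \<in> G}. 2 ^ card G * 2 powr (- (card (sh G) / 2)))"
    proof (rule sum_mono)
      fix G
      have "1 * ?w G \<le> 2 ^ card G * 2 powr (- (card (sh G) / 2))"
        by (intro mult_mono powr_mono) auto
      then show "?w G \<le> 2 ^ card G * 2 powr (- (card (sh G) / 2))" by simp
    qed
    also have "\<dots> \<le> (\<Sum>G\<in>{G. G \<subseteq> layer n j \<and> conn lk (snd c) G \<and> card (sh G) < n ^ 4}. 2 ^ card G * 2 powr (- (card (sh G) / 2)))"
    proof (rule sum_mono2)
      show "finite {G. G \<subseteq> layer n j \<and> conn lk (snd c) G \<and> card (sh G) < n ^ 4}"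
        by (rule finite_subset[of _ "Pow (layer n j)"]) (auto simp: finX)
      show "{G \<in> P. snd c \<in> G} \<subseteq> {G. G \<subseteq> layer n j \<and> conn lk (snd c) G \<and> card (sh G) < n ^ 4}"
        unfolding P_def by blast
    qed simp
    also have "\<dots> \<le> 2 * rho n" by (rule small_polymer_sum_le[OF rho(1)])
    finally show "(\<Sum>G\<in>{G \<in> P. snd c \<in> G}. ?w G) \<le> 2 * rho n" .
  qed (use finP in auto)
  also have "card (Sigma Z nb) \<le> card Z * n"
  proof -
    have "card (Sigma Z nb) = (\<Sum>y\<in>Z. card (nb y))" using finZ finite_nb by simp
    also have "\<dots> \<le> of_nat (card Z) * n"
    proof (rule sum_bounded_above)
      show "card (nb y) \<le> n" if "y \<in> Z" for y
      proof -
        have "card (nb y) < j" using that Z by (intro card_nb) auto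
        then show ?thesis using nj(2) by linarith
      qed
    qed
    finally show ?thesis by simp
  qed
  finally have "(\<Sum>A\<in>{A \<in> small_sets. sh A \<subseteq> Z}. ?w A) \<le> exp (card Z * n * (2 * rho n))"
    by (simp add: mult_right_mono rho_def)
  also have "\<dots> \<le> exp (card Z / real (j - 1) ^ 2 * ln 2)"
  proof (subst exp_le_cancel_iff)
    have j1: "0 < real (j - 1)" "real (j - 1) \<le> n" using nj by auto
    have "real (j - 1) ^ 2 * (n * (2 * rho n)) \<le> real n ^ 2 * (n * (2 * rho n))"
      using j1 by (intro mult_right_mono power_mono) (auto simp: rho_def)
    also have "\<dots> \<le> ln 2" using rho(2) by (simp add: power2_eq_square power3_eq_cube mult_ac)
    finally have "n * (2 * rho n) \<le> ln 2 / real (j - 1) ^ 2" using j1 by (simp add: field_simps)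
    then have "card Z * (n * (2 * rho n)) \<le> card Z * (ln 2 / real (j - 1) ^ 2)" by (intro mult_left_mono) auto
    then show "card Z * n * (2 * rho n) \<le> card Z / real (j - 1) ^ 2 * ln 2" by (simp add: mult_ac)
  qed
  also have "\<dots> = 2 powr (card Z / real (j - 1) ^ 2)" by (simp add: powr_def)
  finally show ?thesis .
qed

end

section \<open>Peeling off the top level\<close>

context weighted_bigraph begin

lemma big_polymer_sum_le:
  assumes "large d" and B: "card Y \<le> B"
  shows "(\<Sum>G\<in>{G. G \<subseteq> X \<and> conn lk x G \<and> M \<le> card (sh G)}. wt G * 2 powr (- real (card (sh G))))
    \<le> (real B + 1) * (3 * real (d + 1) ^ 16 * 2 powr (- (M / (2 * d))))"
    (is "sum ?f ?A \<le> _")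
proof -
  have finA: "finite ?A" by (rule finite_subset[of _ "Pow X"]) (auto simp: finX)
  have img: "(\<lambda>G. card (sh G)) ` ?A \<subseteq> {M..B}"
  proof clarify
    fix G assume "G \<subseteq> X" "M \<le> card (sh G)"
    then show "card (sh G) \<in> {M..B}" using card_mono[OF finY sh_subset[of G]] B by simp
  qed
  have "sum ?f ?A = (\<Sum>g=M..B. \<Sum>G\<in>{G \<in> ?A. card (sh G) = g}. ?f G)"
    by (rule sum.group[symmetric, OF finA _ img]) simp
  also have "\<dots> \<le> of_nat (card {M..B}) * (3 * real (d + 1) ^ 16 * 2 powr (- (M / (2 * d))))"
  proof (rule sum_bounded_above)
    fix g assume g: "g \<in> {M..B}"
    have "(\<Sum>G\<in>{G \<in> ?A. card (sh G) = g}. ?f G) = (\<Sum>G\<in>{G \<in> ?A. card (sh G) = g}. wt G * 2 powr (- real g))"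
      by (intro sum.cong refl) simp
    also have "\<dots> \<le> (\<Sum>G\<in>fam x g. wt G * 2 powr (- real g))"
    proof (rule sum_mono2[OF finite_fam])
      show "{G \<in> ?A. card (sh G) = g} \<subseteq> fam x g" by (auto simp: fam_def)
    qed (simp add: wt_nonneg)
    also have "\<dots> \<le> 3 * real (d + 1) ^ 16 * 2 powr (- (g / (2 * d)))" by (rule polymer_sum_le[OF assms(1)])
    also have "\<dots> \<le> 3 * real (d + 1) ^ 16 * 2 powr (- (M / (2 * d)))"
      using g by (intro mult_left_mono powr_mono) (auto intro!: divide_right_mono)
    finally show "(\<Sum>G\<in>{G \<in> ?A. card (sh G) = g}. ?f G) \<le> 3 * real (d + 1) ^ 16 * 2 powr (- (M / (2 * d)))" .
  qed
  also have "\<dots> \<le> (real B + 1) * (3 * real (d + 1) ^ 16 * 2 powr (- (M / (2 * d))))"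
    by (intro mult_right_mono) auto
  finally show ?thesis .
qed

end

lemma layer_iff: "A \<in> layer n j \<longleftrightarrow> A \<subseteq> {1..n} \<and> card A = j"
  by (simp add: layer_def)

text \<open>Removing two elements gives a common lower neighbour, so the shadow of a single set lies
  in one component. If y = w, size at least 2 keeps \<open>shade y\<close> nonempty.\<close>

lemma shades_meet:
  assumes "finite z" "2 \<le> card z" "y \<in> shade z" "w \<in> shade z"
  shows "shade y \<inter> shade w \<noteq> {}"
proof -
  obtain p q where pq: "p \<in> z" "q \<in> z" "y = z - {p}" "w = z - {q}" using assms by (auto simp: shade_def)
  show ?thesis
  proof (cases "p = q")
    case True
    have "card y \<noteq> 0" using assms(1,2) pq by simp
    then have "y \<noteq> {}" by auto
    then show ?thesis using True pq by (auto simp: shade_def)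
  next
    case False
    then have "q \<in> y" "p \<in> w" "z - {p} - {q} = z - {q} - {p}" using pq by auto
    then have "z - {p} - {q} \<in> shade y" "z - {p} - {q} \<in> shade w"
      unfolding shade_def pq(3,4) by (auto intro: rev_image_eqI)
    then show ?thesis by blast
  qed
qed

definition levels :: "nat \<Rightarrow> nat \<Rightarrow> nat \<Rightarrow> nat set set" where
  "levels n i k = {A. A \<subseteq> {1..n} \<and> i \<le> card A \<and> card A \<le> k}"

lemma finite_levels: "finite (levels n i k)"
  by (rule finite_subset[of _ "Pow {1..n}"]) (auto simp: levels_def)

definition big_err :: "nat \<Rightarrow> real" where
  "big_err n = (2 ^ n + 1) * (3 * real (n + 1) ^ 16 * 2 powr (- (real n ^ 3 / 2)))"

text \<open>2^n stands for the choices of a. \<open>big_err\<close> occurs twice: for large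
  components in the top level and in the level below.\<close>

definition err :: "nat \<Rightarrow> real" where
  "err n = 2 ^ n * (2 * big_err n + 2 powr (- (real n ^ 2 / 16)) * (2 * rho n))"

text \<open>One peeling step. The bound n + 4 <= 2k gives the degree gap for k and k - 1 alike, and
  i + 2 <= k ensures that both freed shadows are still within the levels considered.\<close>

locale cube_levels =
  fixes n k i :: nat
  assumes nk: "n + 4 \<le> 2 * k" "k \<le> n" and ik: "i + 2 \<le> k"
    and large: "large k" "large (k - 1)" and rho: "rho n \<le> 1 / 2" "2 * real n ^ 3 * rho n \<le> ln 2"
begin

abbreviation "Hi \<equiv> layer n k"
abbreviation "Lo \<equiv> layer n (k - 1)"

sublocale U: cube_layer n k by standard (use nk in auto)
sublocale L: cube_layer n "k - 1" by standard (use nk in auto)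

text \<open>Nothing lies above the top level: a single index with the empty set makes the weight
  constantly 1.\<close>

sublocale UW: weighted_bigraph Hi Lo shade k "{()}" "\<lambda>_. {}"
  by standard (auto intro: ge_one_powr_ge_zero)

sublocale LW: weighted_bigraph Lo "layer n (k - 1 - 1)" shade "k - 1" U.small_sets U.sh
proof
  show "finite U.small_sets"
    by (rule finite_subset[of _ "Pow (Hi)"]) (auto simp: U.small_sets_def U.finX)
qed (rule U.small_sets_sum_le[OF rho])

abbreviation "Ds \<equiv> downsets (levels n i k)"

lemma downD: "D \<in> Ds \<Longrightarrow> z \<in> D \<Longrightarrow> z' \<subseteq> z \<Longrightarrow> i \<le> card z' \<Longrightarrow> z' \<in> D"
proof -
  assume *: "D \<in> Ds" "z \<in> D" "z' \<subseteq> z" "i \<le> card z'"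
  then have z: "z \<subseteq> {1..n}" "card z \<le> k" by (auto simp: downsets_def levels_def)
  then have "card z' \<le> card z" using * finite_subset by (intro card_mono) auto
  then have "z' \<in> levels n i k" using * z by (auto simp: levels_def)
  then show "z' \<in> D" using * by (auto simp: downsets_def)
qed

lemma Ds_sub: "D \<in> Ds \<Longrightarrow> z \<in> D \<Longrightarrow> z \<subseteq> {1..n} \<and> card z \<le> k \<and> i \<le> card z"
  by (auto simp: downsets_def levels_def)

lemma Ds_layerI: "D \<in> Ds \<Longrightarrow> z \<in> D \<Longrightarrow> card z = j \<Longrightarrow> z \<in> layer n j"
  using Ds_sub by (simp add: layer_iff)

lemma Ds_shade: "D \<in> Ds \<Longrightarrow> z \<in> D \<Longrightarrow> i < card z \<Longrightarrow> shade z \<subseteq> D"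
proof
  fix y assume *: "D \<in> Ds" "z \<in> D" "i < card z" "y \<in> shade z"
  then have "finite z" using Ds_sub finite_subset by blast
  then have "y \<subseteq> z" "card y + 1 = card z" using mem_shade_iff * by blast+
  then show "y \<in> D" using downD[of D z y] * by simp
qed

lemma removal_in_Ds:
  assumes D: "D \<in> Ds"
    and R: "\<And>z z'. z \<in> D \<Longrightarrow> z' \<in> R \<Longrightarrow> z' \<subseteq> z \<Longrightarrow> z \<in> R"
  shows "D - R \<in> Ds"
  unfolding downsets_def
proof (clarify, intro conjI ballI impI)
  show "D - R \<subseteq> levels n i k" using D by (auto simp: downsets_def)
  fix z z' assume "z \<in> D - R" "z' \<in> levels n i k" "z' \<subseteq> z"
  then show "z' \<in> D - R" using D R by (auto simp: downsets_def)
qed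

lemma shade_between:
  assumes "finite z" "z' \<subseteq> z" "card z' < card z"
  obtains x where "x \<in> shade z" "z' \<subseteq> x"
proof -
  obtain j where j: "j \<in> z" "j \<notin> z'" using assms by (metis less_irrefl subsetI subset_antisym)
  then have "z - {j} \<in> shade z" "z' \<subseteq> z - {j}" using assms by (auto simp: shade_def)
  then show ?thesis by (rule that)
qed

text \<open>A member of D strictly above a freed point is a top set linked to G, hence belongs to
  the component and has been deleted as well.\<close>

lemma top_removal:
  "card {D \<in> Ds. a \<in> D \<inter> Hi \<and> component U.lk (D \<inter> Hi) a = G} * 2 ^ card (U.sh G) \<le> card Ds"
    (is "card ?E * _ \<le> _")
proof (cases "?E = {}")
  case False
  then obtain D0 where "D0 \<in> ?E" by blast
  then have GX: "G \<subseteq> Hi" using component_subset[of a "D0 \<inter> Hi" U.lk] by blast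
  have shY: "U.sh G \<subseteq> Lo" using GX by (rule U.sh_subset)
  have cG: "card z = k" if "z \<in> G" for z using subsetD[OF GX that] by (simp add: layer_iff)
  have cS: "card z = k - 1" if "z \<in> U.sh G" for z using subsetD[OF shY that] by (simp add: layer_iff)
  show ?thesis
  proof (rule card_downsets_removal[OF finite_levels _ U.finite_sh[OF GX]])
    show "?E \<subseteq> Ds" by blast
    show "G \<inter> U.sh G = {}" using GX shY U.disj by blast
    fix D assume "D \<in> ?E"
    then have D: "D \<in> Ds" "a \<in> D \<inter> Hi" "component U.lk (D \<inter> Hi) a = G" by blast+
    have GD: "G \<subseteq> D \<inter> Hi" using component_subset[OF D(2), of U.lk] D(3) by simp
    have "shade x \<subseteq> D" if x: "x \<in> G" for x
    proof -
      have "i < card x" using cG[OF x] ik by linarith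
      then show ?thesis using Ds_shade[OF D(1)] GD x by blast
    qed
    then show "G \<union> U.sh G \<subseteq> D" using GD by (auto simp: U.sh_def)
    fix S assume S: "S \<subseteq> U.sh G"
    have "D - (G \<union> S) \<in> Ds"
    proof (rule removal_in_Ds[OF D(1)])
      fix z z' assume z: "z \<in> D" "z' \<in> G \<union> S" "z' \<subseteq> z"
      have zP: "z \<subseteq> {1..n}" "card z \<le> k" using Ds_sub[OF D(1) z(1)] by auto
      have finz: "finite z" using zP(1) finite_subset by blast
      show "z \<in> G \<union> S"
      proof (cases "z' = z")
        case False
        then have lt: "card z' < card z" using z finz by (simp add: psubset_card_mono psubsetI)
        have "z' \<notin> G" using cG[of z'] lt zP by auto
        then have z'S: "z' \<in> S" using z by simp
        then have c': "card z' = k - 1" using S cS by blast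
        then have ck: "card z = k" using lt zP by linarith
        have zk: "z \<in> D \<inter> Hi" using z Ds_layerI[OF D(1) z(1) ck] by simp
        have "z' \<in> shade z" using z c' ck nk by (simp add: mem_shade_iff[OF finz])
        moreover obtain x where x: "x \<in> G" "z' \<in> shade x" using z'S S by (auto simp: U.sh_def)
        ultimately have xz: "(x, z) \<in> U.lk" using zk GX by (auto simp: U.lk_def)
        have "x \<in> component U.lk (D \<inter> Hi) a" using x D(3) by simp
        then have "z \<in> component U.lk (D \<inter> Hi) a" using zk xz by (rule component_closed[OF D(2)])
        then show ?thesis using D(3) by simp
      qed (use z in simp)
    qed
    moreover have "D - (G \<union> S) = D - G - S" by blast
    ultimately show "D - G - S \<in> Ds" by simp
  qed
next
  case True
  show ?thesis unfolding True by simp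
qed

text \<open>Deleting G forces the top sets above it to go. The shades of a top set over G are
  pairwise linked, so they all lie in the component G, and these top sets are exactly A. Since A
  must be known to invert the map, each possible A is a separate event.\<close>

lemma second_removal:
  "card {D \<in> Ds. x \<in> D \<inter> Lo \<and> component L.lk (D \<inter> Lo) x = G
      \<and> {b \<in> D \<inter> Hi. shade b \<subseteq> G} = A} * 2 ^ card (U.sh G) \<le> card Ds"
    (is "card ?E * _ \<le> _")
proof (cases "?E = {}")
  case False
  then obtain D0 where "D0 \<in> ?E" by blast
  then have GX: "G \<subseteq> Lo" and AX: "A \<subseteq> Hi"
    using component_subset[of x "D0 \<inter> Lo" L.lk] by blast+
  have shY: "U.sh G \<subseteq> layer n (k - 1 - 1)" using GX by (rule L.sh_subset)
  have cG: "card z = k - 1" if "z \<in> G" for z using subsetD[OF GX that] by (simp add: layer_iff)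
  have cA: "card z = k" if "z \<in> A" for z using subsetD[OF AX that] by (simp add: layer_iff)
  have cS: "card z = k - 2" if "z \<in> U.sh G" for z using subsetD[OF shY that] by (simp add: layer_iff)
  show ?thesis
  proof (rule card_downsets_removal[OF finite_levels _ L.finite_sh[OF GX]])
    show "?E \<subseteq> Ds" by blast
    have "z \<notin> U.sh G" if "z \<in> G \<union> A" for z
    proof
      assume "z \<in> U.sh G"
      then show False using that cG[of z] cA[of z] cS[of z] ik by auto
    qed
    then show "(G \<union> A) \<inter> U.sh G = {}" by blast
    fix D assume "D \<in> ?E"
    then have D: "D \<in> Ds" "x \<in> D \<inter> Lo" "component L.lk (D \<inter> Lo) x = G"
      and AD: "A = {b \<in> D \<inter> Hi. shade b \<subseteq> G}" by blast+
    have GD: "G \<subseteq> D \<inter> Lo" using component_subset[OF D(2), of L.lk] D(3) by simp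
    have "shade y \<subseteq> D" if y: "y \<in> G" for y
    proof -
      have "i < card y" using cG[OF y] ik by linarith
      then show ?thesis using Ds_shade[OF D(1)] GD y by blast
    qed
    then show "G \<union> A \<union> U.sh G \<subseteq> D" using GD AD by (auto simp: U.sh_def)
    fix S assume S: "S \<subseteq> U.sh G"
    have in_G: "z \<in> G" if z: "z \<in> D" "z \<in> Lo" and y: "y \<in> G" "shade y \<inter> shade z \<noteq> {}" for y z
    proof -
      have yz: "(y, z) \<in> L.lk" unfolding L.lk_def using z y GX by blast
      have "z \<in> component L.lk (D \<inter> Lo) x"
      proof (rule component_closed[OF D(2) _ _ yz])
        show "y \<in> component L.lk (D \<inter> Lo) x" unfolding D(3) by (rule y(1))
        show "z \<in> D \<inter> Lo" using z by (rule IntI)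
      qed
      then show ?thesis unfolding D(3) .
    qed
    have in_A: "z \<in> A" if z: "z \<in> D" "z \<in> Hi" and y: "y \<in> shade z" "y \<in> G" for y z
    proof -
      have cz: "card z = k" and finz: "finite z" using z finite_in_layer by (auto simp: layer_iff)
      have shz: "shade z \<subseteq> D" using Ds_shade[OF D(1) z(1)] cz ik by simp
      have "w \<in> G" if w: "w \<in> shade z" for w
      proof -
        have wl: "w \<in> Lo" using U.N_sub[OF z(2)] w by blast
        have "shade y \<inter> shade w \<noteq> {}" using shades_meet[OF finz _ y(1) w] cz ik by simp
        then show ?thesis using in_G[OF _ wl y(2)] shz w by blast
      qed
      then show ?thesis using z AD by auto
    qed
    have "D - (G \<union> A \<union> S) \<in> Ds"
    proof (rule removal_in_Ds[OF D(1)])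
      fix z z' assume z: "z \<in> D" "z' \<in> G \<union> A \<union> S" "z' \<subseteq> z"
      have zP: "z \<subseteq> {1..n}" "card z \<le> k" using Ds_sub[OF D(1) z(1)] by auto
      have finz: "finite z" using zP(1) finite_subset by blast
      show "z \<in> G \<union> A \<union> S"
      proof (cases "z' = z")
        case False
        then have lt: "card z' < card z" using z finz by (simp add: psubset_card_mono psubsetI)
        then have "z' \<notin> A" using cA[of z'] zP by auto
        then consider "z' \<in> G" | "z' \<in> S" using z by auto
        then show ?thesis
        proof cases
          case 1
          have c: "card z = k" using cG[OF 1] lt zP by linarith
          then have "z' \<in> shade z" using cG[OF 1] z ik by (simp add: mem_shade_iff[OF finz])
          then show ?thesis using in_A[OF z(1) Ds_layerI[OF D(1) z(1) c] _ 1] by simp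
        next
          case 2
          then obtain y where y: "y \<in> G" "z' \<in> shade y" using S by (auto simp: U.sh_def)
          have c: "card z' = k - 2" using 2 S cS by blast
          \<comment> \<open>A member of D above a freed point is one level up, and then linked to G
            through that point, or two levels up, and then above an intermediate set that is linked
            to G.\<close>
          have lower: "w \<in> G" if w: "w \<in> D" "w \<in> Lo" "z' \<subseteq> w" for w
          proof -
            have "card w = k - 1" using w by (simp add: layer_iff)
            then have "z' \<in> shade w" using w(3) c ik finite_in_layer[OF w(2)] by (simp add: mem_shade_iff)
            then show ?thesis using in_G[OF w(1,2) y(1)] y(2) by blast
          qed
          show ?thesis
          proof (cases "card z = k - 1")
            case True
            then show ?thesis using lower[OF z(1) Ds_layerI[OF D(1) z(1) True] z(3)] by simp
          next
            case False
            then have ck: "card z = k" using lt c zP by linarith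
            then have zk: "z \<in> Hi" by (rule Ds_layerI[OF D(1) z(1)])
            obtain w where w: "w \<in> shade z" "z' \<subseteq> w" using shade_between[OF finz z(3) lt] by blast
            have "shade z \<subseteq> D" using Ds_shade[OF D(1) z(1)] ck ik by simp
            then have "w \<in> G" using lower[of w] w U.N_sub[OF zk] by blast
            then show ?thesis using in_A[OF z(1) zk w(1)] by simp
          qed
        qed
      qed (use z in simp)
    qed
    moreover have "D - (G \<union> A \<union> S) = D - (G \<union> A) - S" by blast
    ultimately show "D - (G \<union> A) - S \<in> Ds" by simp
  qed
next
  case True
  show ?thesis unfolding True by simp
qed

end

section \<open>Union bounds for a downset that meets the top level\<close>

lemma real_card_UN_le:
  "finite I \<Longrightarrow> real (card (\<Union>i\<in>I. A i)) \<le> (\<Sum>i\<in>I. real (card (A i)))"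
  using of_nat_mono[OF card_UN_le[of I A], where 'a = real] by simp

lemma card_le_powr_mult:
  "a * 2 ^ m \<le> b \<Longrightarrow> real a \<le> 2 powr (- real m) * b"
  using of_nat_mono[of "a * 2 ^ m" b, where 'a = real] by (simp add: powr_minus_divide powr_realpow field_simps)

lemma big_err_ge:
  assumes "0 < d" "d \<le> n"
  shows "(real (2 ^ n) + 1) * (3 * real (d + 1) ^ 16 * 2 powr (- (real (n ^ 4) / real (2 * d)))) \<le> big_err n"
proof -
  have "real n ^ 3 / 2 * (2 * real d) \<le> real n ^ 3 * real n" using assms by simp
  also have "\<dots> = real (n ^ 4)" by (simp add: power4_eq_xxxx power3_eq_cube)
  finally have "real n ^ 3 / 2 \<le> real (n ^ 4) / real (2 * d)" using assms by (simp add: pos_le_divide_eq)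
  then have "2 powr (- (real (n ^ 4) / real (2 * d))) \<le> 2 powr (- (real n ^ 3 / 2))" by (intro powr_mono) auto
  moreover have "real (d + 1) ^ 16 \<le> real (n + 1) ^ 16" using assms by (intro power_mono) auto
  ultimately show ?thesis unfolding big_err_def by (intro mult_mono) auto
qed

context cube_levels begin

abbreviation "Z \<equiv> real (card Ds)"

lemma finite_Ds: "finite Ds" by (rule finite_downsets[OF finite_levels])

lemma big_top_count:
  "real (card {D \<in> Ds. \<exists>a\<in>D \<inter> Hi. n ^ 4 \<le> card (U.sh (component U.lk (D \<inter> Hi) a))})
    \<le> 2 ^ n * big_err n * Z"
    (is "real (card ?E) \<le> _")
proof -
  let ?B = "\<lambda>a. {G. G \<subseteq> Hi \<and> conn U.lk a G \<and> n ^ 4 \<le> card (U.sh G)}"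
  let ?F = "\<lambda>a G. {D \<in> Ds. a \<in> D \<inter> Hi \<and> component U.lk (D \<inter> Hi) a = G}"
  have finB: "finite (?B a)" for a by (rule finite_subset[of _ "Pow (Hi)"]) (auto simp: U.finX)
  have finF: "finite (?F a G)" for a G using finite_Ds by simp
  have "?E \<subseteq> (\<Union>a\<in>Hi. \<Union>G\<in>?B a. ?F a G)"
  proof
    fix D assume "D \<in> ?E"
    then obtain a where D: "D \<in> Ds" and a: "a \<in> D \<inter> Hi"
      and big: "n ^ 4 \<le> card (U.sh (component U.lk (D \<inter> Hi) a))" by blast
    have "component U.lk (D \<inter> Hi) a \<in> ?B a"
      using component_subset[OF a, of U.lk] conn_component[OF a, of U.lk] big by simp
    then show "D \<in> (\<Union>a\<in>Hi. \<Union>G\<in>?B a. ?F a G)" using D a by blast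
  qed
  then have "card ?E \<le> card (\<Union>a\<in>Hi. \<Union>G\<in>?B a. ?F a G)"
    by (rule card_mono[rotated]) (intro finite_UN_I U.finX finB finF)
  then have "real (card ?E) \<le> card (\<Union>a\<in>Hi. \<Union>G\<in>?B a. ?F a G)" by simp
  also have "\<dots> \<le> (\<Sum>a\<in>Hi. real (card (\<Union>G\<in>?B a. ?F a G)))" by (rule real_card_UN_le[OF U.finX])
  also have "\<dots> \<le> (\<Sum>a\<in>Hi. big_err n * Z)"
  proof (rule sum_mono)
    fix a
    have "real (card (\<Union>G\<in>?B a. ?F a G)) \<le> (\<Sum>G\<in>?B a. real (card (?F a G)))"
      by (rule real_card_UN_le[OF finB])
    also have "\<dots> \<le> (\<Sum>G\<in>?B a. UW.wt G * 2 powr (- real (card (U.sh G))) * Z)"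
      using card_le_powr_mult[OF top_removal] by (intro sum_mono) (simp add: UW.wt_def)
    also have "\<dots> = (\<Sum>G\<in>?B a. UW.wt G * 2 powr (- real (card (U.sh G)))) * Z"
      by (simp only: sum_distrib_right)
    also have "\<dots> \<le> big_err n * Z"
    proof (rule mult_right_mono)
      show "(\<Sum>G\<in>?B a. UW.wt G * 2 powr (- real (card (U.sh G)))) \<le> big_err n"
        using UW.big_polymer_sum_le[OF large(1) card_layer_le, of a "n ^ 4"] big_err_ge[of k n] nk
        by linarith
    qed simp
    finally show "real (card (\<Union>G\<in>?B a. ?F a G)) \<le> big_err n * Z" .
  qed
  also have "\<dots> \<le> 2 ^ n * (big_err n * Z)"
  proof -
    have "real (card (Hi)) \<le> 2 ^ n" using card_layer_le[of n k] by (metis of_nat_le_iff of_nat_numeral of_nat_power)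
    then show ?thesis by (simp add: mult_right_mono big_err_def)
  qed
  finally show ?thesis by (simp add: mult.assoc)
qed

text \<open>Two levels below a lie its k choose 2 subsets obtained by removing a pair; the size
  n^2/8 comes from k(k - 1) >= n^2/4.\<close>

lemma card_sh_shade_ge:
  assumes a: "a \<in> Hi"
  shows "real n ^ 2 / 8 \<le> card (U.sh (shade a))"
proof -
  have fina: "finite a" and ca: "card a = k" using a finite_in_layer by (auto simp: layer_iff)
  have shY: "shade a \<subseteq> Lo" by (rule U.N_sub[OF a])
  have "(\<lambda>B. a - B) ` {B. B \<subseteq> a \<and> card B = 2} \<subseteq> U.sh (shade a)"
  proof clarify
    fix B assume "B \<subseteq> a" "card B = 2"
    then obtain p q where "B = {p, q}" "p \<noteq> q" "p \<in> a" "q \<in> a" by (auto simp: card_2_iff)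
    then have "a - {p} \<in> shade a" "a - B \<in> shade (a - {p})" by (auto simp: shade_def intro!: image_eqI[of _ _ q])
    then show "a - B \<in> U.sh (shade a)" unfolding U.sh_def by blast
  qed
  then have "card ((\<lambda>B. a - B) ` {B. B \<subseteq> a \<and> card B = 2}) \<le> card (U.sh (shade a))"
    by (rule card_mono[OF L.finite_sh[OF shY]])
  moreover have "inj_on (\<lambda>B. a - B) {B. B \<subseteq> a \<and> card B = 2}"
    by (rule inj_onI) (auto dest: double_diff[OF _ subset_refl])
  ultimately have "k choose 2 \<le> card (U.sh (shade a))"
    using n_subsets[OF fina, of 2] ca by (simp add: card_image)
  moreover have "real n ^ 2 / 8 \<le> real (k choose 2)"
  proof -
    have "real n / 2 * (real n / 2) \<le> real k * (real k - 1)" using nk by (intro mult_mono) auto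
    also have "real k * (real k - 1) = 2 * real (k choose 2)"
    proof -
      have "even (k * (k - 1))" by (cases k) auto
      then have "2 * (k choose 2) = k * (k - 1)" unfolding choose_two by (rule dvd_mult_div_cancel)
      then have "real (2 * (k choose 2)) = real (k * (k - 1))" by (simp only:)
      then have "2 * real (k choose 2) = real (k * (k - 1))" by simp
      then show ?thesis using nk by (simp add: of_nat_diff)
    qed
    finally show ?thesis by (simp add: power2_eq_square)
  qed
  ultimately show ?thesis by (meson of_nat_le_iff order_trans)
qed

text \<open>By the degree gap, at most |G| top sets have their whole shadow in G. This crude count
  suffices for small G, where isoperimetry makes the shadow far larger than G.\<close>

lemma wt_le_power:
  assumes G: "G \<subseteq> Lo"
  shows "LW.wt G \<le> 2 ^ card G"
proof -
  define Q where "Q = {b \<in> Hi. shade b \<subseteq> G}"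
  have QX: "Q \<subseteq> Hi" by (auto simp: Q_def)
  have finQ: "finite Q" using QX U.finX by (rule finite_subset)
  have "card Q * real k \<le> card G * (real k - 1)"
  proof (rule U.card_rich_le[OF QX G])
    fix b assume b: "b \<in> Q"
    then have "shade b \<inter> G = shade b" by (auto simp: Q_def)
    then show "real k \<le> card (shade b \<inter> G)" using U.card_N b QX by auto
  qed
  also have "\<dots> \<le> card G * real k" by (intro mult_left_mono) auto
  finally have "card Q \<le> card G" using nk by simp
  have "{A \<in> U.small_sets. U.sh A \<subseteq> G} \<subseteq> Pow Q"
    by (auto simp: U.small_sets_def U.sh_def Q_def)
  then have "card {A \<in> U.small_sets. U.sh A \<subseteq> G} \<le> card (Pow Q)" using finQ by (intro card_mono) auto
  also have "\<dots> = 2 ^ card Q" using finQ by (rule card_Pow)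
  also have "\<dots> \<le> 2 ^ card G" using \<open>card Q \<le> card G\<close> by (intro power_increasing) auto
  finally show ?thesis unfolding LW.wt_def by (metis of_nat_le_iff of_nat_numeral of_nat_power)
qed

text \<open>For small G, one half of the exponent is at least n^2/16 because the shadow contains
  that of \<open>shade a\<close>, and the other half goes into the geometric series. Large G are
  left to the certificates.\<close>

lemma second_polymer_sum_le:
  assumes a: "a \<in> Hi"
  shows "(\<Sum>G\<in>{G. G \<subseteq> Lo \<and> conn L.lk x G \<and> shade a \<subseteq> G}. LW.wt G * 2 powr (- real (card (U.sh G))))
    \<le> 2 powr (- (real n ^ 2 / 16)) * (2 * rho n) + big_err n"
proof -
  let ?f = "\<lambda>G. LW.wt G * 2 powr (- real (card (U.sh G)))"
  let ?A = "{G. G \<subseteq> Lo \<and> conn L.lk x G \<and> shade a \<subseteq> G}"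
  let ?S = "{G. G \<subseteq> Lo \<and> conn L.lk x G \<and> card (U.sh G) < n ^ 4}"
  let ?B = "{G. G \<subseteq> Lo \<and> conn L.lk x G \<and> n ^ 4 \<le> card (U.sh G)}"
  have fin: "finite ?A" "finite ?S" "finite ?B"
    by (rule finite_subset[of _ "Pow (Lo)"]; use L.finX in auto)+
  have "sum ?f ?A \<le> sum ?f ((?A \<inter> ?S) \<union> ?B)"
    using fin LW.wt_nonneg by (intro sum_mono2) auto
  also have "\<dots> \<le> sum ?f (?A \<inter> ?S) + sum ?f ?B"
    using fin LW.wt_nonneg by (subst sum.union_disjoint) auto
  also have "sum ?f (?A \<inter> ?S) \<le> (\<Sum>G\<in>?A \<inter> ?S. 2 powr (- (real n ^ 2 / 16)) * (2 ^ card G * 2 powr (- (card (U.sh G) / 2))))"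
  proof (rule sum_mono)
    fix G assume G: "G \<in> ?A \<inter> ?S"
    have "U.sh (shade a) \<subseteq> U.sh G" using G by (intro U.sh_mono) auto
    then have "card (U.sh (shade a)) \<le> card (U.sh G)" using G by (intro card_mono L.finite_sh) auto
    then have "real n ^ 2 / 16 \<le> card (U.sh G) / 2" using card_sh_shade_ge[OF a] by simp
    then have "2 powr (- real (card (U.sh G))) \<le> 2 powr (- (real n ^ 2 / 16) + - (card (U.sh G) / 2))"
      by (intro powr_mono) auto
    also have "\<dots> = 2 powr (- (real n ^ 2 / 16)) * 2 powr (- (card (U.sh G) / 2))" by (rule powr_add)
    finally have "?f G \<le> 2 ^ card G * (2 powr (- (real n ^ 2 / 16)) * 2 powr (- (card (U.sh G) / 2)))"
      using wt_le_power[of G] G by (intro mult_mono) auto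
    then show "?f G \<le> 2 powr (- (real n ^ 2 / 16)) * (2 ^ card G * 2 powr (- (card (U.sh G) / 2)))"
      by (simp only: mult_ac)
  qed
  also have "\<dots> = 2 powr (- (real n ^ 2 / 16)) * (\<Sum>G\<in>?A \<inter> ?S. 2 ^ card G * 2 powr (- (card (U.sh G) / 2)))"
    by (simp only: sum_distrib_left)
  also have "\<dots> \<le> 2 powr (- (real n ^ 2 / 16)) * (2 * rho n)"
  proof (rule mult_left_mono)
    have "(\<Sum>G\<in>?A \<inter> ?S. 2 ^ card G * 2 powr (- (card (U.sh G) / 2)))
      \<le> (\<Sum>G\<in>?S. 2 ^ card G * 2 powr (- (card (U.sh G) / 2)))"
      using fin by (intro sum_mono2) auto
    also have "\<dots> \<le> 2 * rho n" by (rule L.small_polymer_sum_le[OF rho(1)])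
    finally show "(\<Sum>G\<in>?A \<inter> ?S. 2 ^ card G * 2 powr (- (card (U.sh G) / 2))) \<le> 2 * rho n" .
  qed simp
  also have "sum ?f ?B \<le> big_err n"
    using LW.big_polymer_sum_le[OF large(2) card_layer_le, of x "n ^ 4"] big_err_ge[of "k - 1" n] nk
    by linarith
  finally show ?thesis by simp
qed

text \<open>When all top components of D are small, so are those of any subfamily, in particular of
  the family above G. Hence the admissible families are among those counted by
  \<open>LW.wt G\<close>.\<close>

lemma small_top_count:
  assumes a: "a \<in> Hi"
  shows "real (card {D \<in> Ds. a \<in> D \<and> D \<inter> Hi \<in> U.small_sets})
    \<le> (2 powr (- (real n ^ 2 / 16)) * (2 * rho n) + big_err n) * Z"
    (is "real (card ?E) \<le> _")
proof -
  have fina: "finite a" and ca: "card a = k" using a finite_in_layer by (auto simp: layer_iff)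
  have "card (shade a) = k" by (rule U.card_N[OF a])
  then obtain x where x: "x \<in> shade a" using ik by fastforce
  let ?B = "{G. G \<subseteq> Lo \<and> conn L.lk x G \<and> shade a \<subseteq> G}"
  let ?C = "\<lambda>G. {A \<in> U.small_sets. U.sh A \<subseteq> G}"
  let ?F = "\<lambda>G A. {D \<in> Ds. x \<in> D \<inter> Lo \<and> component L.lk (D \<inter> Lo) x = G
      \<and> {b \<in> D \<inter> Hi. shade b \<subseteq> G} = A}"
  have finB: "finite ?B" by (rule finite_subset[of _ "Pow (Lo)"]) (use L.finX in auto)
  have finC: "finite (?C G)" for G using LW.finI by simp
  have finF: "finite (?F G A)" for G A using finite_Ds by simp
  have "?E \<subseteq> (\<Union>G\<in>?B. \<Union>A\<in>?C G. ?F G A)"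
  proof
    fix D assume "D \<in> ?E"
    then have D: "D \<in> Ds" "a \<in> D" "D \<inter> Hi \<in> U.small_sets" by blast+
    have "shade a \<subseteq> D" using Ds_shade[OF D(1,2)] ca ik by simp
    moreover have shl: "shade a \<subseteq> Lo" by (rule U.N_sub[OF a])
    ultimately have shD: "shade a \<subseteq> D \<inter> Lo" by blast
    then have xD: "x \<in> D \<inter> Lo" using x by blast
    define G where "G = component L.lk (D \<inter> Lo) x"
    define A where "A = {b \<in> D \<inter> Hi. shade b \<subseteq> G}"
    have "shade a \<subseteq> G"
    proof
      fix w assume w: "w \<in> shade a"
      have "shade x \<inter> shade w \<noteq> {}" using shades_meet[OF fina _ x w] ca ik by simp
      then have "(x, w) \<in> L.lk" unfolding L.lk_def using shl x w by blast
      moreover have "w \<in> D \<inter> Lo" using shD w by blast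
      ultimately show "w \<in> G" unfolding G_def using component_closed[OF xD self_in_component] by blast
    qed
    moreover have "G \<subseteq> Lo" using component_subset[OF xD, of L.lk] unfolding G_def by blast
    moreover have "conn L.lk x G" unfolding G_def by (rule conn_component[OF xD])
    ultimately have GB: "G \<in> ?B" by blast
    have AD: "A \<subseteq> D \<inter> Hi" by (auto simp: A_def)
    have "card (U.sh (component U.lk A b)) < n ^ 4" if b: "b \<in> A" for b
    proof -
      have bD: "b \<in> D \<inter> Hi" using AD b by blast
      have "component U.lk (D \<inter> Hi) b \<subseteq> Hi" using component_subset[OF bD, of U.lk] by blast
      then have "card (U.sh (component U.lk A b)) \<le> card (U.sh (component U.lk (D \<inter> Hi) b))"
        by (intro card_mono U.finite_sh U.sh_mono component_mono[OF AD])
      also have "\<dots> < n ^ 4" using D(3) bD by (simp add: U.small_sets_def)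
      finally show ?thesis .
    qed
    then have "A \<in> U.small_sets" using AD by (auto simp: U.small_sets_def)
    moreover have "U.sh A \<subseteq> G" by (auto simp: U.sh_def A_def)
    ultimately have "A \<in> ?C G" by blast
    moreover have "D \<in> ?F G A" using D(1) xD G_def A_def by blast
    ultimately show "D \<in> (\<Union>G\<in>?B. \<Union>A\<in>?C G. ?F G A)" using GB by blast
  qed
  then have "card ?E \<le> card (\<Union>G\<in>?B. \<Union>A\<in>?C G. ?F G A)"
    by (rule card_mono[rotated]) (intro finite_UN_I finB finC finF)
  then have "real (card ?E) \<le> card (\<Union>G\<in>?B. \<Union>A\<in>?C G. ?F G A)" by simp
  also have "\<dots> \<le> (\<Sum>G\<in>?B. real (card (\<Union>A\<in>?C G. ?F G A)))" by (rule real_card_UN_le[OF finB])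
  also have "\<dots> \<le> (\<Sum>G\<in>?B. LW.wt G * 2 powr (- real (card (U.sh G))) * Z)"
  proof (rule sum_mono)
    fix G
    have "real (card (\<Union>A\<in>?C G. ?F G A)) \<le> (\<Sum>A\<in>?C G. real (card (?F G A)))" by (rule real_card_UN_le[OF finC])
    also have "\<dots> \<le> (\<Sum>A\<in>?C G. 2 powr (- real (card (U.sh G))) * Z)"
      by (intro sum_mono card_le_powr_mult[OF second_removal])
    also have "\<dots> = LW.wt G * 2 powr (- real (card (U.sh G))) * Z" by (simp add: LW.wt_def)
    finally show "real (card (\<Union>A\<in>?C G. ?F G A)) \<le> LW.wt G * 2 powr (- real (card (U.sh G))) * Z" .
  qed
  also have "\<dots> = (\<Sum>G\<in>?B. LW.wt G * 2 powr (- real (card (U.sh G)))) * Z" by (simp only: sum_distrib_right)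
  also have "\<dots> \<le> (2 powr (- (real n ^ 2 / 16)) * (2 * rho n) + big_err n) * Z"
    by (rule mult_right_mono[OF second_polymer_sum_le[OF a]]) simp
  finally show ?thesis .
qed

text \<open>Downsets missing the top level are the downsets of the remaining levels. Any other has a
  large top component, or has small ones only and contains some a.\<close>

theorem card_downsets_peel:
  "Z \<le> real (card (downsets (levels n i (k - 1)))) + err n * Z"
proof -
  let ?e = "2 powr (- (real n ^ 2 / 16)) * (2 * rho n) + big_err n"
  let ?T = "{D \<in> Ds. D \<inter> Hi \<noteq> {}}"
  let ?B = "{D \<in> Ds. \<exists>a\<in>D \<inter> Hi. n ^ 4 \<le> card (U.sh (component U.lk (D \<inter> Hi) a))}"
  let ?Sm = "\<lambda>a. {D \<in> Ds. a \<in> D \<and> D \<inter> Hi \<in> U.small_sets}"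
  have "D \<in> ?B \<or> D \<in> (\<Union>a\<in>Hi. ?Sm a)" if D: "D \<in> ?T" for D
  proof (cases "D \<in> ?B")
    case False
    then have "D \<inter> Hi \<in> U.small_sets" using D by (auto simp: U.small_sets_def not_le)
    then show ?thesis using D by blast
  qed simp
  then have "?T \<subseteq> ?B \<union> (\<Union>a\<in>Hi. ?Sm a)" by blast
  then have "card ?T \<le> card (?B \<union> (\<Union>a\<in>Hi. ?Sm a))"
    using finite_Ds U.finX by (intro card_mono) auto
  also have "\<dots> \<le> card ?B + card (\<Union>a\<in>Hi. ?Sm a)" by (rule card_Un_le)
  finally have "real (card ?T) \<le> card ?B + real (card (\<Union>a\<in>Hi. ?Sm a))" by linarith
  also have "real (card (\<Union>a\<in>Hi. ?Sm a)) \<le> (\<Sum>a\<in>Hi. real (card (?Sm a)))"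
    by (rule real_card_UN_le[OF U.finX])
  also have "\<dots> \<le> (\<Sum>a\<in>Hi. ?e * Z)" by (rule sum_mono[OF small_top_count])
  also have "\<dots> = card (Hi) * (?e * Z)" by simp
  also have "\<dots> \<le> 2 ^ n * (?e * Z)"
  proof (rule mult_right_mono)
    show "real (card (Hi)) \<le> 2 ^ n"
      using card_layer_le[of n k] by (metis of_nat_le_iff of_nat_numeral of_nat_power)
  qed (simp add: rho_def big_err_def)
  also note big_top_count
  finally have T: "real (card ?T) \<le> err n * Z" by (simp add: err_def algebra_simps)
  have "Ds = ?T \<union> downsets (levels n i (k - 1))"
  proof (intro equalityI subsetI)
    fix D assume D: "D \<in> Ds"
    show "D \<in> ?T \<union> downsets (levels n i (k - 1))"
    proof (cases "D \<inter> Hi = {}")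
      case True
      have "z \<in> levels n i (k - 1)" if z: "z \<in> D" for z
      proof -
        have "z \<notin> Hi" using True z by blast
        then have "card z \<noteq> k" using Ds_layerI[OF D z] by blast
        then show ?thesis using Ds_sub[OF D z] by (auto simp: levels_def)
      qed
      then have "D \<subseteq> levels n i (k - 1)" by blast
      moreover have "z' \<in> D" if "z \<in> D" "z' \<in> levels n i (k - 1)" "z' \<subseteq> z" for z z'
        using downD[OF D that(1,3)] that(2) by (simp add: levels_def)
      ultimately have "D \<in> downsets (levels n i (k - 1))" unfolding downsets_def by blast
      then show ?thesis by simp
    qed (use D in simp)
  next
    fix D assume "D \<in> ?T \<union> downsets (levels n i (k - 1))"
    then consider "D \<in> Ds" | "D \<in> downsets (levels n i (k - 1))" by blast
    then show "D \<in> Ds"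
    proof cases
      case 2
      then have sub: "D \<subseteq> levels n i (k - 1)" by (simp add: downsets_def)
      have "z' \<in> D" if z: "z \<in> D" "z' \<in> levels n i k" "z' \<subseteq> z" for z z'
      proof -
        have zl: "z \<subseteq> {1..n}" "card z \<le> k - 1" using sub z by (auto simp: levels_def)
        then have "card z' \<le> card z" using z finite_subset[OF zl(1)] by (intro card_mono) auto
        then have "z' \<in> levels n i (k - 1)" using z zl by (auto simp: levels_def)
        then show ?thesis using 2 z(1,3) unfolding downsets_def by blast
      qed
      moreover have "levels n i (k - 1) \<subseteq> levels n i k" by (auto simp: levels_def)
      ultimately show ?thesis using sub unfolding downsets_def by blast
    qed
  qed
  then have "card Ds = card (?T \<union> downsets (levels n i (k - 1)))" by (rule arg_cong)
  also have "\<dots> \<le> card ?T + card (downsets (levels n i (k - 1)))" by (rule card_Un_le)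
  finally show ?thesis using T by linarith
qed

end

section \<open>The central layers\<close>

lemma eventually_rho_small: "eventually (\<lambda>n. rho n \<le> 1 / 2 \<and> 2 * real n ^ 3 * rho n \<le> ln 2) sequentially"
proof -
  have lims: "(\<lambda>n. 2 * real n ^ 3 * rho n) \<longlonglongrightarrow> 0" "rho \<longlonglongrightarrow> 0"
    unfolding rho_def by real_asymp+
  have "eventually (\<lambda>n. 2 * real n ^ 3 * rho n < ln 2) sequentially"
    by (rule order_tendstoD(2)[OF lims(1)]) simp
  moreover have "eventually (\<lambda>n. rho n < 1 / 2) sequentially"
    by (rule order_tendstoD(2)[OF lims(2)]) simp
  ultimately show ?thesis by eventually_elim auto
qed

text \<open>From ln 2 >= 2/3, the factor 2^-(n^2/16) is at most exp(-n^2/24); the drop to n^2/40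
  absorbs 2^n and the polynomial factors.\<close>

lemma eventually_err_small: "eventually (\<lambda>n. 4 * real n * err n \<le> exp (- (real n ^ 2 / 40))) sequentially"
proof -
  have "eventually (\<lambda>n::nat. 4 * real n * (2 powr n * (2 * ((2 powr n + 1) * (3 * real (n + 1) ^ 16 * 2 powr (- (real n ^ 3 / 2))))))
      \<le> exp (- (real n ^ 2 / 40)) / 2) sequentially"
    by real_asymp
  moreover have "eventually (\<lambda>n::nat. 4 * real n * (2 powr n * exp (- (real n ^ 2 / 24)))
      \<le> exp (- (real n ^ 2 / 40)) / 2) sequentially"
    by real_asymp
  ultimately show ?thesis using eventually_rho_small
  proof eventually_elim
    case (elim n)
    have "2 / 3 * (real n ^ 2 / 16) \<le> ln 2 * (real n ^ 2 / 16)"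
      by (rule mult_right_mono[OF ln2_ge_two_thirds]) simp
    then have "2 powr (- (real n ^ 2 / 16)) \<le> exp (- (real n ^ 2 / 24))" by (simp add: powr_def mult.commute)
    then have "2 powr (- (real n ^ 2 / 16)) * (2 * rho n) \<le> exp (- (real n ^ 2 / 24)) * 1"
      using elim(3) by (intro mult_mono) (auto simp: rho_def)
    then have "4 * real n * (2 ^ n * (2 powr (- (real n ^ 2 / 16)) * (2 * rho n)))
        \<le> 4 * real n * (2 powr n * exp (- (real n ^ 2 / 24)))"
      by (intro mult_left_mono) (auto simp: powr_realpow)
    moreover have "4 * real n * err n = 4 * real n * (2 powr n * (2 * ((2 powr n + 1) * (3 * real (n + 1) ^ 16 * 2 powr (- (real n ^ 3 / 2))))))
      + 4 * real n * (2 ^ n * (2 powr (- (real n ^ 2 / 16)) * (2 * rho n)))"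
      by (simp only: err_def big_err_def powr_realpow[of 2, simplified] distrib_left)
    ultimately show ?case using elim(1,2) by linarith
  qed
qed

lemma eventually_large_levels:
  "eventually (\<lambda>n. \<forall>k. n + 4 \<le> 2 * k \<longrightarrow> large k \<and> large (k - 1)) sequentially"
proof -
  obtain d0 where d0: "\<And>d. d \<ge> d0 \<Longrightarrow> large d"
    using eventually_large by (auto simp: eventually_sequentially)
  have "\<forall>k. n + 4 \<le> 2 * k \<longrightarrow> large k \<and> large (k - 1)" if "n \<ge> 2 * d0" for n
    using that by (auto intro!: d0)
  then show ?thesis by (auto simp: eventually_sequentially)
qed

text \<open>Complementation reverses inclusion and preserves antichains; with it, peeling from below
  becomes peeling from above.\<close>

lemma num_antichains_complement:
  assumes P: "P \<subseteq> Pow U"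
  shows "num_antichains ((\<lambda>A. U - A) ` P) = num_antichains P"
proof -
  let ?c = "\<lambda>A. U - A"
  have cc: "?c (?c A) = A" if "A \<in> P" for A using that P by auto
  have img: "?c ` ?c ` F = F" if "F \<subseteq> P" for F
  proof -
    have "?c ` ?c ` F = (\<lambda>A. A) ` F" unfolding image_image using cc that by (intro image_cong) auto
    then show ?thesis by simp
  qed
  have anti: "antichain (?c ` F)" if "F \<subseteq> Pow U" "antichain F" for F
    unfolding antichain_def
  proof (rule pairwiseI)
    fix A' B' assume AB': "A' \<in> ?c ` F" "B' \<in> ?c ` F" "A' \<noteq> B'"
    then obtain A B where AB: "A \<in> F" "B \<in> F" "A' = U - A" "B' = U - B" by blast
    then have "\<not> A \<subseteq> B \<and> \<not> B \<subseteq> A" using that(2) AB'(3) unfolding antichain_def pairwise_def by blast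
    moreover have "A \<subseteq> U" "B \<subseteq> U" using AB(1,2) that(1) by blast+
    ultimately show "\<not> A' \<subseteq> B' \<and> \<not> B' \<subseteq> A'" unfolding AB(3,4) by blast
  qed
  have "bij_betw ((`) ?c) {F. F \<subseteq> P \<and> antichain F} {F. F \<subseteq> ?c ` P \<and> antichain F}"
  proof (rule bij_betw_byWitness[where f' = "(`) ?c"])
    show "\<forall>F\<in>{F. F \<subseteq> P \<and> antichain F}. ?c ` ?c ` F = F" using img by blast
    show "\<forall>F\<in>{F. F \<subseteq> ?c ` P \<and> antichain F}. ?c ` ?c ` F = F"
    proof
      fix F assume "F \<in> {F. F \<subseteq> ?c ` P \<and> antichain F}"
      then obtain H where "H \<subseteq> P" "F = ?c ` H" by (auto simp: subset_image_iff)
      then show "?c ` ?c ` F = F" using img[of H] by simp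
    qed
    show "(`) ?c ` {F. F \<subseteq> P \<and> antichain F} \<subseteq> {F. F \<subseteq> ?c ` P \<and> antichain F}"
      using anti P by blast
    show "(`) ?c ` {F. F \<subseteq> ?c ` P \<and> antichain F} \<subseteq> {F. F \<subseteq> P \<and> antichain F}"
    proof clarify
      fix F assume F: "F \<subseteq> ?c ` P" "antichain F"
      then have "antichain (?c ` F)" by (intro anti) auto
      moreover have "?c ` F \<subseteq> P" using image_mono[OF F(1), of ?c] img[of P] by simp
      ultimately show "?c ` F \<subseteq> P \<and> antichain (?c ` F)" by simp
    qed
  qed
  then show ?thesis unfolding num_antichains_def by (rule bij_betw_same_card[symmetric])
qed

lemma complement_levels:
  assumes "k \<le> n" "i \<le> n"
  shows "(\<lambda>A. {1..n} - A) ` levels n i k = levels n (n - k) (n - i)"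
proof -
  have c: "card ({1..n} - A) = n - card A \<and> card A \<le> n" if "A \<subseteq> {1..n}" for A
    using that card_mono[of "{1..n}" A] by (simp add: card_Diff_subset finite_subset)
  have sub: "{1..n} - A \<in> levels n (n - k) (n - i)" if "A \<in> levels n i k" for A i k
    using that c[of A] by (auto simp: levels_def)
  have "A \<in> (\<lambda>A. {1..n} - A) ` levels n i k" if A: "A \<in> levels n (n - k) (n - i)" for A
  proof (rule image_eqI)
    show "A = {1..n} - ({1..n} - A)" using A by (auto simp: levels_def)
    show "{1..n} - A \<in> levels n i k" using sub[OF A] assms by simp
  qed
  then show ?thesis using sub by blast
qed

text \<open>Each of the n - K steps loses a factor 1 - err n; the exponent is rounded up to n to
  serve both directions. All steps have k > K, where n + 2 <= 2K becomes n + 4 <= 2k.\<close>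

lemma peel_all:
  assumes large: "\<forall>k. n + 4 \<le> 2 * k \<longrightarrow> large k \<and> large (k - 1)"
    and rho: "rho n \<le> 1 / 2" "2 * real n ^ 3 * rho n \<le> ln 2" and e: "0 \<le> err n" "err n \<le> 1"
    and K: "n + 2 \<le> 2 * K" "K \<le> n" and i: "i + 1 \<le> K"
  shows "(1 - err n) ^ n * num_antichains (levels n i n) \<le> num_antichains (levels n i K)"
proof -
  let ?z = "\<lambda>k. real (num_antichains (levels n i k))"
  have step: "(1 - err n) * ?z k \<le> ?z (k - 1)" if "K < k" "k \<le> n" for k
  proof -
    interpret cube_levels n k i
      by standard (use that K i large rho in auto)
    show ?thesis using card_downsets_peel
      by (simp add: num_antichains_eq_card_downsets[OF finite_levels] algebra_simps)
  qed
  have "(1 - err n) ^ m * ?z (K + m) \<le> ?z K" if "K + m \<le> n" for m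
    using that
  proof (induction m)
    case (Suc m)
    have "(1 - err n) ^ Suc m * ?z (K + Suc m) = (1 - err n) ^ m * ((1 - err n) * ?z (K + Suc m))" by simp
    also have "\<dots> \<le> (1 - err n) ^ m * ?z (K + m)"
      using step[of "K + Suc m"] Suc.prems e by (intro mult_left_mono) auto
    also have "\<dots> \<le> ?z K" using Suc by simp
    finally show ?case .
  qed simp
  from this[of "n - K"] have "(1 - err n) ^ (n - K) * ?z n \<le> ?z K" using K by simp
  moreover have "(1 - err n) ^ n \<le> (1 - err n) ^ (n - K)" using e by (intro power_decreasing) auto
  ultimately show ?thesis by (meson mult_right_mono of_nat_0_le_iff order_trans)
qed

text \<open>The upper end (n + 1) div 2 + 1 is the smallest K with n + 2 <= 2K, precisely where
  peeling stops. For n >= 2 the truncated subtraction in the lower end is exact.\<close>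

lemma central_layers_eq:
  assumes "n \<ge> 2"
  shows "central_layers n = levels n (n - ((n + 1) div 2 + 1)) ((n + 1) div 2 + 1)"
proof -
  have fl: "\<lfloor>real n / 2\<rfloor> = int (n div 2)" by (simp add: floor_divide_of_nat_eq[of n 2, simplified])
  have ce: "\<lceil>real n / 2\<rceil> = int ((n + 1) div 2)"
  proof (rule ceiling_unique)
    have "2 * ((n + 1) div 2) < n + 2" "n \<le> 2 * ((n + 1) div 2)" by presburger+
    then have "real (2 * ((n + 1) div 2)) < real (n + 2)" "real n \<le> real (2 * ((n + 1) div 2))"
      by (simp_all only: of_nat_less_iff of_nat_le_iff)
    then show "real_of_int (int ((n + 1) div 2)) - 1 < real n / 2" "real n / 2 \<le> real_of_int (int ((n + 1) div 2))"
      by simp_all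
  qed
  have "int (n div 2) - 1 = int (n - ((n + 1) div 2 + 1))" using assms by presburger
  then show ?thesis unfolding central_layers_def levels_def boolean_lattice_def fl ce by auto
qed

lemma num_antichains_sandwich:
  assumes n: "n \<ge> 6"
    and large: "\<forall>k. n + 4 \<le> 2 * k \<longrightarrow> large k \<and> large (k - 1)"
    and rho: "rho n \<le> 1 / 2" "2 * real n ^ 3 * rho n \<le> ln 2"
    and e: "4 * real n * err n \<le> 1"
  shows "real (psi n) \<le> (1 + 4 * real n * err n) * num_antichains (central_layers n)"
    and "num_antichains (central_layers n) < psi n"
proof -
  define K where "K = (n + 1) div 2 + 1"
  have K: "n + 2 \<le> 2 * K" "K \<le> n" and K2: "2 * K \<le> n + 3" using n by (auto simp: K_def)
  have e0: "0 \<le> err n" by (simp add: err_def big_err_def rho_def)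
  have "1 * err n \<le> 4 * real n * err n" using n e0 by (intro mult_right_mono) auto
  then have e1: "err n \<le> 1" using e by simp
  have psi: "psi n = num_antichains (levels n 0 n)"
  proof -
    have "boolean_lattice n = levels n 0 n"
      using card_mono[of "{1..n}"] by (auto simp: boolean_lattice_def levels_def)
    then show ?thesis by (simp add: psi_def)
  qed
  have central: "central_layers n = levels n (n - K) K" using central_layers_eq n by (simp add: K_def)
  let ?q = "(1 - err n) ^ n" and ?c = "real (num_antichains (central_layers n))"
  have top: "?q * psi n \<le> num_antichains (levels n 0 K)"
    unfolding psi using K by (intro peel_all large rho e0 e1) auto
  have "levels n 0 K \<subseteq> Pow {1..n}" by (auto simp: levels_def)
  \<comment> \<open>The band from 0 to K is reflected to the band from n - K to n, whose top can be
    peeled again down to K.\<close>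
  then have "num_antichains (levels n 0 K) = num_antichains (levels n (n - K) n)"
    using num_antichains_complement[of "levels n 0 K" "{1..n}"]
    unfolding complement_levels[OF K(2) le0] by simp
  then have "?q * num_antichains (levels n 0 K) \<le> ?c"
    unfolding central using K by (simp only:) (intro peel_all large rho e0 e1; simp)
  moreover have "?q * (?q * psi n) \<le> ?q * num_antichains (levels n 0 K)"
    using top e1 by (intro mult_left_mono) auto
  moreover have "?q * ?q = (1 - err n) ^ (2 * n)" by (simp add: power_add[symmetric] mult_2)
  ultimately have A: "(1 - err n) ^ (2 * n) * psi n \<le> ?c" by (simp add: mult.assoc[symmetric])
  define t where "t = 2 * real n * err n"
  have t: "0 \<le> t" "t \<le> 1 / 2" using e e0 by (auto simp: t_def)
  have "1 - t \<le> (1 - err n) ^ (2 * n)"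
    using Bernoulli_inequality[of "- err n" "2 * n"] e1 by (simp add: t_def)
  then have "(1 - t) * psi n \<le> ?c" using A by (meson mult_right_mono of_nat_0_le_iff order_trans)
  \<comment> \<open>1/(1 - t) <= 1 + 2t for t <= 1/2, which turns 2 n err n into 4 n err n.\<close>
  moreover have "1 \<le> (1 + 2 * t) * (1 - t)"
  proof -
    have "0 \<le> t * (1 - 2 * t)" using t by (intro mult_nonneg_nonneg) auto
    then show ?thesis by (simp add: algebra_simps)
  qed
  then have "1 * real (psi n) \<le> (1 + 2 * t) * (1 - t) * psi n" by (intro mult_right_mono) auto
  moreover have "(1 + 2 * t) * ((1 - t) * psi n) \<le> (1 + 2 * t) * ?c" if "(1 - t) * psi n \<le> ?c"
    using that t by (intro mult_left_mono) auto
  ultimately have "real (psi n) \<le> (1 + 2 * t) * ?c" by (metis mult.assoc mult_1 order_trans)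
  then show "real (psi n) \<le> (1 + 4 * real n * err n) * ?c" by (simp add: t_def mult.assoc)
  \<comment> \<open>Strictness makes the relative error positive, so that its logarithm is
    meaningful. The witness is the antichain consisting of the empty set alone.\<close>
  have "{F. F \<subseteq> central_layers n \<and> antichain F} \<subset> {F. F \<subseteq> boolean_lattice n \<and> antichain F}"
  proof
    show "{F. F \<subseteq> central_layers n \<and> antichain F} \<subseteq> {F. F \<subseteq> boolean_lattice n \<and> antichain F}"
      by (auto simp: central_layers_def)
    have "{} \<notin> central_layers n" unfolding central levels_def using K2 n by auto
    then have "{{}} \<notin> {F. F \<subseteq> central_layers n \<and> antichain F}" by simp
    moreover have "{{}} \<in> {F. F \<subseteq> boolean_lattice n \<and> antichain F}"
      by (simp add: boolean_lattice_def antichain_def)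
    ultimately show "{F. F \<subseteq> central_layers n \<and> antichain F} \<noteq> {F. F \<subseteq> boolean_lattice n \<and> antichain F}"
      by metis
  qed
  then show "num_antichains (central_layers n) < psi n"
    unfolding psi_def num_antichains_def
    by (rule psubset_card_mono[rotated]) (simp add: boolean_lattice_def)
qed

theorem theorem1p7:
  "\<exists>f :: nat \<Rightarrow> real. (\<forall>n. f n \<ge> 0) \<and> f \<in> \<Omega>(\<lambda>n. real n ^ 2) \<and>
     (\<forall>\<^sub>F n in sequentially.
        real (psi n) = (1 + exp (- f n)) * real (num_antichains (central_layers n)))"
proof -
  define r where "r n = real (psi n) / real (num_antichains (central_layers n)) - 1" for n
  \<comment> \<open>\<open>f\<close> is the negative logarithm of the relative error, cut off at 0
    to be nonnegative everywhere; for large n the cut-off is inactive.\<close>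
  define f where "f n = max 0 (- ln (r n))" for n
  have "eventually (\<lambda>n. real (psi n) = (1 + r n) * real (num_antichains (central_layers n))
      \<and> 0 < r n \<and> r n \<le> exp (- (real n ^ 2 / 40))) sequentially"
    using eventually_ge_at_top[of 6] eventually_large_levels eventually_rho_small eventually_err_small
  proof eventually_elim
    case (elim n)
    have "4 * real n * err n \<le> 1" using elim(4) by (rule order_trans) simp
    note s = num_antichains_sandwich[OF elim(1,2) _ _ this]
    have "{} \<in> {F. F \<subseteq> central_layers n \<and> antichain F}" by (simp add: antichain_def)
    moreover have "finite {F. F \<subseteq> central_layers n \<and> antichain F}"
      by (rule finite_subset[of _ "Pow (Pow {1..n})"]) (auto simp: central_layers_def boolean_lattice_def)
    ultimately have c: "0 < num_antichains (central_layers n)"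
      unfolding num_antichains_def by (auto simp: card_gt_0_iff)
    have eq: "real (psi n) = (1 + r n) * real (num_antichains (central_layers n))" using c by (simp add: r_def)
    have "0 < r n" using s(2) elim(3) c by (simp add: r_def)
    moreover have "r n \<le> 4 * real n * err n" using s(1) elim(3) c unfolding eq by simp
    ultimately show ?case using eq elim(4) by linarith
  qed
  then have ev: "eventually (\<lambda>n. real (psi n) = (1 + exp (- f n)) * real (num_antichains (central_layers n))
      \<and> real n ^ 2 / 40 \<le> f n) sequentially"
  proof eventually_elim
    case (elim n)
    then have "ln (r n) \<le> - (real n ^ 2 / 40)" using ln_le_cancel_iff[of "r n" "exp (- (real n ^ 2 / 40))"] by simp
    moreover have "0 \<le> real n ^ 2 / 40" by simp
    ultimately have f: "f n = - ln (r n)" "real n ^ 2 / 40 \<le> f n" unfolding f_def by linarith+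
    then show ?case using elim by simp
  qed
  have "f \<in> \<Omega>(\<lambda>n. real n ^ 2)"
  proof (rule landau_omega.bigI[of "1 / 40"])
    show "eventually (\<lambda>n. norm (f n) \<ge> 1 / 40 * norm (real n ^ 2)) sequentially"
      using ev by eventually_elim (simp add: f_def)
  qed simp
  then show ?thesis using ev by (intro exI[of _ f]) (auto simp: f_def elim: eventually_mono)
qed

end
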